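(* Let $\omega$ be a non-quasianalytic subadditive weight function, and let $L=\frac{\partial}{\partial t}+\sum_{j=1}^{N}(a_j+ib_j)(t)\frac{\partial}{\partial x_j}$ on $\mathbb{T}^{N+1}$, with $a_j,b_j$ real-valued functions in $\mathcal{E}_{\{\omega\}}(\mathbb{T}^1)$. Then $L$ is globally $\{\omega\}$-solvable if and only if the following two conditions hold: \begin{itemize} \item for every $\xi\in\mathbb{Z}^N$ such that $t\mapsto\langle\xi,\beta(t)\rangle$ changes sign, one has $\langle\xi,\beta_0\rangle=0$, $\langle\xi,\alpha_0\rangle\in\mathbb{Z}$ and $\Omega_r^\xi$ is connected for all $r\in\mathbb{R}$; \item the pair $(\alpha_0,\beta_0)$ satisfies $(EDC)_2^{\{\omega\}}$. \end{itemize}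
   Context: $\mathbb{T}^n=(\mathbb{R}/2\pi\mathbb{Z})^n$; coordinates on $\mathbb{T}^{N+1}$ are $(t,x)=(t,x_1,\dots,x_N)$. A weight function is an increasing continuous $\omega:[0,\infty)\to[0,\infty)$ such that: there is $K\ge0$ with $\omega(2t)\le K(\omega(t)+1)$ for all $t\ge0$; $\omega(t)=O(t)$; $\log t=o(\omega(t))$ as $t\to\infty$; $\varphi(t)=\omega(e^t)$ is convex on $[0,\infty)$ (one may assume $\omega=0$ on $[0,1]$). Subadditive: $\omega(s+t)\le\omega(s)+\omega(t)$. Non-quasianalytic: $\int_1^\infty\omega(t)t^{-2}dt<\infty$. $\varphi^*(t)=\sup_{s\ge0}\{st-\varphi(s)\}$. For $\lambda>0$, $\|f\|_\lambda=\sup_{x}\sup_{\alpha}|\partial^\alpha f(x)|\exp(-\lambda\varphi^*(|\alpha|/\lambda))$; $\mathcal{E}_{\{\omega\}}(\mathbb{T}^n)=\{f\in C^\infty(\mathbb{T}^n):\|f\|_\lambda<\infty$ for some $\lambda>0\}$ with the inductive limit topology of the Banach spaces $\{f:\|f\|_{1/k}<\infty\}$, $k\in\mathbb{N}$; $\mathcal{E}'_{\{\omega\}}$ is its strong dual. ${}^tL$ is the transpose of $L$ on $\mathcal{E}'_{\{\omega\}}(\mathbb{T}^{N+1})$ (${}^tL=-L$), $(\ker{}^tL)^\circ=\{f\in\mathcal{E}_{\{\omega\}}(\mathbb{T}^{N+1}):\langle\mu,f\rangle=0\ \forall\mu\in\mathcal{E}'_{\{\omega\}}(\mathbb{T}^{N+1}),\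 {}^tL\mu=0\}$, and $L$ is globally $\{\omega\}$-solvable if $L\mathcal{E}_{\{\omega\}}(\mathbb{T}^{N+1})=(\ker{}^tL)^\circ$. Notation: $\alpha(t)=(a_1(t),\dots,a_N(t))$, $\beta(t)=(b_1(t),\dots,b_N(t))$, $\alpha_0=\frac1{2\pi}\int_0^{2\pi}\alpha$, $\beta_0=\frac1{2\pi}\int_0^{2\pi}\beta$ (componentwise means). $\Omega_r^\xi=\{t\in\mathbb{T}^1:\int_0^t\langle\xi,\beta(\tau)\rangle d\tau<r\}$. $(\alpha,\beta)\in\mathbb{R}^N\times\mathbb{R}^N$ satisfies $(EDC)_2^{\{\omega\}}$ if for every $\epsilon>0$ there is $C_\epsilon>0$ with $|\tau+\langle\xi,\alpha+i\beta\rangle|\ge C_\epsilon e^{-\epsilon\omega(|(\tau,\xi)|)}$ for all $(\tau,\xi)\in\mathbb{Z}\times\mathbb{Z}^N$ with $\tau+\langle\xi,\alpha+i\beta\rangle\ne0$. A real function changes sign if it takes both strictly positive and strictly negative values. *)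

theory Defs
  imports "HOL-Analysis.Analysis" "HOL-Library.Landau_Symbols"
begin

definition weight_function :: "(real \<Rightarrow> real) \<Rightarrow> bool" where
  "weight_function \<omega> \<longleftrightarrow>
     mono_on {0..} \<omega> \<and> continuous_on {0..} \<omega> \<and> (\<forall>t\<ge>0. \<omega> t \<ge> 0) \<and>
     (\<exists>K\<ge>0. \<forall>t\<ge>0. \<omega> (2*t) \<le> K * (\<omega> t + 1)) \<and>
     \<omega> \<in> O[at_top](\<lambda>t. t) \<and>
     ln \<in> o[at_top](\<omega>) \<and>
     convex_on {0..} (\<lambda>t. \<omega> (exp t))"

definition subadditive_weight :: "(real \<Rightarrow> real) \<Rightarrow> bool" where
  "subadditive_weight \<omega> \<longleftrightarrow> (\<forall>s\<ge>0. \<forall>t\<ge>0. \<omega> (s + t) \<le> \<omega> s + \<omega> t)"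

definition non_quasianalytic :: "(real \<Rightarrow> real) \<Rightarrow> bool" where
  "non_quasianalytic \<omega> \<longleftrightarrow> (\<lambda>t. \<omega> t / t\<^sup>2) integrable_on {1..}"

definition phi_star :: "(real \<Rightarrow> real) \<Rightarrow> real \<Rightarrow> real" where
  "phi_star \<omega> t = (SUP s\<in>{0..}. s * t - \<omega> (exp s))"

section \<open>Functions on the torus (R/2piZ)^I, realised as periodic functions on real^'i\<close>

definition pd :: "'i::finite \<Rightarrow> (real^'i \<Rightarrow> complex) \<Rightarrow> real^'i \<Rightarrow> complex" where
  "pd i f x = vector_derivative (\<lambda>s. f (x + s *\<^sub>R axis i 1)) (at 0)"

fun pds :: "'i::finite list \<Rightarrow> (real^'i \<Rightarrow> complex) \<Rightarrow> real^'i \<Rightarrow> complex" where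
  "pds [] f = f"
| "pds (i # ds) f = pd i (pds ds f)"

definition torus_periodic :: "(real^'i::finite \<Rightarrow> complex) \<Rightarrow> bool" where
  "torus_periodic f \<longleftrightarrow> (\<forall>x i. f (x + (2*pi) *\<^sub>R axis i 1) = f x)"

definition smooth_fun :: "(real^'i::finite \<Rightarrow> complex) \<Rightarrow> bool" where
  "smooth_fun f \<longleftrightarrow> (\<forall>ds. continuous_on UNIV (pds ds f) \<and>
      (\<forall>i x. (\<lambda>s. pds ds f (x + s *\<^sub>R axis i 1)) differentiable (at 0)))"

definition seminorm_set :: "(real \<Rightarrow> real) \<Rightarrow> real \<Rightarrow> (real^'i::finite \<Rightarrow> complex) \<Rightarrow> real set" where
  "seminorm_set \<omega> lam f = {cmod (pds ds f x) * exp (- lam * phi_star \<omega> (real (length ds) / lam)) | x ds. True}"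

definition norm_lam :: "(real \<Rightarrow> real) \<Rightarrow> real \<Rightarrow> (real^'i::finite \<Rightarrow> complex) \<Rightarrow> real" where
  "norm_lam \<omega> lam f = Sup (seminorm_set \<omega> lam f)"

definition E_lam :: "(real \<Rightarrow> real) \<Rightarrow> real \<Rightarrow> (real^'i::finite \<Rightarrow> complex) \<Rightarrow> bool" where
  "E_lam \<omega> lam f \<longleftrightarrow> torus_periodic f \<and> smooth_fun f \<and> bdd_above (seminorm_set \<omega> lam f)"

definition E_omega :: "(real \<Rightarrow> real) \<Rightarrow> (real^'i::finite \<Rightarrow> complex) \<Rightarrow> bool" where
  "E_omega \<omega> f \<longleftrightarrow> (\<exists>lam>0. E_lam \<omega> lam f)"

text \<open>Ultradistributions: linear functionals on E_omega that are continuous for the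
  inductive limit topology, i.e. continuous on each step E_{1/k}.\<close>
definition E_dual :: "(real \<Rightarrow> real) \<Rightarrow> ((real^'i::finite \<Rightarrow> complex) \<Rightarrow> complex) \<Rightarrow> bool" where
  "E_dual \<omega> \<mu> \<longleftrightarrow>
     (\<forall>f g. E_omega \<omega> f \<longrightarrow> E_omega \<omega> g \<longrightarrow> \<mu> (\<lambda>x. f x + g x) = \<mu> f + \<mu> g) \<and>
     (\<forall>f c. E_omega \<omega> f \<longrightarrow> \<mu> (\<lambda>x. c * f x) = c * \<mu> f) \<and>
     (\<forall>k::nat. k \<ge> 1 \<longrightarrow> (\<exists>C. \<forall>f. E_lam \<omega> (1 / real k) f \<longrightarrow>
         cmod (\<mu> f) \<le> C * norm_lam \<omega> (1 / real k) f))"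

text \<open>Global {omega}-solvability: L(E) = (ker tL)^circ, where tL mu = mu o L (transpose).\<close>
definition globally_solvable ::
  "(real \<Rightarrow> real) \<Rightarrow> ((real^'i::finite \<Rightarrow> complex) \<Rightarrow> (real^'i \<Rightarrow> complex)) \<Rightarrow> bool" where
  "globally_solvable \<omega> Lop \<longleftrightarrow>
     {Lop g | g. E_omega \<omega> g} =
     {f. E_omega \<omega> f \<and> (\<forall>\<mu>. E_dual \<omega> \<mu> \<longrightarrow> (\<forall>g. E_omega \<omega> g \<longrightarrow> \<mu> (Lop g) = 0) \<longrightarrow> \<mu> f = 0)}"

section \<open>The operator on T^{N+1}: coordinate None is t, coordinate Some j is x_j\<close>

definition L_op :: "('n::finite \<Rightarrow> real \<Rightarrow> real) \<Rightarrow> ('n \<Rightarrow> real \<Rightarrow> real) \<Rightarrow>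
    (real^('n option) \<Rightarrow> complex) \<Rightarrow> real^('n option) \<Rightarrow> complex" where
  "L_op a b f p = pd None f p +
     (\<Sum>j\<in>UNIV. (complex_of_real (a j (p $ None)) + \<i> * complex_of_real (b j (p $ None)))
                  * pd (Some j) f p)"

definition mean :: "(real \<Rightarrow> real) \<Rightarrow> real" where
  "mean g = integral {0..2*pi} g / (2*pi)"

definition changes_sign :: "(real \<Rightarrow> real) \<Rightarrow> bool" where
  "changes_sign g \<longleftrightarrow> (\<exists>t. g t > 0) \<and> (\<exists>t. g t < 0)"

text \<open>Omega_r^xi as a subset of the circle T^1, realised as the unit circle in C.\<close>
definition Omega_set :: "('n::finite \<Rightarrow> real \<Rightarrow> real) \<Rightarrow> ('n \<Rightarrow> int) \<Rightarrow> real \<Rightarrow> complex set" where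
  "Omega_set b \<xi> r = cis ` {t \<in> {0..2*pi}. integral {0..t} (\<lambda>\<tau>. \<Sum>j\<in>UNIV. of_int (\<xi> j) * b j \<tau>) < r}"

definition EDC2 :: "(real \<Rightarrow> real) \<Rightarrow> ('n::finite \<Rightarrow> real) \<Rightarrow> ('n \<Rightarrow> real) \<Rightarrow> bool" where
  "EDC2 \<omega> \<alpha> \<beta> \<longleftrightarrow> (\<forall>\<epsilon>>0. \<exists>C>0. \<forall>(\<tau>::int) (\<xi>::'n \<Rightarrow> int).
     let z = of_int \<tau> + (\<Sum>j\<in>UNIV. of_int (\<xi> j) * (complex_of_real (\<alpha> j) + \<i> * complex_of_real (\<beta> j)))
     in z \<noteq> 0 \<longrightarrow>
        cmod z \<ge> C * exp (- \<epsilon> * \<omega> (sqrt (real_of_int \<tau>^2 + (\<Sum>j\<in>UNIV. real_of_int (\<xi> j)^2)))))"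

end

theory Submission
  imports Defs
begin

text \<open>
  Membership in \<open>E_omega\<close> means that the Fourier coefficients decay like \<open>exp (- \<epsilon> * \<omega> \<bar>k\<bar>)\<close> for some
  \<open>\<epsilon> > 0\<close>. A partial Fourier transform in \<open>x\<close> therefore turns \<open>L u = f\<close> into the family of equations
  \<open>u' + \<i> * c * u = f\<close> on the circle, with \<open>c = \<langle>\<xi>, \<alpha> + \<i> * \<beta>\<rangle>\<close>, and bounded solutions whose sup norms grow at most
  like \<open>exp (\<epsilon> * \<omega> \<bar>\<xi>\<bar>)\<close> for every \<open>\<epsilon>\<close> have Fourier coefficients in \<open>\<tau>\<close> with the required decay.
  The integrating factor \<open>exp (\<i> * \<integral>c)\<close> solves each of these equations, uniquely unless
  \<open>\<langle>\<xi>, \<alpha>\<^sub>0 + \<i> * \<beta>\<^sub>0\<rangle>\<close> is an integer.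

  If \<open>\<langle>\<xi>, \<beta>\<rangle>\<close> has constant sign, one integrates in the direction in which the kernel is at most \<open>1\<close>, and the
  condition \<open>EDC2\<close> bounds the small divisors. If it changes sign, connectedness of the sublevel sets provides,
  for every \<open>t\<close>, a path on the circle to a maximum point of the primitive along which the kernel is at most \<open>1\<close>.

  Conversely, solvability forces the fibre solutions to be bounded uniformly in \<open>\<xi>\<close>. When one of the conditions fails,
  multiples \<open>k * \<xi>\<close> of a single frequency carry right-hand sides with trigonometric polynomial amplitudes whose
  solutions grow exponentially in \<open>k\<close>, which beats every \<open>exp (\<epsilon> * \<omega> (k * \<bar>\<xi>\<bar>))\<close> with small \<open>\<epsilon>\<close>; for \<open>EDC2\<close>, solutions of
  homogeneous equations with shifted symbol serve as right-hand sides.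
\<close>

text \<open>Uniformity in \<xi> is the obstacle throughout. In a fibre equation the coefficient has
  size \<open>l1 \<xi>\<close>, so smoothness of a solution in \<open>t\<close> must be recovered
  with a loss below \<open>exp (\<epsilon> * \<omega> (l1 \<xi>))\<close> for any prescribed
  \<epsilon>. An absorption argument on Fourier coefficients achieves this; subadditivity makes
  \<open>exp (\<eta> * \<omega>)\<close> a submultiplicative weight. The same estimate, applied to
  homogeneous equations, places oscillating factors such as \<open>exp (- \<i> * A)\<close> in the
  class with controlled constants. The converse depends on them: the integrating factor oscillates
  at a rate proportional to \<xi>, and its integrals have no useful lower bound until the right-hand
  side cancels that phase. If \<open>\<langle>\<xi>, \<alpha>\<^sub>0\<rangle>\<close> is not an
  integer, periodicity permits cancellation only up to a slow rotation; the difference of two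
  neighbouring integer phases leaves a kernel whose real part is positive inside one period after a
  constant rotation. That test right-hand sides lie in the annihilator follows by approximation with
  finitely many fibres, not from a description of all functionals.\<close>

definition l1 :: "('i::finite \<Rightarrow> int) \<Rightarrow> real" where
  "l1 k = (\<Sum>i\<in>UNIV. \<bar>real_of_int (k i)\<bar>)"

lemma l1_nonneg [simp]: "l1 k \<ge> 0"
  by (simp add: l1_def sum_nonneg)

lemma l1_ge_coord: "\<bar>real_of_int (k i)\<bar> \<le> l1 k"
  unfolding l1_def by (rule member_le_sum) auto

lemma l1_add_le: "l1 (\<lambda>i. k i + l i) \<le> l1 k + l1 l"
  unfolding l1_def sum.distrib [symmetric] by (rule sum_mono) auto

lemma l1_ge_1:
  assumes "k \<noteq> (\<lambda>i. 0)"
  shows "l1 k \<ge> 1"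
proof -
  obtain i where "k i \<noteq> 0" using assms by (auto simp: fun_eq_iff)
  then have "1 \<le> \<bar>real_of_int (k i)\<bar>" by linarith
  then show ?thesis using l1_ge_coord [of k i] by linarith
qed

text \<open>Pure derivatives in one variable control only one coordinate of the frequency; the
  largest coordinate turns this into control of \<open>l1 k\<close>.\<close>

lemma l1_le_card_coord: "\<exists>i. l1 k \<le> real CARD('i) * \<bar>real_of_int (k i)\<bar>" for k :: "'i::finite \<Rightarrow> int"
proof -
  obtain i where i: "\<And>j. \<bar>real_of_int (k j)\<bar> \<le> \<bar>real_of_int (k i)\<bar>"
  proof -
    have "Max (range (\<lambda>j. \<bar>real_of_int (k j)\<bar>)) \<in> range (\<lambda>j. \<bar>real_of_int (k j)\<bar>)"
      by (rule Max_in) auto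
    then obtain i where "Max (range (\<lambda>j. \<bar>real_of_int (k j)\<bar>)) = \<bar>real_of_int (k i)\<bar>"
      unfolding image_iff by blast
    then have "\<bar>real_of_int (k j)\<bar> \<le> \<bar>real_of_int (k i)\<bar>" for j
      by (metis Max_ge finite_class.finite_UNIV finite_imageI rangeI)
    then show ?thesis using that by blast
  qed
  have "l1 k \<le> (\<Sum>j\<in>(UNIV::'i set). \<bar>real_of_int (k i)\<bar>)"
    unfolding l1_def by (rule sum_mono) (rule i)
  then show ?thesis by auto
qed

text \<open>The correction \<open>2 / (real m + 1)\<close> lets the induction close: the two new
  terms lie below the telescoping difference \<open>2 / (m + 1) - 2 / (m + 2)\<close>.\<close>

lemma sum_inverse_squares_int_le: "(\<Sum>n\<in>{-int m..int m}. 1 / (1 + \<bar>real_of_int n\<bar>)\<^sup>2) \<le> 3 - 2 / (real m + 1)"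
proof (induction m)
  case (Suc m)
  have "{-int (Suc m)..int (Suc m)} = insert (int (Suc m)) (insert (- int (Suc m)) {-int m..int m})"
    by auto
  then have "(\<Sum>n\<in>{-int (Suc m)..int (Suc m)}. 1 / (1 + \<bar>real_of_int n\<bar>)\<^sup>2)
     = 2 / (real m + 2)\<^sup>2 + (\<Sum>n\<in>{-int m..int m}. 1 / (1 + \<bar>real_of_int n\<bar>)\<^sup>2)"
    by (simp add: algebra_simps)
  also have "\<dots> \<le> 2 / (real m + 2)\<^sup>2 + (3 - 2 / (real m + 1))"
    using Suc by simp
  also have "\<dots> \<le> 3 - 2 / (real (Suc m) + 1)"
  proof -
    have "2 / (real m + 2)\<^sup>2 \<le> 2 / ((real m + 1) * (real m + 2))"
      by (rule divide_left_mono) (auto simp: power2_eq_square)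
    also have "\<dots> = 2 / (real m + 1) - 2 / (real m + 2)"
      by (simp add: field_simps)
    finally show ?thesis by (simp add: algebra_simps)
  qed
  finally show ?case .
qed simp

text \<open>\<open>1 + l1 k\<close> dominates every \<open>1 + \<bar>k i\<bar>\<close>, so two
  powers per coordinate bound a term by a product of inverse squares; over a box the sum factorises
  into one-dimensional sums, each at most 3.\<close>

lemma summable_inverse_l1_power:
  "(\<lambda>k::'i::finite \<Rightarrow> int. 1 / (1 + l1 k) ^ (2 * CARD('i))) summable_on UNIV"
proof (rule nonneg_bdd_above_summable_on)
  show "0 \<le> 1 / (1 + l1 k) ^ (2 * CARD('i))" for k :: "'i \<Rightarrow> int"
    by (auto intro!: divide_nonneg_nonneg add_nonneg_nonneg)
  show "bdd_above (sum (\<lambda>k::'i \<Rightarrow> int. 1 / (1 + l1 k) ^ (2 * CARD('i))) ` {F. F \<subseteq> UNIV \<and> finite F})"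
  proof (rule bdd_aboveI2)
    fix S :: "('i \<Rightarrow> int) set"
    assume "S \<in> {F. F \<subseteq> UNIV \<and> finite F}"
    then have fin: "finite S" by simp
    define m where "m = nat (Max (insert 0 ((\<lambda>(k,i). \<bar>k i\<bar>) ` (S \<times> UNIV))))"
    have bnd: "\<bar>k i\<bar> \<le> int m" if "k \<in> S" for k i
    proof -
      have "\<bar>k i\<bar> \<le> Max (insert 0 ((\<lambda>(k,i). \<bar>k i\<bar>) ` (S \<times> UNIV)))"
        using fin that by (intro Max_ge) auto
      then show ?thesis unfolding m_def by linarith
    qed
    have sub: "S \<subseteq> PiE UNIV (\<lambda>_. {-int m..int m})"
      using bnd by (auto simp: PiE_def abs_le_iff) (metis minus_le_iff)
    have "(\<Sum>k\<in>S. 1 / (1 + l1 k) ^ (2 * CARD('i)))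
        \<le> (\<Sum>k\<in>S. \<Prod>i\<in>UNIV. 1 / (1 + \<bar>real_of_int (k i)\<bar>)\<^sup>2)"
    proof (rule sum_mono)
      fix k
      have "(\<Prod>i\<in>(UNIV::'i set). (1 + \<bar>real_of_int (k i)\<bar>)\<^sup>2) \<le> (\<Prod>i\<in>(UNIV::'i set). (1 + l1 k)\<^sup>2)"
        by (rule prod_mono) (auto intro!: power_mono l1_ge_coord)
      then have "(\<Prod>i\<in>(UNIV::'i set). (1 + \<bar>real_of_int (k i)\<bar>)\<^sup>2) \<le> (1 + l1 k) ^ (2 * CARD('i))"
        by (simp add: power_mult)
      moreover have "(\<Prod>i\<in>(UNIV::'i set). (1 + \<bar>real_of_int (k i)\<bar>)\<^sup>2) > 0"
        by (rule prod_pos) (simp add: add_pos_nonneg)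
      ultimately have "1 / (1 + l1 k) ^ (2 * CARD('i)) \<le> 1 / (\<Prod>i\<in>(UNIV::'i set). (1 + \<bar>real_of_int (k i)\<bar>)\<^sup>2)"
        by (intro divide_left_mono) auto
      then show "1 / (1 + l1 k) ^ (2 * CARD('i)) \<le> (\<Prod>i\<in>UNIV. 1 / (1 + \<bar>real_of_int (k i)\<bar>)\<^sup>2)"
        by (simp add: prod_dividef)
    qed
    also have "\<dots> \<le> (\<Sum>k\<in>PiE (UNIV::'i set) (\<lambda>_. {-int m..int m}). \<Prod>i\<in>UNIV. 1 / (1 + \<bar>real_of_int (k i)\<bar>)\<^sup>2)"
      by (intro sum_mono2 sub) (auto intro!: finite_PiE prod_nonneg)
    also have "\<dots> = (\<Prod>i\<in>(UNIV::'i set). \<Sum>n\<in>{-int m..int m}. 1 / (1 + \<bar>real_of_int n\<bar>)\<^sup>2)"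
      by (rule prod_sum_PiE [symmetric]) auto
    also have "\<dots> \<le> (\<Prod>i\<in>(UNIV::'i set). 3)"
    proof (rule prod_mono)
      fix i :: 'i
      have "(\<Sum>n\<in>{-int m..int m}. 1 / (1 + \<bar>real_of_int n\<bar>)\<^sup>2) \<le> 3 - 2 / (real m + 1)"
        by (rule sum_inverse_squares_int_le)
      also have "\<dots> \<le> 3" by simp
      finally show "0 \<le> (\<Sum>n\<in>{-int m..int m}. 1 / (1 + \<bar>real_of_int n\<bar>)\<^sup>2) \<and>
        (\<Sum>n\<in>{-int m..int m}. 1 / (1 + \<bar>real_of_int n\<bar>)\<^sup>2) \<le> 3"
        by (auto intro!: sum_nonneg)
    qed
    finally show "(\<Sum>k\<in>S. 1 / (1 + l1 k) ^ (2 * CARD('i))) \<le> 3 ^ CARD('i)" by simp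
  qed
qed

text \<open>The slope of a supporting line, nonnegative by monotonicity. For
  \<open>\<omega> (exp t)\<close> it is the dual slope at which Young's inequality becomes an
  equality at \<open>s\<close>; the passage from derivative bounds to Fourier decay depends on
  it.\<close>

lemma convex_on_subgradient:
  fixes f :: "real \<Rightarrow> real"
  assumes "convex_on {0..} f" and mono: "\<And>x y. 0 \<le> x \<Longrightarrow> x \<le> y \<Longrightarrow> f x \<le> f y" and "s \<ge> 0"
  shows "\<exists>y\<ge>0. \<forall>x\<ge>0. f s + y * (x - s) \<le> f x"
proof (cases "s = 0")
  case True
  then show ?thesis using mono by (intro exI [of _ 0]) auto
next
  case False
  then have s: "s > 0" using assms by simp
  \<comment> \<open>The supremum of the left difference quotients is the left derivative; convexity
    bounds it by every right quotient. At \<open>s = 0\<close> there is no left quotient, hence the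
    separate case.\<close>
  define y where "y = (SUP x\<in>{0..<s}. (f s - f x) / (s - x))"
  have slope: "(f s - f x) / (s - x) \<le> (f t - f s) / (t - s)" if "x \<in> {0..<s}" "s < t" for x t
  proof -
    have "(f x - f s) / (x - s) \<le> (f s - f t) / (s - t)"
      using convex_on_slope_le [OF assms(1), of x t s] that by auto
    then show ?thesis by (metis minus_diff_eq minus_divide_divide)
  qed
  have bdd: "bdd_above ((\<lambda>x. (f s - f x) / (s - x)) ` {0..<s})"
    using slope [of _ "s + 1"] by (intro bdd_aboveI2) auto
  have up: "(f s - f x) / (s - x) \<le> y" if "x \<in> {0..<s}" for x
    unfolding y_def using that bdd by (rule cSUP_upper)
  have "0 \<le> (f s - f 0) / (s - 0)" using mono [of 0 s] s by simp
  also have "\<dots> \<le> y" using up [of 0] s by simp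
  finally have "y \<ge> 0" .
  moreover have "f s + y * (x - s) \<le> f x" if "x \<ge> 0" for x
  proof -
    consider "x < s" | "x = s" | "x > s" by linarith
    then show ?thesis
    proof cases
      case 1
      with up [of x] that have "f s - f x \<le> y * (s - x)" by (simp add: field_simps)
      then show ?thesis by (simp add: algebra_simps)
    next
      case 3
      have "y \<le> (f x - f s) / (x - s)"
        unfolding y_def using s slope 3 by (intro cSUP_least) auto
      with 3 show ?thesis by (simp add: field_simps)
    qed auto
  qed
  ultimately show ?thesis by blast
qed

section \<open>Weight functions\<close>

locale weight_subadd =
  fixes \<omega> :: "real \<Rightarrow> real"
  assumes weight: "weight_function \<omega>" and subadditive: "subadditive_weight \<omega>"
begin

lemma w_mono: "0 \<le> s \<Longrightarrow> s \<le> t \<Longrightarrow> \<omega> s \<le> \<omega> t"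
  using weight by (auto simp: weight_function_def mono_on_def)

lemma w_nonneg: "0 \<le> t \<Longrightarrow> 0 \<le> \<omega> t"
  using weight by (auto simp: weight_function_def)

lemma w_add: "0 \<le> s \<Longrightarrow> 0 \<le> t \<Longrightarrow> \<omega> (s + t) \<le> \<omega> s + \<omega> t"
  using subadditive by (auto simp: subadditive_weight_def)

lemma w_mult_nat: "0 \<le> t \<Longrightarrow> \<omega> (real (Suc m) * t) \<le> real (Suc m) * \<omega> t"
proof (induction m)
  case (Suc m)
  have "\<omega> (real (Suc (Suc m)) * t) = \<omega> (real (Suc m) * t + t)" by (simp add: algebra_simps)
  also have "\<dots> \<le> \<omega> (real (Suc m) * t) + \<omega> t" using Suc by (intro w_add) auto
  finally show ?case using Suc by (simp add: algebra_simps)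
qed simp

text \<open>An explicit dilation constant: \<open>M\<close> is rounded up to an integer, and
  subadditivity costs at most \<open>M + 1\<close>. Changes of norm on frequencies are paid for with
  it.\<close>

lemma w_scale: "\<omega> (M * t) \<le> (M + 1) * \<omega> t" if "0 \<le> M" "0 \<le> t"
proof -
  define m where "m = nat \<lfloor>M\<rfloor>"
  have m: "real m \<le> M" "M \<le> real (Suc m)" unfolding m_def using that by linarith+
  have "\<omega> (M * t) \<le> \<omega> (real (Suc m) * t)" 
    using that m by (intro w_mono mult_right_mono) auto
  also have "\<dots> \<le> real (Suc m) * \<omega> t" using that by (intro w_mult_nat)
  also have "\<dots> \<le> (M + 1) * \<omega> t" using m that w_nonneg [of t] by (intro mult_right_mono) auto
  finally show ?thesis .
qed

lemma w_linear: "\<omega> t \<le> (t + 1) * \<omega> 1" if "0 \<le> t"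
  using w_scale [of t 1] that by simp

text \<open>Beyond a threshold, \<open>ln = o(\<omega>)\<close> gives the bound; below it a constant
  suffices. Polynomial losses are absorbed in this way by an arbitrarily small part of the
  exponent.\<close>

lemma w_poly: "\<exists>C>0. \<forall>t\<ge>0. (1 + t) ^ p \<le> C * exp (\<epsilon> * \<omega> t)" if "\<epsilon> > 0"
proof -
  have "ln \<in> o[at_top](\<omega>)" using weight by (auto simp: weight_function_def)
  then have "eventually (\<lambda>t. norm (ln t) \<le> \<epsilon> / (real p + 1) * norm (\<omega> t)) at_top"
    by (rule landau_o.smallD) (use that in auto)
  then obtain T0 where T0: "\<And>t. t \<ge> T0 \<Longrightarrow> norm (ln t) \<le> \<epsilon> / (real p + 1) * norm (\<omega> t)"
    unfolding eventually_at_top_linorder by auto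
  define T where "T = max T0 1"
  define C where "C = max (exp (\<epsilon> * \<omega> 1)) (T ^ p)"
  have "C > 0" by (simp add: C_def less_max_iff_disj)
  moreover have "(1 + t) ^ p \<le> C * exp (\<epsilon> * \<omega> t)" if t: "t \<ge> 0" for t
  proof (cases "1 + t \<ge> T")
    case True
    have "ln (1 + t) \<le> \<epsilon> / (real p + 1) * \<omega> (1 + t)"
      using T0 [of "1 + t"] True w_nonneg [of "1 + t"] t by (auto simp: T_def)
    then have "real p * ln (1 + t) \<le> real p * (\<epsilon> / (real p + 1) * \<omega> (1 + t))"
      by (intro mult_left_mono) auto
    also have "\<dots> = (real p / (real p + 1)) * (\<epsilon> * \<omega> (1 + t))" by simp
    also have "\<dots> \<le> 1 * (\<epsilon> * \<omega> (1 + t))"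
      using \<open>\<epsilon> > 0\<close> t w_nonneg [of "1 + t"] by (intro mult_right_mono) auto
    also have "\<dots> \<le> \<epsilon> * (\<omega> 1 + \<omega> t)" using w_add [of 1 t] t \<open>\<epsilon> > 0\<close> by simp
    finally have *: "real p * ln (1 + t) \<le> \<epsilon> * (\<omega> 1 + \<omega> t)" .
    have "(1 + t) ^ p = exp (real p * ln (1 + t))"
      using t by (simp add: exp_of_nat_mult)
    also have "\<dots> \<le> exp (\<epsilon> * \<omega> 1) * exp (\<epsilon> * \<omega> t)"
      using * by (simp add: exp_add [symmetric] algebra_simps)
    also have "\<dots> \<le> C * exp (\<epsilon> * \<omega> t)" by (simp add: C_def)
    finally show ?thesis .
  next
    case False
    then have "(1 + t) ^ p \<le> T ^ p" using t by (intro power_mono) auto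
    also have "\<dots> \<le> C * 1" by (simp add: C_def)
    also have "\<dots> \<le> C * exp (\<epsilon> * \<omega> t)"
      using \<open>\<epsilon> > 0\<close> w_nonneg [OF t] \<open>C > 0\<close> by (intro mult_left_mono) auto
    finally show ?thesis .
  qed
  ultimately show ?thesis by blast
qed

lemma summable_exp_w:
  assumes "\<epsilon> > 0"
  shows "(\<lambda>k::'i::finite \<Rightarrow> int. exp (- \<epsilon> * \<omega> (l1 k))) summable_on UNIV"
proof -
  obtain C where C: "C > 0" "\<And>t. t \<ge> 0 \<Longrightarrow> (1 + t) ^ (2 * CARD('i)) \<le> C * exp (\<epsilon> * \<omega> t)"
    using w_poly [OF assms, of "2 * CARD('i)"] by metis
  have "exp (- \<epsilon> * \<omega> (l1 k)) \<le> C * (1 / (1 + l1 k) ^ (2 * CARD('i)))" for k :: "'i \<Rightarrow> int"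
    using C(2) [of "l1 k"] by (simp add: exp_minus field_simps add_pos_nonneg)
  then show ?thesis
    using summable_on_cmult_right [OF summable_inverse_l1_power, of C]
    by (rule_tac summable_on_comparison_test) auto
qed

text \<open>The one-element index type \<open>1\<close> transports the lattice result to integer
  sequences.\<close>

lemma summable_exp_w_int: "(\<lambda>n::int. exp (- \<epsilon> * \<omega> \<bar>real_of_int n\<bar>)) summable_on UNIV" if "\<epsilon> > 0"
proof -
  have "(\<lambda>k::1 \<Rightarrow> int. exp (- \<epsilon> * \<omega> (l1 k))) summable_on UNIV \<longleftrightarrow>
     (\<lambda>n::int. exp (- \<epsilon> * \<omega> \<bar>real_of_int n\<bar>)) summable_on UNIV"
    by (rule summable_on_reindex_bij_witness [where i = "\<lambda>n _. n" and j = "\<lambda>k. k 1"])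
       (auto simp: l1_def fun_eq_iff)
  then show ?thesis using summable_exp_w [OF that] by blast
qed

text \<open>\<open>phi_star\<close> is a real supremum and hence meaningful only when bounded above;
  since \<open>ln\<close> is negligible against \<open>\<omega>\<close>, the term
  \<open>s * t\<close> stays below \<open>\<omega> (exp s)\<close> up to a constant.\<close>

lemma phi_star_bdd: "bdd_above ((\<lambda>s. s * t - \<omega> (exp s)) ` {0..})"
proof -
  obtain C where C: "C > 0" "\<And>x. x \<ge> 0 \<Longrightarrow> (1 + x) ^ (nat \<lceil>\<bar>t\<bar>\<rceil>) \<le> C * exp (1 * \<omega> x)"
    using w_poly [of 1 "nat \<lceil>\<bar>t\<bar>\<rceil>"] by (metis zero_less_one)
  have "s * t - \<omega> (exp s) \<le> ln C" if "s \<ge> 0" for s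
  proof -
    have "exp (s * t) \<le> exp (real (nat \<lceil>\<bar>t\<bar>\<rceil>) * s)"
    proof -
      have "t \<le> real (nat \<lceil>\<bar>t\<bar>\<rceil>)" by linarith
      then show ?thesis using that by (simp add: mult.commute mult_left_mono)
    qed
    also have "\<dots> = exp s ^ (nat \<lceil>\<bar>t\<bar>\<rceil>)" by (rule exp_of_nat_mult)
    also have "\<dots> \<le> (1 + exp s) ^ (nat \<lceil>\<bar>t\<bar>\<rceil>)" by (rule power_mono) auto
    also have "\<dots> \<le> exp (ln C + \<omega> (exp s))" using C(2) [of "exp s"] C(1) by (simp add: exp_add)
    finally have "s * t \<le> ln C + \<omega> (exp s)" by simp
    then show ?thesis by simp
  qed
  then show ?thesis by (intro bdd_aboveI2) auto
qed

lemma phi_star_ge: "s \<ge> 0 \<Longrightarrow> s * t - \<omega> (exp s) \<le> phi_star \<omega> t"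
  unfolding phi_star_def by (rule cSUP_upper [OF _ phi_star_bdd]) auto

text \<open>Young's inequality at \<open>s = ln x\<close> with slope \<open>n / lam\<close>,
  exponentiated: \<open>n\<close> derivatives at frequency \<open>x\<close> cost no more than the
  seminorm weight.\<close>

lemma power_exp_w_le:
  assumes "x \<ge> 1" "lam > 0"
  shows "x ^ n * exp (- lam * \<omega> x) \<le> exp (lam * phi_star \<omega> (real n / lam))"
proof -
  have "ln x * (real n / lam) - \<omega> (exp (ln x)) \<le> phi_star \<omega> (real n / lam)"
    by (rule phi_star_ge) (use assms in auto)
  then have "lam * (ln x * (real n / lam) - \<omega> (exp (ln x))) \<le> lam * phi_star \<omega> (real n / lam)"
    using assms by simp
  moreover have "lam * (ln x * (real n / lam) - \<omega> (exp (ln x))) = real n * ln x - lam * \<omega> x"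
    using assms by (simp add: field_simps)
  ultimately have "exp (real n * ln x + - lam * \<omega> x) \<le> exp (lam * phi_star \<omega> (real n / lam))" by simp
  then show ?thesis using assms by (simp add: exp_add exp_of_nat_mult exp_diff exp_minus divide_inverse)
qed

text \<open>Frequency 0 has no logarithm; there the inequality at \<open>s = 0\<close> is used,
  which is the origin of the factor \<open>exp (lam * \<omega> 1)\<close>.\<close>

lemma l1_power_exp_w_le:
  assumes "lam > 0"
  shows "l1 k ^ n * exp (- lam * \<omega> (l1 k)) \<le> exp (lam * \<omega> 1) * exp (lam * phi_star \<omega> (real n / lam))"
proof (cases "k = (\<lambda>i. 0)")
  case True
  have "exp (- lam * \<omega> 1) \<le> exp (lam * phi_star \<omega> (real n / lam))"
    using mult_left_mono [OF phi_star_ge [of 0 "real n / lam"], of lam] assms by simp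
  then have "1 \<le> exp (lam * \<omega> 1) * exp (lam * phi_star \<omega> (real n / lam))"
    by (simp add: exp_minus field_simps)
  moreover have "exp (- lam * \<omega> 0) \<le> 1" using w_nonneg [of 0] assms by simp
  moreover have "l1 k = 0" using True by (simp add: l1_def)
  ultimately show ?thesis by (cases n) (auto intro: order_trans [of _ 1])
next
  case False
  have "l1 k ^ n * exp (- lam * \<omega> (l1 k)) \<le> 1 * exp (lam * phi_star \<omega> (real n / lam))"
    using power_exp_w_le [OF l1_ge_1 [OF False] assms] by simp
  also have "\<dots> \<le> exp (lam * \<omega> 1) * exp (lam * phi_star \<omega> (real n / lam))"
    using w_nonneg [of 1] assms by (intro mult_right_mono) auto
  finally show ?thesis .
qed

text \<open>Optimising over the number \<open>n\<close> of derivatives recovers the weight, since a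
  convex function is its own biconjugate. The optimal order is \<open>lam * y\<close> for a
  subgradient \<open>y\<close> at \<open>ln x\<close>; rounding it down to an integer costs one
  power of \<open>x\<close>.\<close>

lemma exp_w_decay_of_power_bounds:
  assumes "x \<ge> 1" "lam > 0" "D \<ge> 0"
    and bound: "\<And>n::nat. M * x ^ n \<le> D * exp (lam * phi_star \<omega> (real n / lam))"
  shows "M \<le> D * x * exp (- lam * \<omega> x)"
proof -
  define s where "s = ln x"
  have s: "s \<ge> 0" "exp s = x" using assms by (auto simp: s_def)
  have "convex_on {0..} (\<lambda>t. \<omega> (exp t))" using weight by (auto simp: weight_function_def)
  then obtain y where y: "y \<ge> 0" "\<And>t. t \<ge> 0 \<Longrightarrow> \<omega> (exp s) + y * (t - s) \<le> \<omega> (exp t)"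
    using convex_on_subgradient [of "\<lambda>t. \<omega> (exp t)" s] s by (metis exp_ge_zero exp_le_cancel_iff w_mono)
  define n where "n = nat \<lfloor>lam * y\<rfloor>"
  have n: "real n \<le> lam * y" "lam * y \<le> real n + 1"
    unfolding n_def using mult_nonneg_nonneg [of lam y] assms y by linarith+
  have "phi_star \<omega> (real n / lam) \<le> s * y - \<omega> x"
    unfolding phi_star_def
  proof (rule cSUP_least)
    fix t :: real assume "t \<in> {0..}"
    then have t: "t \<ge> 0" by simp
    have "real n / lam \<le> y" using n assms by (simp add: field_simps)
    then have "t * (real n / lam) \<le> t * y" using t by (rule mult_left_mono)
    then show "t * (real n / lam) - \<omega> (exp t) \<le> s * y - \<omega> x"
      using y(2) [OF t] s by (simp add: algebra_simps)
  qed auto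
  then have "lam * phi_star \<omega> (real n / lam) \<le> lam * (s * y - \<omega> x)" using assms by simp
  also have "\<dots> \<le> (real n + 1) * s - lam * \<omega> x"
    using mult_right_mono [OF n(2) s(1)] by (simp add: algebra_simps)
  finally have le: "exp (lam * phi_star \<omega> (real n / lam)) \<le> exp (real n * s + s + - lam * \<omega> x)"
    by (simp add: algebra_simps)
  have "M * x ^ n \<le> D * exp (real n * s + s + - lam * \<omega> x)"
    using bound [of n] mult_left_mono [OF le \<open>D \<ge> 0\<close>] by linarith
  also have "\<dots> = D * x * exp (- lam * \<omega> x) * x ^ n"
    unfolding exp_add exp_of_nat_mult s by simp
  finally show ?thesis using assms by (simp add: mult_le_cancel_right)
qed

end

section \<open>Normally convergent series, primitives and periodic functions\<close>

lemma continuous_on_infsum: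
  fixes f :: "'k \<Rightarrow> 'a::topological_space \<Rightarrow> complex"
  assumes "\<And>k. continuous_on S (f k)" "\<And>k t. t \<in> S \<Longrightarrow> norm (f k t) \<le> M k" "M summable_on UNIV"
  shows "continuous_on S (\<lambda>t. \<Sum>\<^sub>\<infinity>k. f k t)"
proof (rule uniform_limit_theorem)
  show "uniform_limit S (\<lambda>X y. \<Sum>x\<in>X. f x y) (\<lambda>y. \<Sum>\<^sub>\<infinity>x\<in>UNIV. f x y) (finite_subsets_at_top UNIV)"
    by (rule Weierstrass_m_test_general) (use assms in auto)
qed (auto intro!: always_eventually continuous_on_sum assms)

lemma has_sum_integral_infsum:
  fixes f :: "'k \<Rightarrow> real \<Rightarrow> complex"
  assumes "\<And>k. continuous_on {a..b} (f k)" "\<And>k t. t \<in> {a..b} \<Longrightarrow> norm (f k t) \<le> M k" "M summable_on UNIV"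
  shows "((\<lambda>k. integral {a..b} (f k)) has_sum integral {a..b} (\<lambda>t. \<Sum>\<^sub>\<infinity>k. f k t)) UNIV"
proof -
  have "uniform_limit {a..b} (\<lambda>X y. \<Sum>x\<in>X. f x y) (\<lambda>y. \<Sum>\<^sub>\<infinity>x\<in>UNIV. f x y) (finite_subsets_at_top UNIV)"
    by (rule Weierstrass_m_test_general) (use assms in auto)
  then obtain I J where I: "\<And>X. ((\<lambda>y. \<Sum>x\<in>X. f x y) has_integral I X) {a..b}"
    and J: "((\<lambda>y. \<Sum>\<^sub>\<infinity>x\<in>UNIV. f x y) has_integral J) {a..b}" "(I \<longlongrightarrow> J) (finite_subsets_at_top UNIV)"
    by (rule uniform_limit_integral) (auto intro!: continuous_on_sum assms)
  have "I X = (\<Sum>k\<in>X. integral {a..b} (f k))" for X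
  proof (cases "finite X")
    case True
    then have "integral {a..b} (\<lambda>y. \<Sum>x\<in>X. f x y) = (\<Sum>k\<in>X. integral {a..b} (f k))"
      by (intro integral_sum) (auto intro!: integrable_continuous_real assms)
    then show ?thesis using integral_unique [OF I] by simp
  next
    case False
    then show ?thesis using integral_unique [OF I [of X]] by simp
  qed
  then have "I = sum (\<lambda>k. integral {a..b} (f k))" by auto
  then show ?thesis using J integral_unique [OF J(1)] by (simp add: has_sum_def)
qed

lemma norm_cis_minus_linear_le: "norm (cis x - 1 - \<i> * x) \<le> x\<^sup>2"
proof -
  have 1: "\<bar>sin x - x\<bar> \<le> x\<^sup>2 / 2"
    using Maclaurin_sin_bound [of x 2] by (simp add: sin_coeff_def lessThan_nat_numeral lessThan_Suc)
  have "1 - cos x = 2 * (sin (x / 2))\<^sup>2" using cos_double_sin [of "x / 2"] by simp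
  also have "\<dots> \<le> 2 * (x / 2)\<^sup>2"
    using abs_sin_x_le_abs_x [of "x / 2"] by (simp only: abs_le_square_iff mult_le_cancel_left_pos zero_less_numeral)
  finally have 2: "\<bar>cos x - 1\<bar> \<le> x\<^sup>2 / 2" by (simp add: power_divide)
  have "norm (cis x - 1 - \<i> * x) \<le> \<bar>Re (cis x - 1 - \<i> * x)\<bar> + \<bar>Im (cis x - 1 - \<i> * x)\<bar>"
    by (rule cmod_le)
  then show ?thesis using 1 2 by simp
qed

lemma has_vector_derivative_quadratic_error:
  fixes f :: "real \<Rightarrow> 'a::real_normed_vector"
  assumes "\<And>h. norm (f (s + h) - f s - h *\<^sub>R D) \<le> C * h\<^sup>2"
  shows "(f has_vector_derivative D) (at s)"
  unfolding has_vector_derivative_def has_derivative_at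
proof
  show "bounded_linear (\<lambda>x. x *\<^sub>R D)" by (rule bounded_linear_scaleR_left)
  have "((\<lambda>h. \<bar>C\<bar> * \<bar>h\<bar>) \<longlongrightarrow> \<bar>C\<bar> * \<bar>0\<bar>) (at (0::real))" by (intro tendsto_intros)
  then have lim: "((\<lambda>h. \<bar>C\<bar> * \<bar>h\<bar>) \<longlongrightarrow> 0) (at (0::real))" by simp
  show "(\<lambda>h. norm (f (s + h) - f s - h *\<^sub>R D) / norm h) \<midarrow>0\<rightarrow> 0"
  proof (rule Lim_null_comparison [OF _ lim])
    show "\<forall>\<^sub>F h in at 0. norm (norm (f (s + h) - f s - h *\<^sub>R D) / norm h) \<le> \<bar>C\<bar> * \<bar>h\<bar>"
    proof (rule eventually_mono [OF eventually_at_ball'[of 1]])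
      fix h :: real assume "h \<in> ball 0 1 \<and> h \<noteq> 0 \<and> h \<in> UNIV"
      then have h: "h \<noteq> 0" by simp
      have "norm (f (s + h) - f s - h *\<^sub>R D) \<le> \<bar>C\<bar> * h\<^sup>2"
        using assms [of h] mult_right_mono [OF abs_ge_self [of C], of "h\<^sup>2"] by simp
      then have "norm (f (s + h) - f s - h *\<^sub>R D) \<le> \<bar>C\<bar> * \<bar>h\<bar> * \<bar>h\<bar>"
        by (simp add: power2_eq_square mult.assoc flip: abs_mult)
      then show "norm (norm (f (s + h) - f s - h *\<^sub>R D) / norm h) \<le> \<bar>C\<bar> * \<bar>h\<bar>"
        using h by (simp add: divide_le_eq)
    qed auto
  qed
qed

lemma has_sum_diff':
  fixes f g :: "'k \<Rightarrow> 'a::real_normed_vector"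
  assumes "(f has_sum a) A" "(g has_sum b) A"
  shows "((\<lambda>x. f x - g x) has_sum (a - b)) A"
  using has_sum_add [OF assms(1), of "\<lambda>x. - g x" "- b"] assms(2) by (simp add: has_sum_uminus)

text \<open>Each term differs from its linearisation by at most its coefficient times
  \<open>(1 + \<kappa>\<^sup>2) * h\<^sup>2\<close>, so the summed remainder is quadratic in
  \<open>h\<close> and the sum is differentiated directly.\<close>

lemma has_vector_derivative_cis_series:
  fixes c :: "'k \<Rightarrow> complex" and \<kappa> :: "'k \<Rightarrow> real"
  assumes sum: "(\<lambda>k. norm (c k) * (1 + (\<kappa> k)\<^sup>2)) summable_on UNIV"
  shows "((\<lambda>s. \<Sum>\<^sub>\<infinity>k. c k * cis (\<kappa> k * s)) has_vector_derivative
          (\<Sum>\<^sub>\<infinity>k. \<i> * \<kappa> k * c k * cis (\<kappa> k * s))) (at s)"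
proof (rule has_vector_derivative_quadratic_error)
  fix h :: real
  let ?f = "\<lambda>k s. c k * cis (\<kappa> k * s)"
  let ?d = "\<lambda>k. \<i> * \<kappa> k * c k * cis (\<kappa> k * s)"
  have ab: "\<bar>x\<bar> \<le> 1 + x\<^sup>2" for x :: real
    using zero_le_power2 [of "\<bar>x\<bar> - 1"] by (simp add: power2_diff)
  have f: "w summable_on UNIV" if "\<And>k. norm (w k) \<le> norm (c k) * (1 + (\<kappa> k)\<^sup>2)" for w :: "'k \<Rightarrow> complex"
    using abs_summable_summable [OF Infinite_Sum.abs_summable_on_comparison_test' [OF sum that]] .
  have sf: "(\<lambda>k. ?f k t) summable_on UNIV" for t
    by (rule f) (simp add: norm_mult mult_left_mono algebra_simps)
  have sd: "?d summable_on UNIV"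
    by (rule f) (use ab in \<open>simp add: norm_mult mult_left_mono mult.commute [of "\<bar>_\<bar>"]\<close>)
  have "((\<lambda>k. ?f k (s + h) - ?f k s - h *\<^sub>R ?d k) has_sum 
     ((\<Sum>\<^sub>\<infinity>k. ?f k (s + h)) - (\<Sum>\<^sub>\<infinity>k. ?f k s) - h *\<^sub>R (\<Sum>\<^sub>\<infinity>k. ?d k))) UNIV"
    by (intro has_sum_diff' has_sum_infsum has_sum_scaleR sf sd)
  moreover have "((\<lambda>k. norm (c k) * (1 + (\<kappa> k)\<^sup>2) * h\<^sup>2) has_sum
      ((\<Sum>\<^sub>\<infinity>k. norm (c k) * (1 + (\<kappa> k)\<^sup>2)) * h\<^sup>2)) UNIV"
    by (intro has_sum_cmult_left has_sum_infsum sum)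
  moreover have "norm (?f k (s + h) - ?f k s - h *\<^sub>R ?d k) \<le> norm (c k) * (1 + (\<kappa> k)\<^sup>2) * h\<^sup>2" for k
  proof -
    have "?f k (s + h) - ?f k s - h *\<^sub>R ?d k = c k * cis (\<kappa> k * s) * (cis (\<kappa> k * h) - 1 - \<i> * (\<kappa> k * h))"
      by (simp add: algebra_simps cis_mult scaleR_conv_of_real)
    then have "norm (?f k (s + h) - ?f k s - h *\<^sub>R ?d k) = norm (c k) * norm (cis (\<kappa> k * h) - 1 - \<i> * (\<kappa> k * h))"
      by (simp add: norm_mult)
    also have "\<dots> \<le> norm (c k) * ((1 + (\<kappa> k)\<^sup>2) * h\<^sup>2)"
      using norm_cis_minus_linear_le [of "\<kappa> k * h"]
      by (intro mult_left_mono) (auto simp: power_mult_distrib algebra_simps intro: order_trans)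
    finally show ?thesis by (simp add: mult.assoc)
  qed
  ultimately show "norm ((\<Sum>\<^sub>\<infinity>k. ?f k (s + h)) - (\<Sum>\<^sub>\<infinity>k. ?f k s) - h *\<^sub>R (\<Sum>\<^sub>\<infinity>k. ?d k))
      \<le> (\<Sum>\<^sub>\<infinity>k. norm (c k) * (1 + (\<kappa> k)\<^sup>2)) * h\<^sup>2"
    by (rule norm_infsum_le)
qed

lemma ex_antiderivative:
  fixes g :: "real \<Rightarrow> 'a::euclidean_space"
  assumes "continuous_on UNIV g"
  shows "\<exists>G. \<forall>t. (G has_vector_derivative g t) (at t)"
proof (intro exI allI)
  fix t :: real
  define a where "a = - \<bar>t\<bar> - 1"
  define b where "b = \<bar>t\<bar> + 1"
  have ab: "a < 0" "0 < b" "a < t" "t < b" by (auto simp: a_def b_def)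
  have "((\<lambda>u. LBINT y=ereal 0..ereal u. g y) has_vector_derivative g t) (at t within {a..b})"
    by (rule interval_integral_FTC2) (use ab assms in \<open>auto intro: continuous_on_subset\<close>)
  then show "((\<lambda>u. LBINT y=ereal 0..ereal u. g y) has_vector_derivative g t) (at t)"
    using ab by (simp add: at_within_Icc_at)
qed

lemma has_integral_FTC:
  fixes G :: "real \<Rightarrow> 'a::banach"
  assumes "\<And>t. (G has_vector_derivative g t) (at t)" "a \<le> b"
  shows "(g has_integral G b - G a) {a..b}"
  using assms by (intro fundamental_theorem_of_calculus) (auto intro: has_vector_derivative_at_within)

lemma norm_increment_le:
  fixes G :: "real \<Rightarrow> 'a::banach"
  assumes "\<And>t. (G has_vector_derivative g t) (at t)" "a \<le> b" "\<And>t. a \<le> t \<Longrightarrow> t \<le> b \<Longrightarrow> norm (g t) \<le> M"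
  shows "norm (G b - G a) \<le> (b - a) * M"
proof -
  have "0 \<le> M" using assms(2) assms(3) [of a] norm_ge_zero [of "g a"] by linarith
  then have "norm (G b - G a) \<le> M * measure lborel {a..b}"
    by (rule has_integral_bound_real [OF _ finite.emptyI has_integral_FTC [OF assms(1,2)]]) (use assms in auto)
  then show ?thesis using assms by (simp add: mult.commute)
qed

lemma vector_derivative_0_const:
  fixes G :: "real \<Rightarrow> 'a::banach"
  assumes "\<And>t. (G has_vector_derivative 0) (at t)"
  shows "G a = G b"
  using has_integral_FTC [of G "\<lambda>_. 0" a b] has_integral_FTC [of G "\<lambda>_. 0" b a] assms
  by (metis eq_iff_diff_eq_0 has_integral_0_eq linear)

lemma integral_periodic_shift:
  fixes g :: "real \<Rightarrow> 'a::euclidean_space"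
  assumes "continuous_on UNIV g" "\<And>t. g (t + p) = g t" "p \<ge> 0"
  shows "integral {a..a + p} g = integral {0..p} g"
proof -
  obtain G where G: "\<And>t. (G has_vector_derivative g t) (at t)"
    using ex_antiderivative [OF assms(1)] by auto
  have "((\<lambda>t. G (t + p)) has_vector_derivative 1 *\<^sub>R g (t + p)) (at t)" for t
  proof -
    have "((\<lambda>t. t + p) has_vector_derivative 1) (at t)" by (auto intro!: derivative_eq_intros)
    from vector_diff_chain_at [OF this G] show ?thesis by (simp add: o_def)
  qed
  then have "((\<lambda>t. G (t + p) - G t) has_vector_derivative g (t + p) - g t) (at t)" for t
    using G by (auto intro!: has_vector_derivative_diff)
  then have "((\<lambda>t. G (t + p) - G t) has_vector_derivative 0) (at t)" for t
    using assms by simp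
  then have "G (a + p) - G a = G (0 + p) - G 0" by (rule vector_derivative_0_const)
  then show ?thesis
    using integral_unique [OF has_integral_FTC [OF G, of a "a + p"]] integral_unique [OF has_integral_FTC [OF G, of 0 p]] assms
    by simp
qed

lemma periodic_int_mult:
  fixes u :: "real \<Rightarrow> 'a"
  assumes "\<And>t. u (t + p) = u t"
  shows "u (t + of_int n * p) = u t"
proof (induction n rule: int_induct [of _ 0])
  case (step1 i)
  then show ?case using assms [of "t + of_int i * p"] by (simp add: algebra_simps)
next
  case (step2 i)
  then show ?case using assms [of "t + of_int (i - 1) * p"] by (simp add: algebra_simps)
qed simp

lemma periodic_cis_cong:
  fixes u :: "real \<Rightarrow> 'a"
  assumes "\<And>t. u (t + 2 * pi) = u t" "cis x = cis y"
  shows "u x = u y"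
proof -
  obtain n :: int where "x = y + 2 * pi * n"
    using assms(2) sin_cos_eq_iff [of x y] by (auto simp: complex_eq_iff)
  then show ?thesis using periodic_int_mult [of u "2 * pi" y n] assms(1) by (simp add: algebra_simps)
qed

text \<open>\<open>Arg\<close> jumps across the negative real axis. There the factor is rewritten as
  \<open>u (Arg (- z) + pi)\<close>, which is continuous; periodicity makes it agree with
  \<open>u (Arg z)\<close>.\<close>

lemma periodic_factor_circle:
  fixes u :: "real \<Rightarrow> complex"
  assumes cont: "continuous_on UNIV u" and per: "\<And>t. u (t + 2 * pi) = u t"
  obtains F where "continuous_on (sphere 0 1) F" "\<And>t. F (cis t) = u t"
proof
  define F where "F = (\<lambda>z. u (Arg z))"
  show *: "F (cis t) = u t" for t
    unfolding F_def by (rule periodic_cis_cong [of u]) (simp_all add: cis_Arg per)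
  have Fneg: "F z = u (Arg (- z) + pi)" if "z \<in> sphere 0 1" for z
  proof -
    have "- z \<noteq> 0" using that by auto
    then have "cis (Arg (- z)) = - z" using that by (simp add: cis_Arg sgn_div_norm)
    then have "cis (Arg (- z) + pi) = z" by (simp add: cis_mult [symmetric])
    then show ?thesis using * by metis
  qed
  have ucont: "isCont u t" for t using cont by (simp add: continuous_on_eq_continuous_at)
  show "continuous_on (sphere 0 1) F"
    unfolding continuous_on_eq_continuous_within
  proof
    fix z :: complex assume z: "z \<in> sphere 0 1"
    show "continuous (at z within sphere 0 1) F"
    proof (cases "z \<in> \<real>\<^sub>\<le>\<^sub>0")
      case False
      then have "isCont Arg z" by (rule continuous_at_Arg)
      then have "isCont F z" unfolding F_def using isCont_o2 [OF _ ucont] by blast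
      then show ?thesis by (rule continuous_at_imp_continuous_at_within)
    next
      case True
      then have "- z \<notin> \<real>\<^sub>\<le>\<^sub>0" using z by (auto simp: complex_nonpos_Reals_iff cmod_def)
      then have "isCont (\<lambda>z. Arg (- z)) z" by (rule isCont_o2 [OF continuous_minus [OF continuous_ident] continuous_at_Arg])
      then have "isCont (\<lambda>z. Arg (- z) + pi) z" by (intro continuous_intros)
      then have "isCont (\<lambda>z. u (Arg (- z) + pi)) z" by (rule isCont_o2 [OF _ ucont])
      then have "continuous (at z within sphere 0 1) (\<lambda>z. u (Arg (- z) + pi))"
        by (rule continuous_at_imp_continuous_at_within)
      then show ?thesis
        by (rule continuous_transform_within [where \<delta> = 1]) (use z Fneg in auto)
    qed
  qed
qed

section \<open>Fourier series in one variable\<close>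

definition fcoef :: "(real \<Rightarrow> complex) \<Rightarrow> int \<Rightarrow> complex" where
  "fcoef u n = integral {0..2*pi} (\<lambda>t. u t * cis (- (of_int n * t))) / (2 * pi)"

definition fser :: "(int \<Rightarrow> complex) \<Rightarrow> real \<Rightarrow> complex" where
  "fser h t = (\<Sum>\<^sub>\<infinity>n. h n * cis (of_int n * t))"

lemma has_vector_derivative_cis_linear:
  "((\<lambda>t. cis (c * t)) has_vector_derivative \<i> * of_real c * cis (c * t)) (at t)"
proof -
  have "((\<lambda>s. \<Sum>\<^sub>\<infinity>k\<in>(UNIV::unit set). 1 * cis (c * s)) has_vector_derivative
          (\<Sum>\<^sub>\<infinity>k\<in>(UNIV::unit set). \<i> * c * 1 * cis (c * t))) (at t)"
    by (rule has_vector_derivative_cis_series) simp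
  then show ?thesis by simp
qed

text \<open>Multipliers that preserve the vanishing of all Fourier coefficients form an algebra
  containing the characters, hence all polynomials on the circle. Stone-Weierstrass approximates
  \<open>cnj u\<close> by such a multiplier, so the integral of \<open>u * cnj u\<close>
  vanishes.\<close>

lemma fourier_unique:
  fixes u :: "real \<Rightarrow> complex"
  assumes cont: "continuous_on UNIV u" and per: "\<And>t. u (t + 2 * pi) = u t" and zero: "\<And>n. fcoef u n = 0"
  shows "u t = 0"
proof -
  define N where "N v \<longleftrightarrow> continuous_on UNIV v \<and> (\<forall>n::int. integral {0..2*pi} (\<lambda>t. v t * cis (- (of_int n * t))) = 0)"
    for v :: "real \<Rightarrow> complex"
  define T where "T p \<longleftrightarrow> (\<forall>v. N v \<longrightarrow> N (\<lambda>t. v t * p t))" for p :: "real \<Rightarrow> complex"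
  have int: "g integrable_on {0..2*pi}" if "continuous_on UNIV g" for g :: "real \<Rightarrow> complex"
    by (rule integrable_continuous_real) (rule continuous_on_subset [OF that], simp)
  have Tadd: "T (\<lambda>t. p t + q t)" if "T p" "T q" for p q
    using that unfolding T_def N_def
    by (auto simp: distrib_left distrib_right integral_add int continuous_intros)
  have Tmult: "T (\<lambda>t. p t * q t)" if "T p" "T q" for p q
    using that unfolding T_def by (simp add: mult.assoc [symmetric])
  have Tconst: "T (\<lambda>t. c)" for c
    unfolding T_def N_def by (auto intro!: continuous_intros simp: mult.commute [of _ c] mult.assoc)
  have Tcis: "T (\<lambda>t. cis (of_int m * t))" for m :: int
    unfolding T_def N_def
  proof (intro allI impI conjI)
    fix v n assume v: "continuous_on UNIV v \<and> (\<forall>n::int. integral {0..2*pi} (\<lambda>t. v t * cis (- (of_int n * t))) = 0)"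
    then show "continuous_on UNIV (\<lambda>t. v t * cis (of_int m * t))" by (auto intro!: continuous_intros)
    have "(\<lambda>t. v t * cis (of_int m * t) * cis (- (of_int n * t))) = (\<lambda>t. v t * cis (- (of_int (n - m) * t)))"
      by (auto simp: mult.assoc cis_mult algebra_simps)
    with v show "integral {0..2*pi} (\<lambda>t. v t * cis (of_int m * t) * cis (- (of_int n * t))) = 0" by metis
  qed
  have Tpoly: "T (\<lambda>t. of_real (p (cis t)))" if "real_polynomial_function p" for p :: "complex \<Rightarrow> real"
    using that
  proof induction
    case (linear p)
    \<comment> \<open>A real-linear functional is determined by its values at 1 and \<i>, and
      \<open>cos t\<close>, \<open>sin t\<close> are combinations of \<open>cis t\<close> and
      \<open>cis (- t)\<close>.\<close>
    have "of_real (p (cis t)) = of_real (p 1 / 2) * (cis (of_int 1 * t) + cis (of_int (-1) * t)) 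
       + (- \<i> * of_real (p \<i> / 2)) * (cis (of_int 1 * t) + (-1) * cis (of_int (-1) * t))" for t
    proof -
      interpret bounded_linear p by fact
      have "p (cis t) = p (cos t *\<^sub>R 1 + sin t *\<^sub>R \<i>)"
        by (rule arg_cong [of _ _ p]) (simp add: complex_eq_iff)
      also have "\<dots> = cos t * p 1 + sin t * p \<i>" unfolding add scaleR by simp
      finally show ?thesis by (simp add: complex_eq_iff field_simps)
    qed
    then show ?case by (simp only:) (intro Tadd Tmult Tconst Tcis)
  next
    case (const c)
    show ?case by (rule Tconst)
  next
    case (add f g)
    then show ?case using Tadd by simp
  next
    case (mult f g)
    then show ?case using Tmult by simp
  qed
  have "N u" unfolding N_def using cont zero by (simp add: fcoef_def)
  obtain F where F: "continuous_on (sphere 0 1) F" "\<And>t. F (cis t) = u t"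
    using periodic_factor_circle [OF cont per] by blast
  have "compact (u ` {0..2*pi})"
    by (intro compact_continuous_image continuous_on_subset [OF cont]) auto
  then obtain B where B: "B > 0" "\<And>t. t \<in> {0..2*pi} \<Longrightarrow> norm (u t) \<le> B"
    using compact_imp_bounded [of "u ` {0..2*pi}"] unfolding bounded_pos by blast
  define I where "I = integral {0..2*pi} (\<lambda>t. u t * cnj (u t))"
  have "norm I \<le> e" if "e > 0" for e
  proof -
    \<comment> \<open>Real and imaginary errors contribute \<open>2 * d\<close>, the factor
      \<open>u\<close> contributes \<open>B\<close>, the interval \<open>2 * pi\<close>: the product
      is exactly \<open>e\<close>.\<close>
    define d where "d = e / (4 * pi * B)"
    have d: "d > 0" using that B by (simp add: d_def)
    obtain p where p: "real_polynomial_function p" "\<And>z. z \<in> sphere 0 1 \<Longrightarrow> \<bar>Re (F z) - p z\<bar> < d"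
      by (rule Stone_Weierstrass_real_polynomial_function [of "sphere 0 1" "\<lambda>z. Re (F z)" d])
         (use F d in \<open>auto intro!: continuous_intros\<close>)
    obtain q where q: "real_polynomial_function q" "\<And>z. z \<in> sphere 0 1 \<Longrightarrow> \<bar>Im (F z) - q z\<bar> < d"
      by (rule Stone_Weierstrass_real_polynomial_function [of "sphere 0 1" "\<lambda>z. Im (F z)" d])
         (use F d in \<open>auto intro!: continuous_intros\<close>)
    define P where "P t = of_real (p (cis t)) + (- \<i>) * of_real (q (cis t))" for t
    have "T P" unfolding P_def by (intro Tadd Tmult Tconst Tpoly p q)
    then have NP: "N (\<lambda>t. u t * P t)" using \<open>N u\<close> by (auto simp: T_def)
    then have P0: "integral {0..2*pi} (\<lambda>t. u t * P t) = 0"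
    proof -
      have "integral {0..2*pi} (\<lambda>t. u t * P t * cis (- (of_int 0 * t))) = 0" using NP unfolding N_def by blast
      then show ?thesis by simp
    qed
    have "I = integral {0..2*pi} (\<lambda>t. u t * cnj (u t)) - integral {0..2*pi} (\<lambda>t. u t * P t)"
      using P0 by (simp add: I_def)
    also have "\<dots> = integral {0..2*pi} (\<lambda>t. u t * cnj (u t) - u t * P t)"
      using NP cont by (intro integral_diff [symmetric] int) (auto simp: N_def intro!: continuous_intros)
    also have "norm \<dots> \<le> (B * (2 * d)) * (2 * pi - 0)"
    proof (rule integral_bound)
      show "continuous_on {0..2 * pi} (\<lambda>t. u t * cnj (u t) - u t * P t)"
      proof (intro continuous_on_diff)
        show "continuous_on {0..2 * pi} (\<lambda>t. u t * cnj (u t))"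
          by (intro continuous_intros continuous_on_subset [OF cont]) auto
        show "continuous_on {0..2 * pi} (\<lambda>t. u t * P t)"
          using NP unfolding N_def by (blast intro: continuous_on_subset)
      qed
      fix t assume t: "t \<in> {0..2*pi}"
      have "norm (cnj (u t) - P t) \<le> \<bar>Re (cnj (u t) - P t)\<bar> + \<bar>Im (cnj (u t) - P t)\<bar>" by (rule cmod_le)
      also have "\<dots> = \<bar>Re (F (cis t)) - p (cis t)\<bar> + \<bar>Im (F (cis t)) - q (cis t)\<bar>"
        by (simp add: F P_def)
      also have "\<dots> \<le> 2 * d" using p(2) [of "cis t"] q(2) [of "cis t"] by simp
      finally have "norm (u t) * norm (cnj (u t) - P t) \<le> B * (2 * d)"
        using B t by (intro mult_mono) auto
      then show "norm (u t * cnj (u t) - u t * P t) \<le> B * (2 * d)"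
        by (simp add: norm_mult right_diff_distrib [symmetric] del: complex_cnj_cnj)
    qed simp
    finally show ?thesis using B by (simp add: d_def)
  qed
  then have "norm I \<le> 0" by (rule field_le_epsilon [of _ 0, simplified])
  then have "I = 0" by simp
  moreover have "I = of_real (integral {0..2*pi} (\<lambda>t. (norm (u t))\<^sup>2))"
  proof -
    have "(\<lambda>t. (norm (u t))\<^sup>2) integrable_on {0..2*pi}"
      by (intro integrable_continuous_real continuous_intros continuous_on_subset [OF cont]) simp
    from integral_linear [OF this bounded_linear_of_real] show ?thesis
      unfolding I_def o_def complex_norm_square [symmetric] by simp
  qed
  ultimately have "integral {0..2*pi} (\<lambda>t. (norm (u t))\<^sup>2) = 0" by simp
  then have "\<forall>t\<in>{0..2*pi}. (norm (u t))\<^sup>2 = 0"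
    by (subst (asm) integral_eq_0_iff) (auto intro!: continuous_intros continuous_on_subset [OF cont])
  then have z: "u t = 0" if "t \<in> {0..2*pi}" for t using that by auto
  define n where "n = \<lfloor>t / (2 * pi)\<rfloor>"
  have "t + of_int (- n) * (2 * pi) \<in> {0..2*pi}"
    unfolding n_def using floor_divide_lower [of "2*pi" t] floor_divide_upper [of "2*pi" t] by (auto simp: algebra_simps)
  then show ?thesis using z periodic_int_mult [of u "2 * pi" t "- n"] per by metis
qed

lemma integral_cis: "integral {0..2*pi} (\<lambda>t. cis (of_int n * t)) = (if n = 0 then 2 * pi else 0)"
proof (cases "n = 0")
  case False
  have "((\<lambda>t. cis (of_int n * t) / (\<i> * of_int n)) has_vector_derivative cis (of_int n * t)) (at t)" for t
    using has_vector_derivative_divide [OF has_vector_derivative_cis_linear [of "of_int n" t], of "\<i> * complex_of_int n"] False by simp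
  from has_integral_FTC [OF this, of 0 "2*pi"] show ?thesis
    using False cis_multiple_2pi [of "of_int n"] by (simp add: integral_unique algebra_simps)
qed (simp add: scaleR_conv_of_real)

lemma norm_infsum_le_infsum:
  fixes f :: "'k \<Rightarrow> complex"
  assumes "g summable_on UNIV" "\<And>k. norm (f k) \<le> g k"
  shows "norm (\<Sum>\<^sub>\<infinity>k. f k) \<le> (\<Sum>\<^sub>\<infinity>k. g k)" "f summable_on UNIV"
proof -
  show f: "f summable_on UNIV"
    by (rule abs_summable_summable [OF Infinite_Sum.abs_summable_on_comparison_test' [OF assms(1)]]) (use assms in auto)
  show "norm (\<Sum>\<^sub>\<infinity>k. f k) \<le> (\<Sum>\<^sub>\<infinity>k. g k)"
    by (rule norm_infsum_le [OF has_sum_infsum [OF f] has_sum_infsum [OF assms(1)]]) (use assms in auto)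
qed

lemma fser_continuous: "continuous_on UNIV (fser h)" if "(\<lambda>n. norm (h n)) summable_on UNIV"
  unfolding fser_def by (rule continuous_on_infsum [OF _ _ that]) (auto simp: norm_mult intro!: continuous_intros)

lemma cis_int_shift: "cis (of_int n * (t + 2 * pi)) = cis (of_int n * t)"
  using cis_multiple_2pi [of "of_int n"] by (simp add: distrib_left cis_mult [symmetric] algebra_simps)

lemma fser_periodic: "fser h (t + 2 * pi) = fser h t"
  unfolding fser_def by (simp add: cis_int_shift)

lemma fcoef_fser: "fcoef (fser h) n = h n" if "(\<lambda>n. norm (h n)) summable_on UNIV"
proof -
  have "((\<lambda>k. integral {0..2*pi} (\<lambda>t. h k * cis (of_int (k - n) * t))) has_sum
     integral {0..2*pi} (\<lambda>t. \<Sum>\<^sub>\<infinity>k. h k * cis (of_int (k - n) * t))) UNIV"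
    by (rule has_sum_integral_infsum [OF _ _ that]) (auto simp: norm_mult intro!: continuous_intros)
  moreover have "(\<Sum>\<^sub>\<infinity>k. h k * cis (of_int (k - n) * t)) = fser h t * cis (- (of_int n * t))" for t
    unfolding fser_def by (subst infsum_cmult_left' [symmetric]) (simp add: mult.assoc cis_mult algebra_simps)
  moreover have "((\<lambda>k. integral {0..2*pi} (\<lambda>t. h k * cis (of_int (k - n) * t))) has_sum (h n * (2 * pi))) UNIV"
    by (rule has_sum_finite_neutralI [of "{n}"]) (auto simp: integral_cis scaleR_conv_of_real simp flip: of_int_diff)
  ultimately have "integral {0..2*pi} (\<lambda>t. fser h t * cis (- (of_int n * t))) = h n * (2 * pi)"
    using has_sum_unique by fastforce
  then show ?thesis by (simp add: fcoef_def)
qed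

lemma fcoef_diff:
  assumes "continuous_on UNIV u" "continuous_on UNIV v"
  shows "fcoef (\<lambda>t. u t - v t) n = fcoef u n - fcoef v n"
proof -
  have int: "(\<lambda>t. g t * cis (- (of_int n * t))) integrable_on {0..2*pi}" if "continuous_on UNIV g" for g :: "real \<Rightarrow> complex"
    by (intro integrable_continuous_real continuous_intros continuous_on_subset [OF that]) simp
  show ?thesis
    unfolding fcoef_def left_diff_distrib integral_diff [OF int [OF assms(1)] int [OF assms(2)]] diff_divide_distrib ..
qed

lemma fser_fcoef:
  assumes "continuous_on UNIV u" "\<And>t. u (t + 2 * pi) = u t" "(\<lambda>n. norm (fcoef u n)) summable_on UNIV"
  shows "fser (fcoef u) = u"
proof
  fix t
  have c: "continuous_on UNIV (\<lambda>t. u t - fser (fcoef u) t)"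
    using assms fser_continuous by (intro continuous_intros) auto
  have "fcoef (\<lambda>t. u t - fser (fcoef u) t) n = fcoef u n - fcoef (fser (fcoef u)) n" for n
    by (rule fcoef_diff) (use assms fser_continuous in auto)
  then have z: "fcoef (\<lambda>t. u t - fser (fcoef u) t) n = 0" for n
    using fcoef_fser [OF assms(3)] by simp
  have "u t - fser (fcoef u) t = 0"
    by (rule fourier_unique [OF c _ z]) (simp only: assms(2) fser_periodic)
  then show "fser (fcoef u) t = u t" by simp
qed

lemma fser_has_vector_derivative:
  assumes "(\<lambda>n. norm (h n) * (1 + (real_of_int n)\<^sup>2)) summable_on UNIV"
  shows "(fser h has_vector_derivative fser (\<lambda>n. \<i> * of_int n * h n) t) (at t)"
  using has_vector_derivative_cis_series [OF assms, of t] by (simp add: fser_def [abs_def])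

lemma fcoef_deriv:
  assumes "\<And>t. (u has_vector_derivative v t) (at t)" "continuous_on UNIV v" "\<And>t. u (t + 2 * pi) = u t"
  shows "fcoef v n = \<i> * of_int n * fcoef u n"
proof -
  have cu: "continuous_on UNIV u"
    using assms(1) by (metis continuous_at_imp_continuous_on has_vector_derivative_continuous)
  have d: "((\<lambda>t. u t * cis (of_int (-n) * t)) has_vector_derivative
     u t * (\<i> * of_int (-n) * cis (of_int (-n) * t)) + v t * cis (of_int (-n) * t)) (at t)" for t
    using has_vector_derivative_mult [OF assms(1) has_vector_derivative_cis_linear [of "of_int (-n)"]] by simp
  have "((\<lambda>t. u t * (\<i> * of_int (-n) * cis (of_int (-n) * t)) + v t * cis (of_int (-n) * t)) has_integral
     u (2*pi) * cis (of_int (-n) * (2 * pi)) - u 0 * cis (of_int (-n) * 0)) {0..2*pi}"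
    by (rule has_integral_FTC [OF d]) simp
  moreover have "cis (of_int (-n) * (2 * pi)) = 1" using cis_int_shift [of "-n" 0] by simp
  moreover have "(\<lambda>t. u t * (\<i> * of_int (-n) * cis (of_int (-n) * t)) + v t * cis (of_int (-n) * t))
     = (\<lambda>t. (- \<i> * of_int n) * (u t * cis (- (of_int n * t))) + v t * cis (- (of_int n * t)))"
    by (auto simp: algebra_simps)
  ultimately have 1: "((\<lambda>t. (- \<i> * of_int n) * (u t * cis (- (of_int n * t))) + v t * cis (- (of_int n * t))) has_integral 0) {0..2*pi}"
    using assms(3) [of 0] by simp
  have "((\<lambda>t. (- \<i> * of_int n) * (u t * cis (- (of_int n * t))) + v t * cis (- (of_int n * t))) has_integral
     (- \<i> * of_int n) * (fcoef u n * (2 * pi)) + fcoef v n * (2 * pi)) {0..2*pi}"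
    using cu assms(2) unfolding fcoef_def
    by (intro has_integral_add has_integral_mult_right)
       (auto intro!: integrable_integral integrable_continuous_real continuous_intros intro: continuous_on_subset)
  from has_integral_unique [OF this 1]
  have "(fcoef v n - \<i> * of_int n * fcoef u n) * (2 * pi) = 0" by (simp add: algebra_simps)
  then show ?thesis by simp
qed

lemma norm_fcoef_le:
  assumes "continuous_on UNIV u" "\<And>t. norm (u t) \<le> U"
  shows "norm (fcoef u n) \<le> U"
proof -
  have "norm (integral {0..2*pi} (\<lambda>t. u t * cis (- (of_int n * t)))) \<le> U * (2 * pi - 0)"
    using assms by (intro integral_bound) (auto intro!: continuous_intros simp: norm_mult intro: continuous_on_subset)
  then show ?thesis by (simp add: fcoef_def norm_divide divide_le_eq)
qed

section \<open>Fourier series on the torus\<close>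

definition chr :: "('i::finite \<Rightarrow> int) \<Rightarrow> real^'i \<Rightarrow> complex" where
  "chr k x = cis (\<Sum>i\<in>UNIV. of_int (k i) * x $ i)"

lemma chr_axis: "chr k (x + s *\<^sub>R axis j 1) = chr k x * cis (of_int (k j) * s)"
proof -
  have "real_of_int (k i) * (x + s *\<^sub>R axis j 1) $ i = real_of_int (k i) * x $ i + (if i = j then real_of_int (k i) * s else 0)" for i
    by (simp add: axis_def algebra_simps)
  then show ?thesis by (simp add: chr_def cis_mult sum.distrib)
qed

lemma chr_mult: "chr k x * chr l x = chr (\<lambda>i. k i + l i) x"
  by (simp add: chr_def cis_mult sum.distrib [symmetric] distrib_right)

lemma norm_chr [simp]: "norm (chr k x) = 1"
  by (simp add: chr_def)

lemma chr_zero [simp]: "chr (\<lambda>i. 0) x = 1"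
  by (simp add: chr_def)

lemma continuous_on_chr [continuous_intros]: "continuous_on A (chr k)"
  unfolding chr_def by (intro continuous_intros)

lemma torus_periodic_chr: "chr k (x + (2*pi) *\<^sub>R axis i 1) = chr k x"
  using cis_int_shift [of "k i" 0] by (simp add: chr_axis mult.commute)

text \<open>Torus coefficients are taken as iterated one-variable means. Averaging over all
  coordinates gives full coefficients, averaging over the \<open>x\<close> coordinates gives partial
  ones, so both obey the same lemmas.\<close>

definition avg :: "'i::finite \<Rightarrow> (real^'i \<Rightarrow> complex) \<Rightarrow> real^'i \<Rightarrow> complex" where
  "avg j g x = integral {0..2*pi} (\<lambda>s. g (x + s *\<^sub>R axis j 1)) / (2 * pi)"

primrec avgs :: "'i::finite list \<Rightarrow> (real^'i \<Rightarrow> complex) \<Rightarrow> real^'i \<Rightarrow> complex" where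
  "avgs [] g = g"
| "avgs (j # js) g = avg j (avgs js g)"

lemma continuous_on_line:
  assumes "continuous_on UNIV (g :: real^'i::finite \<Rightarrow> complex)"
  shows "continuous_on A (\<lambda>s. g (x + s *\<^sub>R axis j 1))"
  by (rule continuous_on_compose2 [OF assms]) (auto intro!: continuous_intros)

lemma integrable_line:
  assumes "continuous_on UNIV (g :: real^'i::finite \<Rightarrow> complex)"
  shows "(\<lambda>s. g (x + s *\<^sub>R axis j 1)) integrable_on {a..b}"
  by (rule integrable_continuous_real) (rule continuous_on_line [OF assms])

lemma continuous_on_avg:
  assumes "continuous_on UNIV g"
  shows "continuous_on UNIV (avg j g)"
proof -
  have "continuous_on UNIV (\<lambda>x. integral (cbox 0 (2*pi)) (\<lambda>s. g (x + s *\<^sub>R axis j 1)))"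
    by (rule integral_continuous_on_param)
      (auto simp: case_prod_unfold intro!: continuous_on_compose2 [OF assms] continuous_intros)
  then show ?thesis unfolding avg_def [abs_def] by (intro continuous_intros) (auto simp: cbox_interval)
qed

lemma continuous_on_avgs: "continuous_on UNIV g \<Longrightarrow> continuous_on UNIV (avgs js g)"
  by (induction js) (auto intro: continuous_on_avg)

lemma avg_add:
  assumes "continuous_on UNIV f" "continuous_on UNIV g"
  shows "avg j (\<lambda>x. f x + g x) = (\<lambda>x. avg j f x + avg j g x)"
  by (auto simp: avg_def integral_add integrable_line assms add_divide_distrib)

lemma avgs_add:
  assumes "continuous_on UNIV f" "continuous_on UNIV g"
  shows "avgs js (\<lambda>x. f x + g x) = (\<lambda>x. avgs js f x + avgs js g x)"
  by (induction js) (simp_all add: avg_add continuous_on_avgs assms)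

lemma avgs_mult_invariant:
  assumes "\<And>y i s. i \<in> set js \<Longrightarrow> \<phi> (y + s *\<^sub>R axis i 1) = \<phi> y"
  shows "avgs js (\<lambda>y. g y * \<phi> y) = (\<lambda>y. avgs js g y * \<phi> y)"
  using assms by (induction js) (auto simp: avg_def)

lemma norm_avg_le:
  assumes "continuous_on UNIV g" "\<And>x. norm (g x) \<le> U"
  shows "norm (avg j g x) \<le> U"
proof -
  have "norm (integral {0..2*pi} (\<lambda>s. g (x + s *\<^sub>R axis j 1))) \<le> U * (2 * pi - 0)"
    by (rule integral_bound) (auto intro!: continuous_on_line assms)
  then show ?thesis by (simp add: avg_def norm_divide divide_le_eq)
qed

lemma norm_avgs_le:
  assumes "continuous_on UNIV g" "\<And>x. norm (g x) \<le> U"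
  shows "norm (avgs js g x) \<le> U"
  using assms by (induction js arbitrary: x) (auto intro!: norm_avg_le continuous_on_avgs)

lemma avg_swap:
  assumes "continuous_on UNIV g"
  shows "avg i (avg j g) = avg j (avg i g)"
proof
  fix x
  have "integral (cbox 0 (2*pi)) (\<lambda>s. integral (cbox 0 (2*pi)) (\<lambda>t. g (x + s *\<^sub>R axis i 1 + t *\<^sub>R axis j 1)))
     = integral (cbox 0 (2*pi)) (\<lambda>t. integral (cbox 0 (2*pi)) (\<lambda>s. g (x + s *\<^sub>R axis i 1 + t *\<^sub>R axis j 1)))"
    by (rule integral_swap_continuous)
      (auto simp: case_prod_unfold intro!: continuous_on_compose2 [OF assms] continuous_intros)
  then show "avg i (avg j g) x = avg j (avg i g) x"
    by (simp add: avg_def cbox_interval add.assoc add.commute [of "_ *\<^sub>R axis i 1" "_ *\<^sub>R axis j 1"])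
qed

lemma avg_avgs_swap: "continuous_on UNIV g \<Longrightarrow> avg i (avgs js g) = avgs js (avg i g)"
proof (induction js)
  case (Cons j js)
  then show ?case by (simp add: avg_swap [of "avgs js g" i j] continuous_on_avgs)
qed simp

text \<open>Averages commute, so the one over \<open>j\<close> may be taken before all others;
  agreement after averaging in a single coordinate survives the whole average.\<close>

lemma avgs_cong_avg:
  assumes "continuous_on UNIV f" "continuous_on UNIV g" "avg j f = avg j g" "j \<in> set js"
  shows "avgs js f = avgs js g"
  using assms(4)
proof (induction js)
  case (Cons i js)
  then show ?case using assms by (cases "i = j") (auto simp: avg_avgs_swap)
qed simp

lemma torus_periodic_avgs: "torus_periodic g \<Longrightarrow> torus_periodic (avgs js g)"
proof (induction js)
  case (Cons j js)
  have "avgs js g (x + (2*pi) *\<^sub>R axis i 1 + s *\<^sub>R axis j 1) = avgs js g (x + s *\<^sub>R axis j 1)" for x i s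
  proof -
    have "x + (2*pi) *\<^sub>R axis i 1 + s *\<^sub>R axis j 1 = (x + s *\<^sub>R axis j 1) + (2*pi) *\<^sub>R axis i 1" by simp
    then show ?thesis using Cons unfolding torus_periodic_def by presburger
  qed
  then show ?case by (simp add: torus_periodic_def avg_def)
qed simp

lemma avg_translate:
  assumes "continuous_on UNIV g" "torus_periodic g"
  shows "avg j g (x + s *\<^sub>R axis j 1) = avg j g x"
proof -
  let ?u = "\<lambda>t. g (x + t *\<^sub>R axis j 1)"
  have shift: "?u (t + 2 * pi) = ?u t" for t
  proof -
    have "g ((x + t *\<^sub>R axis j 1) + (2*pi) *\<^sub>R axis j 1) = ?u t" using assms(2) unfolding torus_periodic_def by blast
    then show ?thesis by (simp add: scaleR_left_distrib add.assoc)
  qed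
  have "integral {0..2*pi} (\<lambda>t. ?u (s + t)) = integral {s..s + 2*pi} ?u"
    using integral_shift_Icc_real [of 0 "2*pi" "?u" s] by (simp add: o_def add.commute)
  also have "\<dots> = integral {0..2*pi} ?u"
    by (rule integral_periodic_shift) (auto simp: shift continuous_on_line [OF assms(1)])
  finally show ?thesis by (simp add: avg_def scaleR_left_distrib add.assoc)
qed

lemma avgs_translate:
  assumes "continuous_on UNIV g" "torus_periodic g" "j \<in> set js"
  shows "avgs js g (x + s *\<^sub>R axis j 1) = avgs js g x"
  using assms(3)
proof (induction js arbitrary: x)
  case (Cons i js)
  show ?case
  proof (cases "i = j")
    case True
    then show ?thesis using avg_translate [OF continuous_on_avgs torus_periodic_avgs] assms by simp
  next
    case False
    with Cons have IH: "\<And>x. avgs js g (x + s *\<^sub>R axis j 1) = avgs js g x" by auto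
    have "avgs js g (x + s *\<^sub>R axis j 1 + t *\<^sub>R axis i 1) = avgs js g (x + t *\<^sub>R axis i 1)" for t
      using IH [of "x + t *\<^sub>R axis i 1"] by (simp add: add.assoc add.commute [of "s *\<^sub>R _"])
    then show ?thesis by (simp add: avg_def)
  qed
qed simp

lemma translation_invariant_const:
  fixes f :: "real^'i::finite \<Rightarrow> 'a"
  assumes "\<And>x s j. f (x + s *\<^sub>R axis j 1) = f x"
  shows "f x = f 0"
proof -
  have "f (\<Sum>i\<in>A. x $ i *\<^sub>R axis i 1) = f 0" if "finite A" for A
    using that
  proof induction
    case (insert a A)
    then show ?case using assms [of "\<Sum>i\<in>A. x $ i *\<^sub>R axis i 1" "x $ a" a] by (simp add: add.commute)
  qed simp
  from this [of UNIV] show ?thesis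
    using basis_expansion [of x] by (simp add: scalar_mult_eq_scaleR)
qed

lemma avg_chr:
  "avg j (\<lambda>y. g y * chr (\<lambda>i. - k i) y) x = chr (\<lambda>i. - k i) x * fcoef (\<lambda>s. g (x + s *\<^sub>R axis j 1)) (k j)"
  by (simp add: avg_def fcoef_def chr_axis mult.assoc mult.left_commute [of _ "chr _ _"])

text \<open>Averaging out \<open>js\<close> leaves a function whose restriction to the
  \<open>j\<close>-line has zero Fourier coefficients; one-variable uniqueness then removes that
  coordinate. Admitting any list of distinct coordinates serves full and partial coefficients
  alike.\<close>

lemma avgs_unique:
  assumes g: "continuous_on UNIV g" "torus_periodic g" and "distinct js"
    and zero: "\<And>k. (\<And>i. i \<notin> set js \<Longrightarrow> k i = 0) \<Longrightarrow> avgs js (\<lambda>y. g y * chr (\<lambda>i. - k i) y) x = 0"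
  shows "g x = 0"
  using \<open>distinct js\<close> zero
proof (induction js)
  case Nil
  then show ?case using Nil.prems(2) [of "\<lambda>_. 0"] by simp
next
  case (Cons j js)
  show ?case
  proof (rule Cons.IH)
    show "distinct js" using Cons.prems by simp
    fix k :: "'a \<Rightarrow> int" assume k: "\<And>i. i \<notin> set js \<Longrightarrow> k i = 0"
    define H where "H = avgs js (\<lambda>y. g y * chr (\<lambda>i. - k i) y)"
    have gc: "continuous_on UNIV (\<lambda>y. g y * chr (\<lambda>i. - k i) y)" using g by (intro continuous_intros)
    have H: "continuous_on UNIV H" unfolding H_def by (rule continuous_on_avgs [OF gc])
    have "torus_periodic H"
      unfolding H_def by (rule torus_periodic_avgs) (use g in \<open>simp add: torus_periodic_def torus_periodic_chr\<close>)
    then have per: "H (x + (t + 2 * pi) *\<^sub>R axis j 1) = H (x + t *\<^sub>R axis j 1)" for t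
      unfolding torus_periodic_def by (simp add: scaleR_left_distrib add.assoc [symmetric])
    have "fcoef (\<lambda>s. H (x + s *\<^sub>R axis j 1)) n = 0" for n
    proof -
      \<comment> \<open>\<open>k\<close> vanishes at \<open>j\<close>, so \<open>k + l\<close> is an
        arbitrary frequency supported on \<open>j # js\<close>; \<open>chr\<close> of
        \<open>- l\<close> depends on coordinate \<open>j\<close> alone and passes through the
        averages over \<open>js\<close>.\<close>
      define l where "l = (\<lambda>i. if i = j then n else (0::int))"
      have kl: "chr (\<lambda>i. - (k i + l i)) y = chr (\<lambda>i. - k i) y * chr (\<lambda>i. - l i) y" for y
        by (simp add: chr_mult)
      have "avgs (j # js) (\<lambda>y. g y * chr (\<lambda>i. - (k i + l i)) y) x = 0"
        by (rule Cons.prems(2)) (use k in \<open>auto simp: l_def\<close>)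
      moreover have "avgs js (\<lambda>y. g y * chr (\<lambda>i. - (k i + l i)) y) = (\<lambda>y. H y * chr (\<lambda>i. - l i) y)"
        unfolding H_def kl mult.assoc [symmetric]
        by (rule avgs_mult_invariant) (use Cons.prems in \<open>auto simp: chr_axis l_def\<close>)
      ultimately have "avg j (\<lambda>y. H y * chr (\<lambda>i. - l i) y) x = 0" by simp
      moreover have "chr (\<lambda>i. - l i) x \<noteq> 0" using norm_chr [of "\<lambda>i. - l i" x] by (metis norm_zero zero_neq_one)
      ultimately show ?thesis unfolding avg_chr by (simp add: l_def)
    qed
    then have "H (x + 0 *\<^sub>R axis j 1) = 0"
      by (intro fourier_unique [of "\<lambda>s. H (x + s *\<^sub>R axis j 1)"] per continuous_on_line H) 
    then show "avgs js (\<lambda>y. g y * chr (\<lambda>i. - k i) y) x = 0" by (simp add: H_def)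
  qed
qed

definition coords :: "'i::finite list" where
  "coords = (SOME xs. set xs = UNIV \<and> distinct xs)"

lemma set_coords [simp]: "set coords = UNIV" and distinct_coords [simp]: "distinct coords"
  using someI_ex [OF finite_distinct_list [OF finite_class.finite_UNIV]] unfolding coords_def by auto

text \<open>The base point 0 is immaterial: for continuous periodic functions the average over all
  coordinates is translation invariant, hence constant.\<close>

definition tcoef :: "(real^'i::finite \<Rightarrow> complex) \<Rightarrow> ('i \<Rightarrow> int) \<Rightarrow> complex" where
  "tcoef f k = avgs coords (\<lambda>x. f x * chr (\<lambda>i. - k i) x) 0"

lemma tcoef_unique:
  assumes f: "continuous_on UNIV f" "torus_periodic f" and zero: "\<And>k. tcoef f k = 0"
  shows "f x = 0"
proof (rule avgs_unique [OF f distinct_coords])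
  fix k :: "'a \<Rightarrow> int"
  have "avgs coords (\<lambda>y. f y * chr (\<lambda>i. - k i) y) x = avgs coords (\<lambda>y. f y * chr (\<lambda>i. - k i) y) 0"
  proof (rule translation_invariant_const, rule avgs_translate)
    show "continuous_on UNIV (\<lambda>y. f y * chr (\<lambda>i. - k i) y)" using f by (intro continuous_intros)
    show "torus_periodic (\<lambda>y. f y * chr (\<lambda>i. - k i) y)" using f by (simp add: torus_periodic_def torus_periodic_chr)
  qed simp
  then show "avgs coords (\<lambda>y. f y * chr (\<lambda>i. - k i) y) x = 0" using zero [of k] by (simp add: tcoef_def)
qed

lemma norm_tcoef_le:
  assumes "continuous_on UNIV f" "\<And>x. norm (f x) \<le> U"
  shows "norm (tcoef f k) \<le> U"
  unfolding tcoef_def using assms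
  by (intro norm_avgs_le continuous_intros) (auto simp: norm_mult)

lemma tcoef_add:
  assumes "continuous_on UNIV f" "continuous_on UNIV g"
  shows "tcoef (\<lambda>x. f x + g x) k = tcoef f k + tcoef g k"
  unfolding tcoef_def distrib_right
  by (subst avgs_add) (auto intro!: continuous_intros assms)

lemma tcoef_cmult: "tcoef (\<lambda>x. c * f x) k = c * tcoef f k"
proof -
  have "avgs js (\<lambda>x. (f x * chr (\<lambda>i. - k i) x) * c) = (\<lambda>x. avgs js (\<lambda>x. f x * chr (\<lambda>i. - k i) x) x * c)" for js :: "'a list"
    by (rule avgs_mult_invariant) simp
  then show ?thesis by (simp add: tcoef_def mult.commute [of _ c] mult.assoc)
qed

text \<open>Integration by parts takes place along the \<open>j\<close>-th coordinate line only; the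
  remaining averages are then applied to both sides.\<close>

lemma tcoef_deriv:
  assumes "\<And>x. ((\<lambda>s. f (x + s *\<^sub>R axis j 1)) has_vector_derivative f' x) (at 0)"
    and c: "continuous_on UNIV f" "continuous_on UNIV f'" and "torus_periodic f"
  shows "tcoef f' k = \<i> * of_int (k j) * tcoef f k"
proof -
  have d: "((\<lambda>s. f (x + s *\<^sub>R axis j 1)) has_vector_derivative f' (x + t *\<^sub>R axis j 1)) (at t)" for x t
  proof -
    have "((\<lambda>s. f ((x + t *\<^sub>R axis j 1) + (s - t) *\<^sub>R axis j 1)) has_vector_derivative f' (x + t *\<^sub>R axis j 1)) (at t)"
    proof -
      have "((\<lambda>s. s - t) has_vector_derivative 1) (at t)" by (auto intro!: derivative_eq_intros)
      from vector_diff_chain_at [OF this, of "\<lambda>s. f ((x + t *\<^sub>R axis j 1) + s *\<^sub>R axis j 1)"] assms(1)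
      show ?thesis by (simp add: o_def)
    qed
    then show ?thesis by (simp add: algebra_simps)
  qed
  have per: "f (x + (t + 2 * pi) *\<^sub>R axis j 1) = f (x + t *\<^sub>R axis j 1)" for x t
    using assms(4) unfolding torus_periodic_def by (simp add: scaleR_left_distrib add.assoc [symmetric])
  have "avg j (\<lambda>y. f' y * chr (\<lambda>i. - k i) y) = avg j (\<lambda>y. (\<i> * of_int (k j) * f y) * chr (\<lambda>i. - k i) y)"
  proof
    fix x
    have "fcoef (\<lambda>s. f' (x + s *\<^sub>R axis j 1)) (k j) = \<i> * of_int (k j) * fcoef (\<lambda>s. f (x + s *\<^sub>R axis j 1)) (k j)"
      by (rule fcoef_deriv [OF d continuous_on_line [OF c(2)] per])
    moreover have "fcoef (\<lambda>s. \<i> * of_int (k j) * f (x + s *\<^sub>R axis j 1)) (k j) = \<i> * of_int (k j) * fcoef (\<lambda>s. f (x + s *\<^sub>R axis j 1)) (k j)"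
      by (simp add: fcoef_def mult.assoc)
    ultimately show "avg j (\<lambda>y. f' y * chr (\<lambda>i. - k i) y) x = avg j (\<lambda>y. (\<i> * of_int (k j) * f y) * chr (\<lambda>i. - k i) y) x"
      unfolding avg_chr by simp
  qed
  then have "avgs coords (\<lambda>y. f' y * chr (\<lambda>i. - k i) y) = avgs coords (\<lambda>y. (\<i> * of_int (k j) * f y) * chr (\<lambda>i. - k i) y)"
    using c by (intro avgs_cong_avg [of _ _ j] continuous_intros) auto
  then have "tcoef f' k = tcoef (\<lambda>y. \<i> * of_int (k j) * f y) k" by (simp add: tcoef_def)
  then show ?thesis by (simp add: tcoef_cmult)
qed

section \<open>Absolutely convergent trigonometric series on the torus\<close>

definition tser :: "(('i::finite \<Rightarrow> int) \<Rightarrow> complex) \<Rightarrow> real^'i \<Rightarrow> complex" where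
  "tser c x = (\<Sum>\<^sub>\<infinity>k. c k * chr k x)"

lemma tser_summable:
  assumes "(\<lambda>k. norm (c k)) summable_on UNIV"
  shows "(\<lambda>k. c k * chr k x) summable_on UNIV"
  by (rule norm_infsum_le_infsum(2) [OF assms]) (simp add: norm_mult)

lemma continuous_on_tser:
  assumes "(\<lambda>k. norm (c k)) summable_on UNIV"
  shows "continuous_on UNIV (tser c)"
  unfolding tser_def [abs_def]
  by (rule continuous_on_infsum [OF _ _ assms]) (auto simp: norm_mult intro!: continuous_intros)

lemma torus_periodic_tser: "torus_periodic (tser c)"
  by (simp add: torus_periodic_def tser_def torus_periodic_chr)

lemma tser_add:
  assumes "(\<lambda>k. norm (c k)) summable_on UNIV" "(\<lambda>k. norm (d k)) summable_on UNIV"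
  shows "tser (\<lambda>k. c k + d k) x = tser c x + tser d x"
  unfolding tser_def distrib_right by (rule infsum_add) (auto intro: tser_summable assms)

lemma tser_cmult: "tser (\<lambda>k. a * c k) x = a * tser c x"
  unfolding tser_def mult.assoc by (rule infsum_cmult_right')

lemma summable_restrict:
  fixes c :: "'k \<Rightarrow> complex"
  assumes "(\<lambda>k. norm (c k)) summable_on UNIV"
  shows "(\<lambda>k. norm (if P k then c k else 0)) summable_on UNIV"
  by (rule Infinite_Sum.abs_summable_on_comparison_test' [OF assms]) auto

lemma avg_tser:
  assumes "(\<lambda>k. norm (c k)) summable_on UNIV"
  shows "avg j (tser c) = tser (\<lambda>k. if k j = 0 then c k else 0)"
proof
  fix x
  have "((\<lambda>k. integral {0..2*pi} (\<lambda>s. c k * chr k (x + s *\<^sub>R axis j 1))) has_sum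
      integral {0..2*pi} (\<lambda>s. \<Sum>\<^sub>\<infinity>k. c k * chr k (x + s *\<^sub>R axis j 1))) UNIV"
    by (rule has_sum_integral_infsum [OF _ _ assms]) (auto simp: norm_mult intro!: continuous_intros continuous_on_line)
  then have *: "((\<lambda>k. integral {0..2*pi} (\<lambda>s. c k * chr k (x + s *\<^sub>R axis j 1)) / (2 * pi)) has_sum avg j (tser c) x) UNIV"
    unfolding avg_def tser_def by (rule has_sum_divide_const)
  have "integral {0..2*pi} (\<lambda>s. c k * chr k (x + s *\<^sub>R axis j 1)) / (2 * pi) = (if k j = 0 then c k else 0) * chr k x" for k
    by (simp add: chr_axis integral_cis mult.assoc [symmetric])
  with * have "((\<lambda>k. (if k j = 0 then c k else 0) * chr k x) has_sum avg j (tser c) x) UNIV" by simp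
  then show "avg j (tser c) x = tser (\<lambda>k. if k j = 0 then c k else 0) x"
    unfolding tser_def by (rule infsumI [symmetric])
qed

lemma avgs_tser:
  assumes "(\<lambda>k. norm (c k)) summable_on UNIV"
  shows "avgs js (tser c) = tser (\<lambda>k. if \<forall>j\<in>set js. k j = 0 then c k else 0)"
proof (induction js)
  case (Cons j js)
  have "avgs (j # js) (tser c) = tser (\<lambda>k. if k j = 0 then if \<forall>j\<in>set js. k j = 0 then c k else 0 else 0)"
    by (simp add: Cons avg_tser summable_restrict assms)
  also have "(\<lambda>k. if k j = 0 then if \<forall>j\<in>set js. k j = 0 then c k else 0 else 0) = (\<lambda>k. if \<forall>j\<in>set (j # js). k j = 0 then c k else 0)"
    by auto
  finally show ?case .
qed simp

lemma summable_shift: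
  fixes c :: "('i \<Rightarrow> int) \<Rightarrow> 'a::{topological_comm_monoid_add}"
  shows "(\<lambda>k. c (\<lambda>i. k i + l i)) summable_on UNIV \<longleftrightarrow> c summable_on UNIV"
  by (rule summable_on_reindex_bij_witness [where j = "\<lambda>k i. k i + l i" and i = "\<lambda>k i. k i - l i"]) auto

lemma tser_mult_chr: "tser c x * chr (\<lambda>i. - l i) x = tser (\<lambda>k. c (\<lambda>i. k i + l i)) x"
proof -
  have "tser c x * chr (\<lambda>i. - l i) x = (\<Sum>\<^sub>\<infinity>k. c k * chr k x * chr (\<lambda>i. - l i) x)"
    unfolding tser_def by (rule infsum_cmult_left' [symmetric])
  also have "\<dots> = (\<Sum>\<^sub>\<infinity>k. c (\<lambda>i. k i + l i) * chr k x)"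
    by (rule infsum_reindex_bij_witness [where i = "\<lambda>k i. k i + l i" and j = "\<lambda>k i. k i - l i"])
       (auto simp: mult.assoc chr_mult)
  finally show ?thesis by (simp add: tser_def)
qed

lemma tcoef_tser:
  assumes "(\<lambda>k. norm (c k)) summable_on UNIV"
  shows "tcoef (tser c) l = c l"
proof -
  have "tcoef (tser c) l = tser (\<lambda>k. if \<forall>j\<in>UNIV. k j = 0 then c (\<lambda>i. k i + l i) else 0) 0"
    using summable_shift [of "\<lambda>k. norm (c k)" l] assms
    by (simp add: tcoef_def tser_mult_chr avgs_tser)
  also have "\<dots> = (\<Sum>\<^sub>\<infinity>k\<in>{\<lambda>i. 0}. c (\<lambda>i. k i + l i) * chr k 0)"
    unfolding tser_def by (rule infsum_cong_neutral) (auto simp: fun_eq_iff)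
  also have "\<dots> = c l" by simp
  finally show ?thesis .
qed

lemma tser_tcoef:
  assumes f: "continuous_on UNIV f" "torus_periodic f" and "(\<lambda>k. norm (tcoef f k)) summable_on UNIV"
  shows "tser (tcoef f) = f"
proof
  fix x
  have "f x + (-1) * tser (tcoef f) x = 0"
  proof (rule tcoef_unique)
    show "continuous_on UNIV (\<lambda>x. f x + (-1) * tser (tcoef f) x)"
      by (intro continuous_intros f continuous_on_tser assms)
    show "torus_periodic (\<lambda>x. f x + (-1) * tser (tcoef f) x)"
      using f(2) torus_periodic_tser [of "tcoef f"] by (simp add: torus_periodic_def)
    show "tcoef (\<lambda>x. f x + (-1) * tser (tcoef f) x) k = 0" for k
      by (subst tcoef_add, fact, intro continuous_intros continuous_on_tser assms, subst tcoef_cmult)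
         (simp add: tcoef_tser assms)
  qed
  then show "tser (tcoef f) x = f x" by simp
qed

lemma tser_has_vector_derivative:
  assumes "(\<lambda>k. norm (c k) * (1 + (l1 k)\<^sup>2)) summable_on UNIV"
  shows "((\<lambda>s. tser c (x + s *\<^sub>R axis j 1)) has_vector_derivative tser (\<lambda>k. \<i> * of_int (k j) * c k) x) (at 0)"
proof -
  have "(\<lambda>k. norm (c k * chr k x) * (1 + (real_of_int (k j))\<^sup>2)) summable_on UNIV"
    by (rule summable_on_comparison_test [OF assms])
       (auto simp: norm_mult intro!: mult_left_mono power2_le_iff_abs_le[THEN iffD2] l1_ge_coord)
  from has_vector_derivative_cis_series [OF this, of 0] show ?thesis
    by (simp add: tser_def chr_axis mult.assoc)
qed

definition conv :: "(('i \<Rightarrow> int) \<Rightarrow> complex) \<Rightarrow> (('i \<Rightarrow> int) \<Rightarrow> complex) \<Rightarrow> ('i \<Rightarrow> int) \<Rightarrow> complex" where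
  "conv c d k = (\<Sum>\<^sub>\<infinity>l. c l * d (\<lambda>i. k i - l i))"

text \<open>Absolute summability over pairs permits reindexing by \<open>(l + m, l)\<close> and
  summation over \<open>l\<close> for each fixed sum of frequencies.\<close>

lemma tser_mult:
  assumes c: "(\<lambda>k. norm (c k)) summable_on UNIV" and d: "(\<lambda>k. norm (d k)) summable_on UNIV"
  shows "tser c x * tser d x = tser (conv c d) x"
proof -
  let ?f = "\<lambda>(l, m). c l * chr l x * (d m * chr m x)"
  let ?g = "\<lambda>(k, l). c l * d (\<lambda>i. k i - l i) * chr k x"
  have "(\<lambda>p. norm (?f p)) summable_on UNIV \<times> UNIV"
    using Infinite_Sum.abs_summable_on_Sigma_iff [of ?f UNIV "\<lambda>_. UNIV"] c d
    by (auto simp: norm_mult infsum_cmult_right' abs_mult infsum_nonneg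
       intro!: summable_on_cmult_right summable_on_cmult_left)
  then have "?f summable_on UNIV \<times> UNIV" by (rule abs_summable_summable)
  then have "(?f has_sum (tser c x * tser d x)) (UNIV \<times> UNIV)"
    using tser_summable [OF c, of x] tser_summable [OF d, of x]
    by (intro has_sum_SigmaI [where g = "\<lambda>l. c l * chr l x * tser d x"])
       (auto simp: tser_def intro!: has_sum_cmult_right has_sum_cmult_left)
  also have "?this \<longleftrightarrow> (?g has_sum (tser c x * tser d x)) (UNIV \<times> UNIV)"
    by (rule has_sum_reindex_bij_witness [where j = "\<lambda>(l, m). (\<lambda>i. l i + m i, l)" and i = "\<lambda>(k, l). (l, \<lambda>i. k i - l i)"])
       (auto simp: chr_mult [symmetric])
  finally have g: "(?g has_sum (tser c x * tser d x)) (UNIV \<times> UNIV)" .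
  have "((\<lambda>k. conv c d k * chr k x) has_sum (tser c x * tser d x)) UNIV"
  proof (rule has_sum_Sigma' [OF g])
    fix k :: "'a \<Rightarrow> int"
    have "?g summable_on UNIV \<times> UNIV" using g by (rule has_sum_imp_summable)
    then have "(\<lambda>l. c l * d (\<lambda>i. k i - l i) * chr k x) summable_on UNIV"
      by (rule summable_on_SigmaD1) simp
    then have "(\<lambda>l. c l * d (\<lambda>i. k i - l i) * chr k x * chr (\<lambda>i. - k i) x) summable_on UNIV"
      by (rule summable_on_cmult_left)
    then have "(\<lambda>l. c l * d (\<lambda>i. k i - l i)) summable_on UNIV" by (simp add: mult.assoc chr_mult)
    then show "((\<lambda>l. ?g (k, l)) has_sum conv c d k * chr k x) UNIV"
      by (auto simp: conv_def intro!: has_sum_cmult_left)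
  qed
  then show ?thesis unfolding tser_def by (simp add: infsumI)
qed

text \<open>Polynomial decay of every order is stable under termwise differentiation and follows
  from weighted decay, so smoothness is settled at this level without tracking constants.\<close>

definition rapid :: "(('i::finite \<Rightarrow> int) \<Rightarrow> complex) \<Rightarrow> bool" where
  "rapid c \<longleftrightarrow> (\<forall>p. (\<lambda>k. norm (c k) * (1 + l1 k) ^ p) summable_on UNIV)"

lemma rapid_summable: "rapid c \<Longrightarrow> (\<lambda>k. norm (c k)) summable_on UNIV"
  unfolding rapid_def by (drule spec [of _ 0]) simp

lemma rapid_tser_deriv:
  assumes "rapid c"
  shows "((\<lambda>s. tser c (x + s *\<^sub>R axis j 1)) has_vector_derivative tser (\<lambda>k. \<i> * of_int (k j) * c k) x) (at 0)"
proof (rule tser_has_vector_derivative)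
  have "(\<lambda>k. norm (c k) * (1 + l1 k) ^ 2) summable_on UNIV" using assms unfolding rapid_def by blast
  then show "(\<lambda>k. norm (c k) * (1 + (l1 k)\<^sup>2)) summable_on UNIV"
    by (rule summable_on_comparison_test) (auto simp: power2_sum intro!: mult_left_mono)
qed

lemma rapid_mult_coord:
  assumes "rapid c"
  shows "rapid (\<lambda>k. \<i> * of_int (k j) * c k)"
  unfolding rapid_def
proof
  fix p
  have "(\<lambda>k. norm (c k) * (1 + l1 k) ^ (Suc p)) summable_on UNIV" using assms unfolding rapid_def by blast
  then show "(\<lambda>k. norm (\<i> * of_int (k j) * c k) * (1 + l1 k) ^ p) summable_on UNIV"
  proof (rule summable_on_comparison_test)
    fix k :: "'a \<Rightarrow> int"
    have "\<bar>real_of_int (k j)\<bar> * (norm (c k) * (1 + l1 k) ^ p) \<le> (1 + l1 k) * (norm (c k) * (1 + l1 k) ^ p)"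
      using l1_ge_coord [of k j] by (intro mult_right_mono mult_nonneg_nonneg) auto
    then show "norm (\<i> * of_int (k j) * c k) * (1 + l1 k) ^ p \<le> norm (c k) * (1 + l1 k) ^ (Suc p)"
      by (simp add: norm_mult algebra_simps)
  qed simp
qed

lemma pd_tser: "rapid c \<Longrightarrow> pd j (tser c) = tser (\<lambda>k. \<i> * of_int (k j) * c k)"
  unfolding pd_def by (rule ext) (rule vector_derivative_at [OF rapid_tser_deriv])

lemma pds_tser:
  assumes "rapid c"
  shows "rapid (\<lambda>k. (\<Prod>j\<leftarrow>ds. \<i> * of_int (k j)) * c k) \<and> pds ds (tser c) = tser (\<lambda>k. (\<Prod>j\<leftarrow>ds. \<i> * of_int (k j)) * c k)"
proof (induction ds)
  case (Cons j ds)
  then show ?case using rapid_mult_coord [of _ j] pd_tser [of _ j]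
    by (simp add: mult.assoc)
qed (use assms in simp)

lemma smooth_tser:
  assumes "rapid c"
  shows "smooth_fun (tser c)"
  unfolding smooth_fun_def
proof (intro allI conjI)
  fix ds :: "'a list"
  note p = pds_tser [OF assms, of ds]
  show "continuous_on UNIV (pds ds (tser c))"
    using p by (simp add: continuous_on_tser rapid_summable)
  show "(\<lambda>s. pds ds (tser c) (x + s *\<^sub>R axis i 1)) differentiable (at 0)" for i x
    using rapid_tser_deriv [OF conjunct1 [OF p], of x i] p differentiableI_vector by auto
qed

lemma norm_prod_coords_le: "norm (\<Prod>j\<leftarrow>ds. \<i> * complex_of_int (k j)) \<le> l1 k ^ length ds"
  by (induction ds) (auto simp: norm_mult intro!: mult_mono l1_ge_coord)

lemma torus_periodic_pd: "torus_periodic f \<Longrightarrow> torus_periodic (pd i f)"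
proof -
  assume f: "torus_periodic f"
  have "f (x + (2*pi) *\<^sub>R axis j 1 + s *\<^sub>R axis i 1) = f (x + s *\<^sub>R axis i 1)" for x j s
  proof -
    have "x + (2*pi) *\<^sub>R axis j 1 + s *\<^sub>R axis i 1 = (x + s *\<^sub>R axis i 1) + (2*pi) *\<^sub>R axis j 1" by simp
    then show ?thesis using f unfolding torus_periodic_def by presburger
  qed
  then show ?thesis by (simp add: torus_periodic_def pd_def)
qed

lemma torus_periodic_pds: "torus_periodic f \<Longrightarrow> torus_periodic (pds ds f)"
  by (induction ds) (auto intro: torus_periodic_pd)

lemma tcoef_pds_replicate:
  assumes "smooth_fun f" "torus_periodic f"
  shows "tcoef (pds (replicate n j) f) k = (\<i> * of_int (k j)) ^ n * tcoef f k"
proof (induction n)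
  case (Suc n)
  have "tcoef (pds (j # replicate n j) f) k = \<i> * of_int (k j) * tcoef (pds (replicate n j) f) k"
  proof (rule tcoef_deriv)
    show "((\<lambda>s. pds (replicate n j) f (x + s *\<^sub>R axis j 1)) has_vector_derivative pds (j # replicate n j) f x) (at 0)" for x
      using assms(1) unfolding smooth_fun_def pds.simps pd_def by (simp add: vector_derivative_works [symmetric])
    show "continuous_on UNIV (pds (replicate n j) f)" "continuous_on UNIV (pds (j # replicate n j) f)"
      using assms(1) unfolding smooth_fun_def by blast+
    show "torus_periodic (pds (replicate n j) f)" by (rule torus_periodic_pds [OF assms(2)])
  qed
  then show ?case using Suc by simp
qed simp

text \<open>The coefficients \<open>a j\<close>, \<open>b j\<close> depend on one variable only; on
  the torus their series is supported on a frequency axis.\<close>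

lemma tser_single_coord:
  "tser (\<lambda>k. if \<forall>j. j \<noteq> i \<longrightarrow> k j = 0 then h (k i) else 0) x = fser h (x $ i)"
proof -
  have "tser (\<lambda>k. if \<forall>j. j \<noteq> i \<longrightarrow> k j = 0 then h (k i) else 0) x
     = (\<Sum>\<^sub>\<infinity>k\<in>{k. \<forall>j. j \<noteq> i \<longrightarrow> k j = 0}. h (k i) * chr k x)"
    unfolding tser_def by (rule infsum_cong_neutral) auto
  also have "\<dots> = (\<Sum>\<^sub>\<infinity>n. h n * cis (of_int n * x $ i))"
  proof (rule infsum_reindex_bij_witness [where i = "\<lambda>n j. if j = i then n else 0" and j = "\<lambda>k. k i"])
    fix k :: "'a \<Rightarrow> int" assume "k \<in> {k. \<forall>j. j \<noteq> i \<longrightarrow> k j = 0}"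
    then have "(\<Sum>j\<in>UNIV. real_of_int (k j) * x $ j) = (\<Sum>j\<in>UNIV. if j = i then real_of_int (k i) * x $ i else 0)"
      by (intro sum.cong) auto
    then show "h (k i) * cis (real_of_int (k i) * x $ i) = h (k i) * chr k x" by (simp add: chr_def)
  qed (auto simp: fun_eq_iff)
  finally show ?thesis by (simp add: fser_def)
qed

section \<open>Fourier characterization of ultradifferentiable functions\<close>

context weight_subadd
begin

text \<open>Membership only asks for some \<open>C\<close> and \<epsilon>; both are parameters
  because the fibrewise arguments must know how they depend on \<xi>.\<close>

definition decay :: "real \<Rightarrow> real \<Rightarrow> (('i::finite \<Rightarrow> int) \<Rightarrow> complex) \<Rightarrow> bool" where
  "decay C \<epsilon> c \<longleftrightarrow> (\<forall>k. norm (c k) \<le> C * exp (- \<epsilon> * \<omega> (l1 k)))"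

lemma decay_nonneg: "decay C \<epsilon> c \<Longrightarrow> C \<ge> 0"
  unfolding decay_def by (meson exp_gt_zero norm_ge_zero order_trans zero_le_mult_iff not_le)

lemma decay_mono:
  assumes "decay C \<epsilon> c" "C \<le> C'" "\<epsilon>' \<le> \<epsilon>"
  shows "decay C' \<epsilon>' c"
  unfolding decay_def
proof
  fix k
  have "norm (c k) \<le> C * exp (- \<epsilon> * \<omega> (l1 k))" using assms by (auto simp: decay_def)
  also have "\<dots> \<le> C' * exp (- \<epsilon>' * \<omega> (l1 k))"
    using assms decay_nonneg [OF assms(1)] w_nonneg [of "l1 k"] by (intro mult_mono) (auto intro: mult_right_mono)
  finally show "norm (c k) \<le> C' * exp (- \<epsilon>' * \<omega> (l1 k))" .
qed

lemma decay_rapid: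
  assumes "decay C \<epsilon> c" "\<epsilon> > 0"
  shows "rapid c"
  unfolding rapid_def
proof
  fix p
  obtain K where K: "K > 0" "\<And>t. t \<ge> 0 \<Longrightarrow> (1 + t) ^ p \<le> K * exp (\<epsilon> / 2 * \<omega> t)"
    using w_poly [of "\<epsilon> / 2" p] assms(2) by auto
  show "(\<lambda>k. norm (c k) * (1 + l1 k) ^ p) summable_on UNIV"
  proof (rule summable_on_comparison_test)
    show "(\<lambda>k. C * K * exp (- (\<epsilon> / 2) * \<omega> (l1 k))) summable_on (UNIV :: ('a \<Rightarrow> int) set)"
      using assms(2) by (intro summable_on_cmult_right summable_exp_w) simp
    fix k :: "'a \<Rightarrow> int"
    have "norm (c k) * (1 + l1 k) ^ p \<le> (C * exp (- \<epsilon> * \<omega> (l1 k))) * (K * exp (\<epsilon> / 2 * \<omega> (l1 k)))"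
      using assms K decay_nonneg [OF assms(1)] by (intro mult_mono) (auto simp: decay_def)
    also have "\<dots> = C * K * exp (- \<epsilon> * \<omega> (l1 k) + \<epsilon> / 2 * \<omega> (l1 k))" unfolding exp_add by simp
    also have "- \<epsilon> * \<omega> (l1 k) + \<epsilon> / 2 * \<omega> (l1 k) = - (\<epsilon> / 2) * \<omega> (l1 k)" by simp
    finally show "norm (c k) * (1 + l1 k) ^ p \<le> C * K * exp (- (\<epsilon> / 2) * \<omega> (l1 k))" .
  qed simp
qed

definition wsum :: "'i::finite itself \<Rightarrow> real \<Rightarrow> real" where
  "wsum _ \<epsilon> = (\<Sum>\<^sub>\<infinity>k::'i \<Rightarrow> int. exp (- \<epsilon> * \<omega> (l1 k)))"

text \<open>Half of the exponent pays for derivatives by Young's inequality, the other half makes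
  the series converge. Linearity in \<open>C\<close> later shows that tails of a series are small in
  a fixed step of the inductive limit.\<close>

lemma seminorm_tser_le:
  fixes c :: "('i::finite \<Rightarrow> int) \<Rightarrow> complex"
  assumes "decay C \<epsilon> c" "\<epsilon> > 0" "y \<in> seminorm_set \<omega> (\<epsilon> / 2) (tser c)"
  shows "y \<le> C * (exp (\<epsilon> / 2 * \<omega> 1) * wsum TYPE('i) (\<epsilon> / 2))"
proof -
  define lam where "lam = \<epsilon> / 2"
  have lam: "lam > 0" using assms by (simp add: lam_def)
  obtain x ds where y: "y = norm (pds ds (tser c) x) * exp (- lam * phi_star \<omega> (real (length ds) / lam))"
    using assms(3) unfolding seminorm_set_def lam_def by blast
  define P where "P = exp (lam * phi_star \<omega> (real (length ds) / lam))"
  note p = pds_tser [OF decay_rapid [OF assms(1,2)], of ds]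
  have bound: "norm ((\<Prod>j\<leftarrow>ds. \<i> * of_int (k j)) * c k) \<le> C * (exp (lam * \<omega> 1) * P) * exp (- lam * \<omega> (l1 k))" for k
  proof -
    have "norm ((\<Prod>j\<leftarrow>ds. \<i> * of_int (k j)) * c k) \<le> l1 k ^ length ds * (C * exp (- \<epsilon> * \<omega> (l1 k)))"
      unfolding norm_mult using norm_prod_coords_le assms by (intro mult_mono) (auto simp: decay_def)
    also have "exp (- \<epsilon> * \<omega> (l1 k)) = exp (- lam * \<omega> (l1 k)) * exp (- lam * \<omega> (l1 k))"
      by (simp add: exp_add [symmetric] lam_def)
    also have "l1 k ^ length ds * (C * (exp (- lam * \<omega> (l1 k)) * exp (- lam * \<omega> (l1 k))))
        = C * (l1 k ^ length ds * exp (- lam * \<omega> (l1 k))) * exp (- lam * \<omega> (l1 k))" by simp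
    also have "\<dots> \<le> C * (exp (lam * \<omega> 1) * P) * exp (- lam * \<omega> (l1 k))"
      unfolding P_def using decay_nonneg [OF assms(1)] l1_power_exp_w_le [OF lam]
      by (intro mult_right_mono mult_left_mono) auto
    finally show ?thesis .
  qed
  have "norm (pds ds (tser c) x) \<le> (\<Sum>\<^sub>\<infinity>k::'i \<Rightarrow> int. C * (exp (lam * \<omega> 1) * P) * exp (- lam * \<omega> (l1 k)))"
    unfolding conjunct2 [OF p] tser_def
  proof (rule norm_infsum_le_infsum(1))
    show "(\<lambda>k::'i \<Rightarrow> int. C * (exp (lam * \<omega> 1) * P) * exp (- lam * \<omega> (l1 k))) summable_on UNIV"
      by (intro summable_on_cmult_right summable_exp_w lam)
    show "norm ((\<Prod>j\<leftarrow>ds. \<i> * of_int (k j)) * c k * chr k x) \<le> C * (exp (lam * \<omega> 1) * P) * exp (- lam * \<omega> (l1 k))" for k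
      unfolding norm_mult [of _ "chr k x"] norm_chr mult_1_right by (rule bound)
  qed
  also have "\<dots> = C * (exp (lam * \<omega> 1) * P) * wsum TYPE('i) lam"
    unfolding wsum_def by (rule infsum_cmult_right')
  finally have "y \<le> C * (exp (lam * \<omega> 1) * P) * wsum TYPE('i) lam * exp (- lam * phi_star \<omega> (real (length ds) / lam))"
    unfolding y by (rule mult_right_mono) simp
  also have "\<dots> = C * (exp (lam * \<omega> 1) * wsum TYPE('i) lam) * (P * exp (- lam * phi_star \<omega> (real (length ds) / lam)))"
    by simp
  also have "P * exp (- lam * phi_star \<omega> (real (length ds) / lam)) = 1"
    by (simp add: P_def exp_minus)
  finally show ?thesis by (simp add: lam_def)
qed

lemma tser_E_lam:
  assumes "decay C \<epsilon> c" "\<epsilon> > 0"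
  shows "E_lam \<omega> (\<epsilon> / 2) (tser c)"
  unfolding E_lam_def
  using torus_periodic_tser smooth_tser [OF decay_rapid [OF assms]] seminorm_tser_le [OF assms]
  by (auto intro!: bdd_aboveI)

lemma norm_lam_tser_le:
  fixes c :: "('i::finite \<Rightarrow> int) \<Rightarrow> complex"
  assumes "decay C \<epsilon> c" "\<epsilon> > 0"
  shows "norm_lam \<omega> (\<epsilon> / 2) (tser c) \<le> C * (exp (\<epsilon> / 2 * \<omega> 1) * wsum TYPE('i) (\<epsilon> / 2))"
  unfolding norm_lam_def
  by (rule cSup_least) (use seminorm_tser_le [OF assms] in \<open>auto simp: seminorm_set_def\<close>)

lemma tser_E_omega: "decay C \<epsilon> c \<Longrightarrow> \<epsilon> > 0 \<Longrightarrow> E_omega \<omega> (tser c)"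
  unfolding E_omega_def using tser_E_lam [of C \<epsilon> c] by (intro exI [of _ "\<epsilon> / 2"]) auto

lemma norm_pds_le:
  assumes "E_lam \<omega> lam f"
  shows "norm (pds ds f x) \<le> norm_lam \<omega> lam f * exp (lam * phi_star \<omega> (real (length ds) / lam))"
proof -
  have "norm (pds ds f x) * exp (- lam * phi_star \<omega> (real (length ds) / lam)) \<le> norm_lam \<omega> lam f"
    unfolding norm_lam_def by (rule cSup_upper) (use assms in \<open>auto simp: seminorm_set_def E_lam_def\<close>)
  then show ?thesis by (simp add: exp_minus field_simps)
qed

text \<open>Repeated differentiation in one variable bounds a coefficient against powers of one
  coordinate; the largest coordinate and the optimal order give decay in that coordinate, then in
  \<open>l1 k\<close>.\<close>

lemma E_lam_tcoef_decay:
  fixes f :: "real^'i::finite \<Rightarrow> complex"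
  assumes "E_lam \<omega> lam f" "lam > 0"
  shows "\<exists>C \<epsilon>. \<epsilon> > 0 \<and> decay C \<epsilon> (tcoef f)"
proof -
  define B where "B = norm_lam \<omega> lam f"
  have f: "smooth_fun f" "torus_periodic f" using assms by (auto simp: E_lam_def)
  have cont: "continuous_on UNIV (pds ds f)" for ds using f by (auto simp: smooth_fun_def)
  have bound: "norm (tcoef f k) * \<bar>real_of_int (k j)\<bar> ^ n \<le> B * exp (lam * phi_star \<omega> (real n / lam))" for k j n
  proof -
    have "norm (tcoef (pds (replicate n j) f) k) \<le> B * exp (lam * phi_star \<omega> (real n / lam))"
      using norm_pds_le [OF assms(1), of "replicate n j"] unfolding B_def
      by (intro norm_tcoef_le cont) simp
    then show ?thesis by (simp add: tcoef_pds_replicate f norm_mult norm_power mult.commute)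
  qed
  have "0 \<le> B * exp (lam * phi_star \<omega> (real 0 / lam))"
    using bound [of _ _ 0] by (meson norm_ge_zero mult_nonneg_nonneg order_trans zero_le_power abs_ge_zero)
  then have B: "B \<ge> 0" by (simp add: zero_le_mult_iff)
  obtain K where K: "K > 0" "\<And>t. t \<ge> 0 \<Longrightarrow> (1 + t) ^ 1 \<le> K * exp (lam / 2 * \<omega> t)"
    using w_poly [of "lam / 2" 1] assms(2) by auto
  \<comment> \<open>Half of \<open>lam\<close> absorbs the stray factor \<open>x\<close>; division
    by \<open>CARD('i) + 1\<close> compensates for replacing \<open>x\<close> by \<open>l1 k\<close>
    inside \<open>\<omega>\<close>.\<close>
  define \<epsilon> where "\<epsilon> = lam / (2 * (real CARD('i) + 1))"
  have \<epsilon>: "\<epsilon> > 0" using assms by (simp add: \<epsilon>_def)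
  \<comment> \<open>The second entry covers \<open>k = 0\<close>, where derivatives give no
    information.\<close>
  define C where "C = max (B * K) (B * exp (lam * phi_star \<omega> 0) * exp (\<epsilon> * \<omega> 0))"
  have "decay C \<epsilon> (tcoef f)"
    unfolding decay_def
  proof
    fix k :: "'i \<Rightarrow> int"
    show "norm (tcoef f k) \<le> C * exp (- \<epsilon> * \<omega> (l1 k))"
    proof (cases "k = (\<lambda>i. 0)")
      case True
      then have l: "l1 k = 0" by (simp add: l1_def)
      have "norm (tcoef f k) \<le> B * exp (lam * phi_star \<omega> 0)" using bound [of k _ 0] by simp
      also have "\<dots> = (B * exp (lam * phi_star \<omega> 0) * exp (\<epsilon> * \<omega> 0)) * exp (- \<epsilon> * \<omega> (l1 k))"
        by (simp add: l exp_minus)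
      also have "\<dots> \<le> C * exp (- \<epsilon> * \<omega> (l1 k))" by (intro mult_right_mono) (auto simp: C_def)
      finally show ?thesis .
    next
      case False
      obtain i where i: "l1 k \<le> real CARD('i) * \<bar>real_of_int (k i)\<bar>" using l1_le_card_coord by blast
      define x where "x = \<bar>real_of_int (k i)\<bar>"
      have "x \<noteq> 0" using i l1_ge_1 [OF False] by (auto simp: x_def)
      then have x: "x \<ge> 1" unfolding x_def by (cases "k i = 0") auto
      have "norm (tcoef f k) \<le> B * x * exp (- lam * \<omega> x)"
        by (rule exp_w_decay_of_power_bounds) (use x B assms bound in \<open>auto simp: x_def\<close>)
      also have "\<dots> \<le> B * (K * exp (lam / 2 * \<omega> x)) * exp (- lam * \<omega> x)"
        using K(2) [of x] x B by (intro mult_right_mono mult_left_mono) auto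
      also have "\<dots> = B * K * exp (lam / 2 * \<omega> x + - lam * \<omega> x)" unfolding exp_add by simp
      also have "lam / 2 * \<omega> x + - lam * \<omega> x = - (lam / 2) * \<omega> x" by simp
      also have "B * K * exp (- (lam / 2) * \<omega> x) \<le> C * exp (- \<epsilon> * \<omega> (l1 k))"
      proof (rule mult_mono)
        have "\<omega> (l1 k) \<le> \<omega> (real CARD('i) * x)" using i by (intro w_mono) (auto simp: x_def)
        also have "\<dots> \<le> (real CARD('i) + 1) * \<omega> x" using x by (intro w_scale) auto
        finally have "\<epsilon> * \<omega> (l1 k) \<le> \<epsilon> * ((real CARD('i) + 1) * \<omega> x)" using \<epsilon> by simp
        also have "\<dots> = (lam / 2) * \<omega> x" by (simp add: \<epsilon>_def field_simps)
        finally show "exp (- (lam / 2) * \<omega> x) \<le> exp (- \<epsilon> * \<omega> (l1 k))" by simp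
        show "0 \<le> C" using B K by (auto simp: C_def le_max_iff_disj)
      qed (auto simp: C_def)
      finally show ?thesis .
    qed
  qed
  with \<epsilon> show ?thesis by blast
qed

lemma E_omega_iff: "E_omega \<omega> f \<longleftrightarrow> (\<exists>C \<epsilon> c. \<epsilon> > 0 \<and> decay C \<epsilon> c \<and> f = tser c)"
proof
  assume "E_omega \<omega> f"
  then obtain lam where lam: "lam > 0" "E_lam \<omega> lam f" by (auto simp: E_omega_def)
  then obtain C \<epsilon> where "\<epsilon> > 0" "decay C \<epsilon> (tcoef f)" using E_lam_tcoef_decay by blast
  moreover have "tser (tcoef f) = f"
  proof (rule tser_tcoef)
    show "continuous_on UNIV f" using lam unfolding E_lam_def smooth_fun_def by (metis pds.simps(1))
    show "torus_periodic f" using lam by (auto simp: E_lam_def)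
    show "(\<lambda>k. norm (tcoef f k)) summable_on UNIV"
      by (rule rapid_summable [OF decay_rapid]) fact+
  qed
  ultimately show "\<exists>C \<epsilon> c. \<epsilon> > 0 \<and> decay C \<epsilon> c \<and> f = tser c" by metis
qed (auto intro: tser_E_omega)

lemma E_omegaE:
  assumes "E_omega \<omega> f"
  obtains C \<epsilon> c where "\<epsilon> > 0" "decay C \<epsilon> c" "f = tser c" "rapid c"
  using assms decay_rapid unfolding E_omega_iff by blast

lemma E_omega_continuous: "E_omega \<omega> f \<Longrightarrow> continuous_on UNIV f"
  by (erule E_omegaE) (simp add: continuous_on_tser rapid_summable)

lemma decay_add: "decay C \<epsilon> c \<Longrightarrow> decay D \<epsilon> d \<Longrightarrow> decay (C + D) \<epsilon> (\<lambda>k. c k + d k)"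
  unfolding decay_def by (auto simp: distrib_right intro: order_trans [OF norm_triangle_ineq] add_mono)

lemma decay_cmult: "decay C \<epsilon> c \<Longrightarrow> decay (norm a * C) \<epsilon> (\<lambda>k. a * c k)"
  unfolding decay_def by (auto simp: norm_mult mult.assoc intro: mult_left_mono)

lemma E_omega_add:
  assumes "E_omega \<omega> f" "E_omega \<omega> g"
  shows "E_omega \<omega> (\<lambda>x. f x + g x)"
proof -
  obtain C \<epsilon> c where c: "\<epsilon> > 0" "decay C \<epsilon> c" "f = tser c" "rapid c" using assms(1) by (rule E_omegaE)
  obtain D \<delta> d where d: "\<delta> > 0" "decay D \<delta> d" "g = tser d" "rapid d" using assms(2) by (rule E_omegaE)
  have "decay (C + D) (min \<epsilon> \<delta>) (\<lambda>k. c k + d k)"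
    by (rule decay_add) (rule decay_mono [OF c(2)], simp_all, rule decay_mono [OF d(2)], simp_all)
  moreover have "(\<lambda>x. f x + g x) = tser (\<lambda>k. c k + d k)"
    by (auto simp: c d tser_add rapid_summable)
  ultimately show ?thesis using c d unfolding E_omega_iff by (metis min_less_iff_conj)
qed

lemma E_omega_cmult:
  assumes "E_omega \<omega> f"
  shows "E_omega \<omega> (\<lambda>x. a * f x)"
proof -
  obtain C \<epsilon> c where c: "\<epsilon> > 0" "decay C \<epsilon> c" "f = tser c" "rapid c" using assms(1) by (rule E_omegaE)
  have "(\<lambda>x. a * f x) = tser (\<lambda>k. a * c k)" by (rule ext) (simp add: c tser_cmult)
  then show ?thesis using decay_cmult [OF c(2)] c unfolding E_omega_iff by metis
qed

lemma E_omega_sum: "finite A \<Longrightarrow> (\<And>i. i \<in> A \<Longrightarrow> E_omega \<omega> (f i)) \<Longrightarrow> E_omega \<omega> (\<lambda>x. \<Sum>i\<in>A. f i x)"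
proof (induction rule: finite_induct)
  case empty
  have "decay 0 1 (\<lambda>k. 0)" by (simp add: decay_def)
  from tser_E_omega [OF this] show ?case by (simp add: tser_def [abs_def])
next
  case (insert i A)
  then show ?case by (simp add: E_omega_add)
qed

text \<open>By subadditivity, \<open>\<omega>\<close> at \<open>k\<close> is at most the sum of its
  values at \<open>l\<close> and \<open>k - l\<close>. Half of the combined exponent therefore gives
  decay in \<open>k\<close>, while a remainder in \<open>l\<close> keeps the sum finite.\<close>

lemma decay_conv:
  fixes c d :: "('i::finite \<Rightarrow> int) \<Rightarrow> complex"
  assumes c: "decay C \<epsilon> c" and d: "decay D \<epsilon> d" and \<epsilon>: "\<epsilon> > 0"
  shows "decay (C * D * wsum TYPE('i) (\<epsilon> / 2)) (\<epsilon> / 2) (conv c d)"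
  unfolding decay_def
proof
  fix k :: "'i \<Rightarrow> int"
  have "norm (c l * d (\<lambda>i. k i - l i)) \<le> (C * D * exp (- (\<epsilon> / 2) * \<omega> (l1 k))) * exp (- (\<epsilon> / 2) * \<omega> (l1 l))" for l
  proof -
    have "norm (c l * d (\<lambda>i. k i - l i)) \<le> (C * exp (- \<epsilon> * \<omega> (l1 l))) * (D * exp (- \<epsilon> * \<omega> (l1 (\<lambda>i. k i - l i))))"
      unfolding norm_mult using c d decay_nonneg [OF c] by (intro mult_mono) (auto simp: decay_def)
    also have "\<dots> = C * D * exp (- \<epsilon> * (\<omega> (l1 l) + \<omega> (l1 (\<lambda>i. k i - l i))))"
      by (simp add: exp_add [symmetric] algebra_simps)
    also have "\<dots> \<le> C * D * exp (- (\<epsilon> / 2) * (\<omega> (l1 k) + \<omega> (l1 l)))"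
    proof (rule mult_left_mono)
      have "\<omega> (l1 k) \<le> \<omega> (l1 l + l1 (\<lambda>i. k i - l i))"
        using l1_add_le [of l "\<lambda>i. k i - l i"] by (intro w_mono) auto
      also have "\<dots> \<le> \<omega> (l1 l) + \<omega> (l1 (\<lambda>i. k i - l i))" by (intro w_add) auto
      finally have "\<omega> (l1 k) + \<omega> (l1 l) \<le> 2 * (\<omega> (l1 l) + \<omega> (l1 (\<lambda>i. k i - l i)))"
        using w_nonneg [of "l1 (\<lambda>i. k i - l i)"] by simp
      from mult_left_mono [OF this, of "\<epsilon> / 2"] \<epsilon>
      show "exp (- \<epsilon> * (\<omega> (l1 l) + \<omega> (l1 (\<lambda>i. k i - l i)))) \<le> exp (- (\<epsilon> / 2) * (\<omega> (l1 k) + \<omega> (l1 l)))"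
        by simp
    qed (use decay_nonneg [OF c] decay_nonneg [OF d] in simp)
    also have "exp (- (\<epsilon> / 2) * (\<omega> (l1 k) + \<omega> (l1 l))) = exp (- (\<epsilon> / 2) * \<omega> (l1 k)) * exp (- (\<epsilon> / 2) * \<omega> (l1 l))"
      by (simp add: exp_add [symmetric] algebra_simps)
    finally show ?thesis by simp
  qed
  then have "norm (conv c d k) \<le> (\<Sum>\<^sub>\<infinity>l::'i \<Rightarrow> int. (C * D * exp (- (\<epsilon> / 2) * \<omega> (l1 k))) * exp (- (\<epsilon> / 2) * \<omega> (l1 l)))"
    unfolding conv_def using \<epsilon> by (intro norm_infsum_le_infsum(1) summable_on_cmult_right summable_exp_w) auto
  also have "\<dots> = C * D * wsum TYPE('i) (\<epsilon> / 2) * exp (- (\<epsilon> / 2) * \<omega> (l1 k))"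
    unfolding wsum_def by (subst infsum_cmult_right') simp
  finally show "norm (conv c d k) \<le> C * D * wsum TYPE('i) (\<epsilon> / 2) * exp (- (\<epsilon> / 2) * \<omega> (l1 k))" .
qed

lemma E_omega_mult:
  assumes "E_omega \<omega> f" "E_omega \<omega> g"
  shows "E_omega \<omega> (\<lambda>x. f x * g x)"
proof -
  obtain C \<epsilon> c where c: "\<epsilon> > 0" "decay C \<epsilon> c" "f = tser c" "rapid c" using assms(1) by (rule E_omegaE)
  obtain D \<delta> d where d: "\<delta> > 0" "decay D \<delta> d" "g = tser d" "rapid d" using assms(2) by (rule E_omegaE)
  have "decay C (min \<epsilon> \<delta>) c" "decay D (min \<epsilon> \<delta>) d" using decay_mono [OF c(2)] decay_mono [OF d(2)] by simp_all
  from tser_E_omega [OF decay_conv [OF this]] have "E_omega \<omega> (tser (conv c d))" using c d by simp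
  moreover have "(\<lambda>x. f x * g x) = tser (conv c d)"
    unfolding c d by (rule ext, rule tser_mult) (use c d rapid_summable in auto)
  ultimately show ?thesis by simp
qed

lemma E_omega_pd:
  assumes "E_omega \<omega> f"
  shows "E_omega \<omega> (pd j f)"
proof -
  obtain C \<epsilon> c where c: "\<epsilon> > 0" "decay C \<epsilon> c" "f = tser c" "rapid c" using assms(1) by (rule E_omegaE)
  obtain K where K: "K > 0" "\<And>t. t \<ge> 0 \<Longrightarrow> (1 + t) ^ 1 \<le> K * exp (\<epsilon> / 2 * \<omega> t)"
    using w_poly [of "\<epsilon> / 2" 1] c(1) by auto
  have "decay (K * C) (\<epsilon> / 2) (\<lambda>k. \<i> * of_int (k j) * c k)"
    unfolding decay_def
  proof
    fix k
    have "\<bar>real_of_int (k j)\<bar> \<le> K * exp (\<epsilon> / 2 * \<omega> (l1 k))" using K(2) [of "l1 k"] l1_ge_coord [of k j] by simp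
    then have "norm (\<i> * of_int (k j) * c k) \<le> (K * exp (\<epsilon> / 2 * \<omega> (l1 k))) * (C * exp (- \<epsilon> * \<omega> (l1 k)))"
      using c(2) K by (auto simp: norm_mult decay_def intro!: mult_mono)
    also have "\<dots> = K * C * exp (\<epsilon> / 2 * \<omega> (l1 k) + - \<epsilon> * \<omega> (l1 k))" unfolding exp_add by simp
    also have "\<epsilon> / 2 * \<omega> (l1 k) + - \<epsilon> * \<omega> (l1 k) = - (\<epsilon> / 2) * \<omega> (l1 k)" by simp
    finally show "norm (\<i> * of_int (k j) * c k) \<le> K * C * exp (- (\<epsilon> / 2) * \<omega> (l1 k))" .
  qed
  from tser_E_omega [OF this] c show ?thesis by (simp add: pd_tser)
qed

section \<open>One-variable coefficient sequences\<close>

definition decay_int :: "real \<Rightarrow> real \<Rightarrow> (int \<Rightarrow> complex) \<Rightarrow> bool" where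
  "decay_int C \<epsilon> h \<longleftrightarrow> (\<forall>n. norm (h n) \<le> C * exp (- \<epsilon> * \<omega> \<bar>real_of_int n\<bar>))"

lemma decay_int_nonneg: "decay_int C \<epsilon> h \<Longrightarrow> C \<ge> 0"
  unfolding decay_int_def by (meson exp_gt_zero norm_ge_zero order_trans zero_le_mult_iff not_le)

lemma decay_int_mono:
  assumes "decay_int C \<epsilon> c" "C \<le> C'" "\<epsilon>' \<le> \<epsilon>"
  shows "decay_int C' \<epsilon>' c"
  unfolding decay_int_def
proof
  fix k
  have "norm (c k) \<le> C * exp (- \<epsilon> * \<omega> \<bar>real_of_int k\<bar>)" using assms by (auto simp: decay_int_def)
  also have "\<dots> \<le> C' * exp (- \<epsilon>' * \<omega> \<bar>real_of_int k\<bar>)"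
    using assms decay_int_nonneg [OF assms(1)] w_nonneg [of "\<bar>real_of_int k\<bar>"] by (intro mult_mono) (auto intro: mult_right_mono)
  finally show "norm (c k) \<le> C' * exp (- \<epsilon>' * \<omega> \<bar>real_of_int k\<bar>)" .
qed

lemma decay_int_embed:
  assumes "decay_int C \<epsilon> h"
  shows "decay C \<epsilon> (\<lambda>k. if \<forall>j. j \<noteq> i \<longrightarrow> k j = 0 then h (k i) else 0)"
  unfolding decay_def
proof
  fix k :: "'a \<Rightarrow> int"
  show "norm (if \<forall>j. j \<noteq> i \<longrightarrow> k j = 0 then h (k i) else 0) \<le> C * exp (- \<epsilon> * \<omega> (l1 k))"
  proof (cases "\<forall>j. j \<noteq> i \<longrightarrow> k j = 0")
    case True
    then have "l1 k = (\<Sum>j\<in>UNIV. if j = i then \<bar>real_of_int (k i)\<bar> else 0)"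
      unfolding l1_def by (intro sum.cong) auto
    then show ?thesis using True assms by (simp add: decay_int_def)
  next
    case False
    show ?thesis unfolding if_not_P [OF False] using decay_int_nonneg [OF assms] by simp
  qed
qed

lemma decay_int_rapid:
  assumes "decay_int C \<epsilon> h" "\<epsilon> > 0"
  shows "(\<lambda>n. norm (h n) * (1 + (real_of_int n)\<^sup>2)) summable_on UNIV" "(\<lambda>n. norm (h n)) summable_on UNIV"
proof -
  have "rapid (\<lambda>k::1 \<Rightarrow> int. if \<forall>j. j \<noteq> 1 \<longrightarrow> k j = 0 then h (k 1) else 0)"
    by (rule decay_rapid [OF decay_int_embed]) fact+
  then have "(\<lambda>k::1 \<Rightarrow> int. norm (h (k 1)) * (1 + l1 k)\<^sup>2) summable_on UNIV"
    unfolding rapid_def by (drule_tac spec [of _ 2]) simp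
  moreover have "(\<lambda>k::1 \<Rightarrow> int. norm (h (k 1)) * (1 + l1 k)\<^sup>2) summable_on UNIV \<longleftrightarrow>
     (\<lambda>n::int. norm (h n) * (1 + \<bar>real_of_int n\<bar>)\<^sup>2) summable_on UNIV"
    by (rule summable_on_reindex_bij_witness [where i = "\<lambda>n _. n" and j = "\<lambda>k. k 1"])
       (auto simp: l1_def fun_eq_iff)
  ultimately have s: "(\<lambda>n::int. norm (h n) * (1 + \<bar>real_of_int n\<bar>)\<^sup>2) summable_on UNIV" by simp
  show "(\<lambda>n. norm (h n) * (1 + (real_of_int n)\<^sup>2)) summable_on UNIV"
    by (rule summable_on_comparison_test [OF s]) (auto simp: power2_sum intro!: mult_left_mono)
  then show "(\<lambda>n. norm (h n)) summable_on UNIV"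
    by (rule summable_on_comparison_test) (auto simp: distrib_left)
qed

lemma E_omega_fser_coord:
  assumes "decay_int C \<epsilon> h" "\<epsilon> > 0"
  shows "E_omega \<omega> (\<lambda>p::real^'i::finite. fser h (p $ i))"
  using tser_E_omega [OF decay_int_embed [OF assms(1), of i] assms(2)] by (simp add: tser_single_coord [abs_def])

lemma E_omega_1_fser:
  assumes "E_omega \<omega> (\<lambda>v::real^1. g (v $ 1))"
  obtains C \<epsilon> h where "\<epsilon> > 0" "decay_int C \<epsilon> h" "g = fser h"
proof -
  obtain C \<epsilon> c where c: "\<epsilon> > 0" "decay C \<epsilon> c" "(\<lambda>v::real^1. g (v $ 1)) = tser c" using assms(1) by (rule E_omegaE)
  define h where "h n = c (\<lambda>_. n)" for n
  have "c k = h (k 1)" for k unfolding h_def by (rule arg_cong [of _ _ c]) (simp add: fun_eq_iff)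
  then have "c = (\<lambda>k. if \<forall>j. j \<noteq> 1 \<longrightarrow> k j = 0 then h (k 1) else 0)" by (auto simp: fun_eq_iff)
  then have "tser c x = fser h (x $ 1)" for x using tser_single_coord [of 1 h x] by simp
  then have "g t = fser h t" for t using fun_cong [OF c(3), of "\<chi> i. t"] by simp
  moreover have "decay_int C \<epsilon> h"
    unfolding decay_int_def
  proof
    fix n
    show "norm (h n) \<le> C * exp (- \<epsilon> * \<omega> \<bar>real_of_int n\<bar>)"
      using c(2) [unfolded decay_def, rule_format, of "\<lambda>_. n"] by (simp add: h_def l1_def)
  qed
  ultimately show ?thesis using that c(1) by blast
qed

end

section \<open>Ordinary differential equations on the circle\<close>

text \<open>Only \<open>h\<close> is summable: \<open>u\<close> is merely continuous and bounded,
  which is all that is known of a solution before its regularity is established.\<close>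

lemma has_sum_fcoef_mult:
  assumes h: "(\<lambda>n. norm (h n)) summable_on UNIV" and u: "continuous_on UNIV u" and U: "\<And>t. norm (u t) \<le> U"
  shows "((\<lambda>n. h n * fcoef u (m - n)) has_sum fcoef (\<lambda>t. fser h t * u t) m) UNIV"
proof -
  let ?f = "\<lambda>n t. h n * (u t * cis (- (of_int (m - n) * t)))"
  have "((\<lambda>n. integral {0..2*pi} (?f n)) has_sum integral {0..2*pi} (\<lambda>t. \<Sum>\<^sub>\<infinity>n. ?f n t)) UNIV"
  proof (rule has_sum_integral_infsum)
    show "continuous_on {0..2*pi} (?f n)" for n
      by (intro continuous_intros continuous_on_subset [OF u]) simp
    show "norm (?f n t) \<le> norm (h n) * U" for n t
      using U by (simp add: norm_mult mult_left_mono)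
    show "(\<lambda>n. norm (h n) * U) summable_on UNIV" by (rule summable_on_cmult_left [OF h])
  qed
  moreover have "(\<Sum>\<^sub>\<infinity>n. ?f n t) = fser h t * u t * cis (- (of_int m * t))" for t
  proof -
    have "?f n t = h n * cis (of_int n * t) * (u t * cis (- (of_int m * t)))" for n
    proof -
      have "cis (- (of_int (m - n) * t)) = cis (of_int n * t) * cis (- (of_int m * t))"
        by (simp add: cis_mult algebra_simps)
      then show ?thesis by simp
    qed
    then have "(\<Sum>\<^sub>\<infinity>n. ?f n t) = (\<Sum>\<^sub>\<infinity>n. h n * cis (of_int n * t) * (u t * cis (- (of_int m * t))))"
      by (intro infsum_cong)
    also have "\<dots> = fser h t * (u t * cis (- (of_int m * t)))"
      unfolding fser_def by (rule infsum_cmult_left')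
    finally show ?thesis by (simp only: mult.assoc)
  qed
  ultimately have "((\<lambda>n. integral {0..2*pi} (?f n)) has_sum integral {0..2*pi} (\<lambda>t. fser h t * u t * cis (- (of_int m * t)))) UNIV"
    by simp
  from has_sum_divide_const [OF this, of "2 * pi"] show ?thesis
    unfolding fcoef_def by (simp add: integral_mult_right)
qed

context weight_subadd
begin

definition isum :: "real \<Rightarrow> real" where
  "isum \<epsilon> = (\<Sum>\<^sub>\<infinity>n::int. exp (- \<epsilon> * \<omega> \<bar>real_of_int n\<bar>))"

lemma w_abs_add: "\<omega> \<bar>real_of_int m\<bar> \<le> \<omega> \<bar>real_of_int n\<bar> + \<omega> \<bar>real_of_int (m - n)\<bar>"
proof -
  have "\<omega> \<bar>real_of_int m\<bar> \<le> \<omega> (\<bar>real_of_int n\<bar> + \<bar>real_of_int (m - n)\<bar>)" by (intro w_mono) auto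
  also have "\<dots> \<le> \<omega> \<bar>real_of_int n\<bar> + \<omega> \<bar>real_of_int (m - n)\<bar>" by (intro w_add) auto
  finally show ?thesis .
qed

text \<open>Outside the range \<open>\<bar>m\<bar> < M * Q\<close> the equation bounds the \<open>m\<close>-th coefficient by half of a weighted
  supremum of all coefficients, so that this supremum can be absorbed; truncating the weight keeps it finite.\<close>

lemma ode_coefficient_decay:
  assumes u: "\<And>t. (u has_vector_derivative fser fh t - \<i> * fser ch t * u t) (at t)"
    and per: "\<And>t. u (t + 2 * pi) = u t" and U: "\<And>t. norm (u t) \<le> U"
    and ch: "decay_int (Q * D) \<delta> ch" and fh: "decay_int G \<delta> fh"
    and \<delta>: "\<delta> > 0" and \<eta>: "0 < \<eta>" "\<eta> \<le> \<delta> / 2" and Q: "Q \<ge> 1" and M: "M \<ge> 1" "D * isum (\<delta> / 2) \<le> M / 2"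
  shows "decay_int (2 * (G + U * exp (\<eta> * \<omega> (M * Q)))) \<eta> (fcoef u)"
proof -
  define b where "b m = norm (fcoef u m)" for m
  define E where "E = U * exp (\<eta> * \<omega> (M * Q))"
  have QD: "Q * D \<ge> 0" and G: "G \<ge> 0" using decay_int_nonneg ch fh by blast+
  then have D: "D \<ge> 0" using Q by (simp add: zero_le_mult_iff)
  have U0: "U \<ge> 0" using U [of 0] norm_ge_zero order_trans by blast
  have E: "E \<ge> 0" using U0 by (simp add: E_def)
  have uc: "continuous_on UNIV u"
    using u by (metis continuous_at_imp_continuous_on has_vector_derivative_continuous)
  have sum_ch: "(\<lambda>n. norm (ch n)) summable_on UNIV" and sum_fh: "(\<lambda>n. norm (fh n)) summable_on UNIV"
    using decay_int_rapid ch fh \<delta> by blast+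
  have cont: "continuous_on UNIV (fser ch)" "continuous_on UNIV (fser fh)"
    using fser_continuous sum_ch sum_fh by blast+
  have b: "b m \<le> U" "b m \<ge> 0" for m unfolding b_def by (auto intro: norm_fcoef_le [OF uc U])
  have eq: "\<bar>real_of_int m\<bar> * b m \<le> norm (fh m) + norm (fcoef (\<lambda>t. fser ch t * u t) m)" for m
  proof -
    have "fcoef (\<lambda>t. fser fh t - \<i> * fser ch t * u t) m = \<i> * of_int m * fcoef u m"
      by (rule fcoef_deriv [OF u _ per]) (intro continuous_intros cont uc)
    moreover have "fcoef (\<lambda>t. fser fh t - \<i> * fser ch t * u t) m = fcoef (fser fh) m - fcoef (\<lambda>t. \<i> * fser ch t * u t) m"
      by (rule fcoef_diff) (intro continuous_intros cont uc)+
    moreover have "fcoef (\<lambda>t. \<i> * fser ch t * u t) m = \<i> * fcoef (\<lambda>t. fser ch t * u t) m"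
      by (simp add: fcoef_def mult.assoc)
    ultimately have "\<i> * of_int m * fcoef u m = fh m - \<i> * fcoef (\<lambda>t. fser ch t * u t) m"
      by (simp add: fcoef_fser sum_fh)
    then have "norm (\<i> * of_int m * fcoef u m) \<le> norm (fh m) + norm (\<i> * fcoef (\<lambda>t. fser ch t * u t) m)"
      by (metis norm_triangle_ineq4)
    then show ?thesis by (simp add: norm_mult b_def)
  qed
  have main: "min (exp (\<eta> * \<omega> \<bar>real_of_int m\<bar>)) R * b m \<le> 2 * (G + E)" if R: "R > 0" for R m
  proof -
    define W where "W m = min (exp (\<eta> * \<omega> \<bar>real_of_int m\<bar>)) R" for m
    define S where "S = (SUP m. W m * b m)"
    have W: "0 < W m" "W m \<le> R" "W m \<le> exp (\<eta> * \<omega> \<bar>real_of_int m\<bar>)" for m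
      using R by (auto simp: W_def)
    \<comment> \<open>Cutting the weight at \<open>R\<close> preserves this one-sided
      submultiplicativity because the other factor is at least 1; the uncut inequality is
      subadditivity of \<open>\<omega>\<close>.\<close>
    have Wsub: "W m \<le> exp (\<eta> * \<omega> \<bar>real_of_int n\<bar>) * W (m - n)" for m n
    proof -
      have e1: "1 \<le> exp (\<eta> * \<omega> \<bar>real_of_int n\<bar>)" using \<eta> w_nonneg [of "\<bar>real_of_int n\<bar>"] by simp
      have "exp (\<eta> * \<omega> \<bar>real_of_int m\<bar>) \<le> exp (\<eta> * \<omega> \<bar>real_of_int n\<bar>) * exp (\<eta> * \<omega> \<bar>real_of_int (m - n)\<bar>)"
        unfolding exp_add [symmetric] distrib_left [symmetric] using w_abs_add \<eta> by simp
      moreover have "R \<le> exp (\<eta> * \<omega> \<bar>real_of_int n\<bar>) * R" using mult_right_mono [OF e1, of R] R by simp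
      ultimately show ?thesis unfolding W_def by (auto simp: min_def)
    qed
    have bdd: "bdd_above (range (\<lambda>m. W m * b m))"
      using W b R by (intro bdd_aboveI2 [of _ _ "R * U"] mult_mono) (auto intro: less_imp_le)
    have S: "W m * b m \<le> S" for m unfolding S_def by (rule cSUP_upper [OF _ bdd]) simp
    have S0: "S \<ge> 0" using S [of 0] W(1) [of 0] b(2) [of 0] by (meson less_imp_le mult_nonneg_nonneg order_trans)
    have step: "W m * b m \<le> G + E + S / 2" for m
    proof (cases "\<bar>real_of_int m\<bar> < M * Q")
      case True
      have "W m \<le> exp (\<eta> * \<omega> (M * Q))"
        using True \<eta> by (intro order_trans [OF W(3)]) (auto intro!: mult_left_mono w_mono)
      then have "W m * b m \<le> exp (\<eta> * \<omega> (M * Q)) * U" using b by (intro mult_mono) auto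
      then show ?thesis using G S0 by (simp add: E_def mult.commute)
    next
      case False
      have m1: "1 \<le> \<bar>real_of_int m\<bar>" using False M Q mult_mono [of 1 M 1 Q] by simp
      have hs: "((\<lambda>n. ch n * fcoef u (m - n)) has_sum fcoef (\<lambda>t. fser ch t * u t) m) UNIV"
        by (rule has_sum_fcoef_mult [OF sum_ch uc U])
      have trm: "norm (of_real (W m) * (ch n * fcoef u (m - n))) \<le> Q * D * S * exp (- (\<delta> / 2) * \<omega> \<bar>real_of_int n\<bar>)" for n
      proof -
        have "norm (of_real (W m) * (ch n * fcoef u (m - n))) = norm (ch n) * (W m * b (m - n))"
          using W(1) [of m] by (simp add: norm_mult b_def)
        also have "\<dots> \<le> (Q * D * exp (- \<delta> * \<omega> \<bar>real_of_int n\<bar>)) * (exp (\<eta> * \<omega> \<bar>real_of_int n\<bar>) * S)"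
        proof (rule mult_mono)
          show "norm (ch n) \<le> Q * D * exp (- \<delta> * \<omega> \<bar>real_of_int n\<bar>)" using ch by (simp add: decay_int_def)
          have "W m * b (m - n) \<le> exp (\<eta> * \<omega> \<bar>real_of_int n\<bar>) * W (m - n) * b (m - n)"
            by (rule mult_right_mono [OF Wsub b(2)])
          also have "\<dots> \<le> exp (\<eta> * \<omega> \<bar>real_of_int n\<bar>) * S" using S by (simp add: mult.assoc)
          finally show "W m * b (m - n) \<le> exp (\<eta> * \<omega> \<bar>real_of_int n\<bar>) * S" .
        qed (use QD b in \<open>auto intro!: mult_nonneg_nonneg less_imp_le [OF W(1)]\<close>)
        also have "\<dots> = Q * D * S * exp (- \<delta> * \<omega> \<bar>real_of_int n\<bar> + \<eta> * \<omega> \<bar>real_of_int n\<bar>)"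
          unfolding exp_add by simp
        also have "\<dots> \<le> Q * D * S * exp (- (\<delta> / 2) * \<omega> \<bar>real_of_int n\<bar>)"
        proof -
          have "\<eta> * \<omega> \<bar>real_of_int n\<bar> \<le> \<delta> / 2 * \<omega> \<bar>real_of_int n\<bar>"
            using \<eta> w_nonneg by (intro mult_right_mono) auto
          then show ?thesis using QD S0 by (intro mult_left_mono) auto
        qed
        finally show ?thesis .
      qed
      \<comment> \<open>\<open>\<eta> \<le> \<delta> / 2\<close> leaves half of the decay of
        \<open>ch\<close>, so the weighted convolution costs the constant
        \<open>isum (\<delta> / 2)\<close>, whatever \<open>R\<close> is.\<close>
      have "norm (of_real (W m) * fcoef (\<lambda>t. fser ch t * u t) m) \<le> Q * D * S * isum (\<delta> / 2)"
        unfolding isum_def using \<delta>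
        by (intro norm_infsum_le [OF has_sum_cmult_right [OF hs] has_sum_cmult_right [OF has_sum_infsum] trm] summable_exp_w_int) auto
      then have 1: "W m * norm (fcoef (\<lambda>t. fser ch t * u t) m) \<le> Q * S * (D * isum (\<delta> / 2))"
        using W(1) [of m] by (simp add: norm_mult mult_ac)
      also have "\<dots> \<le> Q * S * (M / 2)" using M Q S0 by (intro mult_left_mono) auto
      finally have 1: "W m * norm (fcoef (\<lambda>t. fser ch t * u t) m) \<le> M * Q * (S / 2)" by (simp add: mult_ac)
      have "W m * norm (fh m) \<le> exp (\<eta> * \<omega> \<bar>real_of_int m\<bar>) * (G * exp (- \<delta> * \<omega> \<bar>real_of_int m\<bar>))"
        using fh W by (intro mult_mono) (auto simp: decay_int_def)
      also have "\<dots> = G * exp (\<eta> * \<omega> \<bar>real_of_int m\<bar> + - \<delta> * \<omega> \<bar>real_of_int m\<bar>)" unfolding exp_add by simp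
      also have "\<dots> \<le> G * exp 0"
      proof -
        have "\<eta> * \<omega> \<bar>real_of_int m\<bar> \<le> \<delta> * \<omega> \<bar>real_of_int m\<bar>"
          using \<eta> \<delta> w_nonneg by (intro mult_right_mono) auto
        then show ?thesis using G by (intro mult_left_mono) auto
      qed
      finally have 2: "W m * norm (fh m) \<le> G" by simp
      have "\<bar>real_of_int m\<bar> * (W m * b m) \<le> W m * (norm (fh m) + norm (fcoef (\<lambda>t. fser ch t * u t) m))"
        using mult_left_mono [OF eq [of m], of "W m"] W(1) [of m] by (simp add: mult_ac)
      also have "\<dots> \<le> G + M * Q * (S / 2)" using 1 2 by (simp add: distrib_left)
      \<comment> \<open>Here \<open>\<bar>m\<bar> \<ge> M * Q\<close> enters: division by
        \<open>\<bar>m\<bar>\<close> cancels the size of the symbol and leaves the factor one half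
        at \<open>S\<close>.\<close>
      also have "\<dots> \<le> \<bar>real_of_int m\<bar> * G + \<bar>real_of_int m\<bar> * (S / 2)"
        using False S0 m1 G mult_right_mono [OF m1 G] by (intro add_mono mult_right_mono) auto
      finally have "\<bar>real_of_int m\<bar> * (W m * b m) \<le> \<bar>real_of_int m\<bar> * (G + S / 2)" by (simp add: distrib_left)
      then have "W m * b m \<le> G + S / 2" using m1 by (simp add: mult_le_cancel_left)
      then show ?thesis using E by simp
    qed
    have "S \<le> G + E + S / 2" unfolding S_def by (rule cSUP_least) (use step in \<open>auto simp: S_def\<close>)
    then show ?thesis using S [of m] unfolding W_def by simp
  qed
  show ?thesis
    unfolding decay_int_def
  proof
    fix m
    \<comment> \<open>With \<open>R\<close> equal to the weight at \<open>m\<close> itself the cut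
      is inactive, and the bound does not depend on \<open>R\<close>.\<close>
    have "exp (\<eta> * \<omega> \<bar>real_of_int m\<bar>) * b m \<le> 2 * (G + E)"
      using main [of "exp (\<eta> * \<omega> \<bar>real_of_int m\<bar>)" m] by simp
    then show "norm (fcoef u m) \<le> 2 * (G + U * exp (\<eta> * \<omega> (M * Q))) * exp (- \<eta> * \<omega> \<bar>real_of_int m\<bar>)"
      by (simp add: b_def E_def exp_minus field_simps)
  qed
qed

end

section \<open>Partial Fourier transform in x and the fibre equations\<close>

definition mk :: "int \<Rightarrow> ('n \<Rightarrow> int) \<Rightarrow> 'n option \<Rightarrow> int" where
  "mk \<tau> \<xi> = case_option \<tau> \<xi>"

lemma mk_simps [simp]: "mk \<tau> \<xi> None = \<tau>" "mk \<tau> \<xi> (Some j) = \<xi> j"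
  by (auto simp: mk_def)

lemma mk_collapse: "mk (k None) (\<lambda>j. k (Some j)) = k"
  by (auto simp: mk_def split: option.split)

lemma UNIV_option: "(UNIV :: 'n::finite option set) = insert None (range Some)"
  by (auto simp: notin_range_Some)

lemma sum_option: "(\<Sum>p\<in>UNIV. f p) = f None + (\<Sum>j\<in>UNIV. f (Some j))" for f :: "'n::finite option \<Rightarrow> 'a::comm_monoid_add"
  unfolding UNIV_option by (subst sum.insert) (auto simp: sum.reindex)

text \<open>This exact splitting of the frequency norm into its \<open>t\<close> and
  \<open>x\<close> parts is the reason for working with the l1 norm.\<close>

lemma l1_mk: "l1 (mk \<tau> \<xi>) = \<bar>real_of_int \<tau>\<bar> + l1 \<xi>"
  by (simp add: l1_def sum_option)

text \<open>The partial Fourier coefficient at \<xi>. It stays a function on the whole torus,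
  although for continuous periodic arguments it varies with \<open>t\<close> only, so that the
  averaging lemmas apply unchanged.\<close>

definition slice :: "('n::finite \<Rightarrow> int) \<Rightarrow> (real^('n option) \<Rightarrow> complex) \<Rightarrow> real^('n option) \<Rightarrow> complex" where
  "slice \<xi> g = avgs (map Some coords) (\<lambda>y. g y * chr (\<lambda>p. - mk 0 \<xi> p) y)"

lemma slice_tser:
  assumes "(\<lambda>k. norm (c k)) summable_on UNIV"
  shows "slice \<xi> (tser c) x = fser (\<lambda>\<tau>. c (mk \<tau> \<xi>)) (x $ None)"
proof -
  have "slice \<xi> (tser c) x = tser (\<lambda>k. if \<forall>j\<in>set (map Some coords). k j = 0 then c (\<lambda>p. k p + mk 0 \<xi> p) else 0) x"
    unfolding slice_def tser_mult_chr
    using summable_shift [of "\<lambda>k. norm (c k)" "mk 0 \<xi>"] assms by (simp add: avgs_tser)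
  also have "(\<lambda>k. if \<forall>j\<in>set (map Some coords). k j = 0 then c (\<lambda>p. k p + mk 0 \<xi> p) else 0)
     = (\<lambda>k. if \<forall>j. j \<noteq> None \<longrightarrow> k j = 0 then c (mk (k None) \<xi>) else 0)"
  proof
    fix k :: "'a option \<Rightarrow> int"
    have "(\<forall>j\<in>set (map Some coords). k j = 0) \<longleftrightarrow> (\<forall>j. j \<noteq> None \<longrightarrow> k j = 0)" by auto
    moreover have "(\<lambda>p. k p + mk 0 \<xi> p) = mk (k None) \<xi>" if "\<forall>j. j \<noteq> None \<longrightarrow> k j = 0"
      using that by (auto simp: mk_def split: option.split)
    ultimately show "(if \<forall>j\<in>set (map Some coords). k j = 0 then c (\<lambda>p. k p + mk 0 \<xi> p) else 0)
      = (if \<forall>j. j \<noteq> None \<longrightarrow> k j = 0 then c (mk (k None) \<xi>) else 0)" by auto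
  qed
  finally show ?thesis using tser_single_coord [of None "\<lambda>\<tau>. c (mk \<tau> \<xi>)" x] by (rule trans)
qed

lemma slice_unique:
  assumes "continuous_on UNIV g" "torus_periodic g" "\<And>\<xi>. slice \<xi> g x = 0"
  shows "g x = 0"
proof (rule avgs_unique [OF assms(1,2)])
  show "distinct (map Some coords)" by (simp add: distinct_map)
  fix k :: "'a option \<Rightarrow> int" assume "\<And>i. i \<notin> set (map Some coords) \<Longrightarrow> k i = 0"
  then have "k None = 0" by auto
  then have "mk 0 (\<lambda>j. k (Some j)) = k" using mk_collapse [of k] by simp
  then show "avgs (map Some coords) (\<lambda>y. g y * chr (\<lambda>i. - k i) y) x = 0"
    using assms(3) [of "\<lambda>j. k (Some j)"] by (simp add: slice_def)
qed

lemma slice_add: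
  assumes "continuous_on UNIV f" "continuous_on UNIV g"
  shows "slice \<xi> (\<lambda>x. f x + g x) x = slice \<xi> f x + slice \<xi> g x"
  unfolding slice_def distrib_right by (subst avgs_add) (auto intro!: continuous_intros assms)

text \<open>Multipliers depending on \<open>t\<close> alone are invariant under the \<open>x\<close>
  averages. This is why the vector field does not couple different \<xi>.\<close>

lemma slice_mult_coord: "slice \<xi> (\<lambda>x. \<phi> (x $ None) * g x) x = \<phi> (x $ None) * slice \<xi> g x"
proof -
  have "avgs (map Some coords) (\<lambda>y. (g y * chr (\<lambda>p. - mk 0 \<xi> p) y) * \<phi> (y $ None))
    = (\<lambda>y. avgs (map Some coords) (\<lambda>y. g y * chr (\<lambda>p. - mk 0 \<xi> p) y) y * \<phi> (y $ None))"
    by (rule avgs_mult_invariant) (auto simp: axis_def)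
  moreover have "(\<lambda>y. \<phi> (y $ None) * g y * chr (\<lambda>p. - mk 0 \<xi> p) y) = (\<lambda>y. (g y * chr (\<lambda>p. - mk 0 \<xi> p) y) * \<phi> (y $ None))"
    by (auto simp: mult_ac)
  ultimately show ?thesis by (simp add: slice_def mult.commute [of "\<phi> _"])
qed

lemma slice_cmult: "slice \<xi> (\<lambda>x. c * g x) x = c * slice \<xi> g x"
  by (rule slice_mult_coord)

lemma slice_sum:
  assumes "finite A" "\<And>i. i \<in> A \<Longrightarrow> continuous_on UNIV (f i)"
  shows "slice \<xi> (\<lambda>x. \<Sum>i\<in>A. f i x) x = (\<Sum>i\<in>A. slice \<xi> (f i) x)"
  using assms
proof (induction rule: finite_induct)
  case empty
  then show ?case using slice_cmult [of \<xi> 0 "\<lambda>_. 0" x] by simp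
next
  case (insert i A)
  then show ?case by (subst sum.insert) (auto simp: slice_add continuous_on_sum)
qed

lemma norm_slice_le:
  assumes "continuous_on UNIV g" "\<And>x. norm (g x) \<le> U"
  shows "norm (slice \<xi> g x) \<le> U"
  unfolding slice_def using assms by (intro norm_avgs_le continuous_intros) (auto simp: norm_mult)

lemma continuous_on_slice:
  "continuous_on UNIV g \<Longrightarrow> continuous_on UNIV (slice \<xi> g)"
  unfolding slice_def by (intro continuous_on_avgs continuous_intros)

lemma rapid_mk:
  assumes "rapid c"
  shows "(\<lambda>\<tau>. norm (c (mk \<tau> \<xi>)) * (1 + (real_of_int \<tau>)\<^sup>2)) summable_on UNIV"
    and "(\<lambda>\<tau>. norm (c (mk \<tau> \<xi>))) summable_on UNIV"
proof -
  have "(\<lambda>k. norm (c k) * (1 + l1 k)\<^sup>2) summable_on range (\<lambda>\<tau>. mk \<tau> \<xi>)"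
    by (rule summable_on_subset_banach [of _ UNIV]) (use assms in \<open>auto simp: rapid_def\<close>)
  moreover have "inj (\<lambda>\<tau>. mk \<tau> \<xi>)" by (rule injI) (metis mk_simps(1))
  ultimately have s: "(\<lambda>\<tau>. norm (c (mk \<tau> \<xi>)) * (1 + l1 (mk \<tau> \<xi>))\<^sup>2) summable_on UNIV"
    by (simp add: summable_on_reindex o_def)
  show *: "(\<lambda>\<tau>. norm (c (mk \<tau> \<xi>)) * (1 + (real_of_int \<tau>)\<^sup>2)) summable_on UNIV"
  proof (rule summable_on_comparison_test [OF s])
    fix \<tau>
    have "1 + (real_of_int \<tau>)\<^sup>2 \<le> (1 + \<bar>real_of_int \<tau>\<bar>)\<^sup>2" by (simp add: power2_sum)
    also have "\<dots> \<le> (1 + l1 (mk \<tau> \<xi>))\<^sup>2" by (intro power_mono) (auto simp: l1_mk)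
    finally show "norm (c (mk \<tau> \<xi>)) * (1 + (real_of_int \<tau>)\<^sup>2) \<le> norm (c (mk \<tau> \<xi>)) * (1 + l1 (mk \<tau> \<xi>))\<^sup>2"
      by (rule mult_left_mono) simp
  qed simp
  then show "(\<lambda>\<tau>. norm (c (mk \<tau> \<xi>))) summable_on UNIV"
    by (rule summable_on_comparison_test) (auto simp: distrib_left)
qed

definition symb :: "('n::finite \<Rightarrow> real \<Rightarrow> real) \<Rightarrow> ('n \<Rightarrow> real \<Rightarrow> real) \<Rightarrow> ('n \<Rightarrow> int) \<Rightarrow> real \<Rightarrow> complex" where
  "symb a b \<xi> t = (\<Sum>j\<in>UNIV. of_int (\<xi> j) * (of_real (a j t) + \<i> * of_real (b j t)))"

text \<open>Periodicity is part of the notion: without it every initial value would give a solution,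
  and neither resonance nor small divisors would appear.\<close>

definition ode :: "(real \<Rightarrow> complex) \<Rightarrow> (real \<Rightarrow> complex) \<Rightarrow> (real \<Rightarrow> complex) \<Rightarrow> bool" where
  "ode c f u \<longleftrightarrow> (\<forall>t. u (t + 2 * pi) = u t) \<and> (\<forall>t. (u has_vector_derivative f t - \<i> * c t * u t) (at t))"

lemma slice_L_op:
  assumes c: "rapid c" and ab: "\<And>j. continuous_on UNIV (a j)" "\<And>j. continuous_on UNIV (b j)"
  shows "slice \<xi> (L_op a b (tser c)) x = fser (\<lambda>\<tau>. \<i> * of_int \<tau> * c (mk \<tau> \<xi>)) (x $ None)
     + \<i> * symb a b \<xi> (x $ None) * fser (\<lambda>\<tau>. c (mk \<tau> \<xi>)) (x $ None)"
proof -
  let ?\<phi> = "\<lambda>j t. complex_of_real (a j t) + \<i> * complex_of_real (b j t)"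
  have pc: "continuous_on UNIV (tser (\<lambda>k. \<i> * of_int (k j) * c k))" for j
    by (intro continuous_on_tser rapid_summable rapid_mult_coord c)
  have \<phi>c: "continuous_on UNIV (\<lambda>x::real^'a option. ?\<phi> j (x $ None))" for j
    by (intro continuous_intros continuous_on_compose2 [OF ab(1)] continuous_on_compose2 [OF ab(2)]) auto
  have "L_op a b (tser c) = (\<lambda>p. tser (\<lambda>k. \<i> * of_int (k None) * c k) p
     + (\<Sum>j\<in>UNIV. ?\<phi> j (p $ None) * tser (\<lambda>k. \<i> * of_int (k (Some j)) * c k) p))"
    by (simp add: L_op_def [abs_def] pd_tser c)
  then have "slice \<xi> (L_op a b (tser c)) x = slice \<xi> (tser (\<lambda>k. \<i> * of_int (k None) * c k)) x
    + (\<Sum>j\<in>UNIV. slice \<xi> (\<lambda>p. ?\<phi> j (p $ None) * tser (\<lambda>k. \<i> * of_int (k (Some j)) * c k) p) x)"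
    by (simp add: slice_add slice_sum pc \<phi>c continuous_on_sum continuous_on_mult)
  also have "\<dots> = slice \<xi> (tser (\<lambda>k. \<i> * of_int (k None) * c k)) x
    + (\<Sum>j\<in>UNIV. ?\<phi> j (x $ None) * slice \<xi> (tser (\<lambda>k. \<i> * of_int (k (Some j)) * c k)) x)"
    by (simp only: slice_mult_coord [of _ "?\<phi> _"])
  also have "\<dots> = fser (\<lambda>\<tau>. \<i> * of_int \<tau> * c (mk \<tau> \<xi>)) (x $ None)
    + (\<Sum>j\<in>UNIV. ?\<phi> j (x $ None) * fser (\<lambda>\<tau>. \<i> * of_int (\<xi> j) * c (mk \<tau> \<xi>)) (x $ None))"
    by (subst slice_tser, intro rapid_summable rapid_mult_coord c)+ simp
  also have "(\<lambda>j. fser (\<lambda>\<tau>. \<i> * of_int (\<xi> j) * c (mk \<tau> \<xi>)) (x $ None))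
      = (\<lambda>j. \<i> * of_int (\<xi> j) * fser (\<lambda>\<tau>. c (mk \<tau> \<xi>)) (x $ None))"
    unfolding fser_def mult.assoc by (auto simp: infsum_cmult_right')
  finally show ?thesis
    by (simp add: symb_def sum_distrib_left sum_distrib_right mult_ac)
qed

lemma ode_of_L_op:
  fixes \<xi> :: "'n::finite \<Rightarrow> int"
  assumes c: "rapid c" and d: "(\<lambda>k. norm (d k)) summable_on UNIV"
    and ab: "\<And>j. continuous_on UNIV (a j)" "\<And>j. continuous_on UNIV (b j)" and L: "L_op a b (tser c) = tser d"
  shows "ode (symb a b \<xi>) (fser (\<lambda>\<tau>. d (mk \<tau> \<xi>))) (fser (\<lambda>\<tau>. c (mk \<tau> \<xi>)))"
  unfolding ode_def
proof (intro conjI allI)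
  fix t
  have "slice \<xi> (L_op a b (tser c)) (\<chi> i. t) = fser (\<lambda>\<tau>. d (mk \<tau> \<xi>)) t"
    unfolding L by (simp add: slice_tser d)
  then have *: "fser (\<lambda>\<tau>. d (mk \<tau> \<xi>)) t - \<i> * symb a b \<xi> t * fser (\<lambda>\<tau>. c (mk \<tau> \<xi>)) t = fser (\<lambda>\<tau>. \<i> * of_int \<tau> * c (mk \<tau> \<xi>)) t"
    using slice_L_op [where a = a and b = b and \<xi> = \<xi> and x = "\<chi> i. t", OF c ab] by (simp add: diff_eq_eq)
  show "(fser (\<lambda>\<tau>. c (mk \<tau> \<xi>)) has_vector_derivative
      fser (\<lambda>\<tau>. d (mk \<tau> \<xi>)) t - \<i> * symb a b \<xi> t * fser (\<lambda>\<tau>. c (mk \<tau> \<xi>)) t) (at t)"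
    unfolding * by (rule fser_has_vector_derivative [OF rapid_mk(1) [OF c]])
qed (rule fser_periodic)

text \<open>Equality on the torus is checked slice by slice; uniqueness of derivatives identifies
  the differentiated series in \<open>t\<close> with the right-hand side of the fibre
  equation.\<close>

lemma L_op_of_ode:
  fixes a b :: "'n::finite \<Rightarrow> real \<Rightarrow> real"
  assumes c: "rapid c" and d: "(\<lambda>k. norm (d k)) summable_on UNIV"
    and ab: "\<And>j. continuous_on UNIV (a j)" "\<And>j. continuous_on UNIV (b j)"
    and per: "\<And>j t. a j (t + 2 * pi) = a j t" "\<And>j t. b j (t + 2 * pi) = b j t"
    and ode: "\<And>\<xi>. ode (symb a b \<xi>) (fser (\<lambda>\<tau>. d (mk \<tau> \<xi>))) (fser (\<lambda>\<tau>. c (mk \<tau> \<xi>)))"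
  shows "L_op a b (tser c) = tser d"
proof
  fix x
  let ?\<phi> = "\<lambda>j t. complex_of_real (a j t) + \<i> * complex_of_real (b j t)"
  have L: "L_op a b (tser c) = (\<lambda>p. tser (\<lambda>k. \<i> * of_int (k None) * c k) p
     + (\<Sum>j\<in>UNIV. ?\<phi> j (p $ None) * tser (\<lambda>k. \<i> * of_int (k (Some j)) * c k) p))"
    by (simp add: L_op_def [abs_def] pd_tser c)
  have pc: "continuous_on UNIV (tser (\<lambda>k. \<i> * of_int (k j) * c k))" for j
    by (intro continuous_on_tser rapid_summable rapid_mult_coord c)
  have \<phi>c: "continuous_on UNIV (\<lambda>x::real^'n option. ?\<phi> j (x $ None))" for j
    by (intro continuous_intros continuous_on_compose2 [OF ab(1)] continuous_on_compose2 [OF ab(2)]) auto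
  have Lc: "continuous_on UNIV (L_op a b (tser c))"
    unfolding L by (intro continuous_intros pc \<phi>c)
  have \<phi>p: "?\<phi> j ((p + (2*pi) *\<^sub>R axis i 1) $ None) = ?\<phi> j (p $ None)" for j i and p :: "real^'n option"
    by (cases "i = None") (auto simp: axis_def per)
  have Lp: "torus_periodic (L_op a b (tser c))"
  proof -
    have "tser e (p + (2*pi) *\<^sub>R axis i 1) = tser e p" for e :: "('n option \<Rightarrow> int) \<Rightarrow> complex" and p i
      using torus_periodic_tser [of e] unfolding torus_periodic_def by blast
    then show ?thesis unfolding L torus_periodic_def \<phi>p by simp
  qed
  have "L_op a b (tser c) x + (-1) * tser d x = 0"
  proof (rule slice_unique)
    show "continuous_on UNIV (\<lambda>x. L_op a b (tser c) x + (-1) * tser d x)"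
      by (intro continuous_intros Lc continuous_on_tser d)
    show "torus_periodic (\<lambda>x. L_op a b (tser c) x + (-1) * tser d x)"
      using Lp torus_periodic_tser [of d] by (simp add: torus_periodic_def)
    fix \<xi>
    have der: "(fser (\<lambda>\<tau>. c (mk \<tau> \<xi>)) has_vector_derivative fser (\<lambda>\<tau>. \<i> * of_int \<tau> * c (mk \<tau> \<xi>)) t) (at t)" for t
      by (rule fser_has_vector_derivative [OF rapid_mk(1) [OF c]])
    have "fser (\<lambda>\<tau>. \<i> * of_int \<tau> * c (mk \<tau> \<xi>)) t = fser (\<lambda>\<tau>. d (mk \<tau> \<xi>)) t - \<i> * symb a b \<xi> t * fser (\<lambda>\<tau>. c (mk \<tau> \<xi>)) t" for t
      by (rule vector_derivative_unique_at [OF der]) (use ode [of \<xi>] in \<open>simp add: ode_def\<close>)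
    then have "slice \<xi> (L_op a b (tser c)) x = slice \<xi> (tser d) x"
      using slice_L_op [where a = a and b = b and \<xi> = \<xi> and x = x, OF c ab] by (simp add: slice_tser d)
    moreover have "slice \<xi> (\<lambda>x. L_op a b (tser c) x + (-1) * tser d x) x = slice \<xi> (L_op a b (tser c)) x + (-1) * slice \<xi> (tser d) x"
      by (subst slice_add, rule Lc, intro continuous_intros continuous_on_tser d, subst slice_cmult) simp
    ultimately show "slice \<xi> (\<lambda>x. L_op a b (tser c) x + (-1) * tser d x) x = 0" by simp
  qed
  then show "L_op a b (tser c) x = tser d x" by simp
qed

text \<open>\<open>\<tau>\<close> is minus the integer nearest to \<open>Re w\<close>. The modulus
  of the exponential controls \<open>Im w\<close>, its argument the distance of \<open>Re w\<close>
  to the integers; \<open>Im w \<ge> 0\<close> keeps the modulus at most 1. For small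
  \<open>Im w\<close> the constant 3 adds the bounds \<open>\<bar>x\<bar> \<le> \<rho>\<close> and
  \<open>y \<le> 2 * \<rho>\<close>.\<close>

lemma exp_minus_one_lower_bound:
  assumes "Im w \<ge> 0"
  shows "\<exists>\<tau>::int. \<bar>real_of_int \<tau>\<bar> \<le> \<bar>Re w\<bar> + 1 \<and> min 1 (norm (w + of_int \<tau>)) / 3 \<le> norm (exp (2 * pi * \<i> * w) - 1)"
proof -
  define \<tau> where "\<tau> = - round (Re w)"
  define x where "x = Re w + \<tau>"
  define y where "y = Im w"
  define r where "r = exp (- (2 * pi * y))"
  define \<rho> where "\<rho> = norm (exp (2 * pi * \<i> * w) - 1)"
  have y: "y \<ge> 0" using assms by (simp add: y_def)
  have x: "\<bar>x\<bar> \<le> 1 / 2" unfolding x_def \<tau>_def using of_int_round_abs_le [of "Re w"] by (simp add: abs_minus_commute)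
  have tau: "\<bar>real_of_int \<tau>\<bar> \<le> \<bar>Re w\<bar> + 1" using x unfolding x_def by linarith
  have e: "exp (2 * pi * \<i> * w) = r * cis (2 * pi * x)"
  proof -
    have "cis (2 * pi * x) = cis (2 * pi * Re w)"
      using cis_multiple_2pi [of "of_int \<tau>"] by (simp add: x_def distrib_left cis_mult [symmetric])
    then show ?thesis by (simp add: exp_eq_polar r_def y_def)
  qed
  have r: "r \<le> 1" "r > 0" using y by (auto simp: r_def)
  have rho1: "1 - r \<le> \<rho>"
    using norm_triangle_ineq2 [of 1 "r * cis (2 * pi * x)"] r unfolding \<rho>_def e by (simp add: norm_mult norm_minus_commute)
  \<comment> \<open>Projection to the unit circle isolates the argument; the detour costs
    \<open>1 - r\<close>, itself at most \<open>\<rho>\<close>.\<close>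
  have "norm (1 - cis (2 * pi * x)) \<le> norm (1 - r * cis (2 * pi * x)) + norm (r * cis (2 * pi * x) - cis (2 * pi * x))"
    using norm_triangle_ineq [of "1 - r * cis (2 * pi * x)" "r * cis (2 * pi * x) - cis (2 * pi * x)"] by simp
  also have "norm (r * cis (2 * pi * x) - cis (2 * pi * x)) = 1 - r"
  proof -
    have "r * cis (2 * pi * x) - cis (2 * pi * x) = of_real (r - 1) * cis (2 * pi * x)" by (simp add: algebra_simps)
    then show ?thesis using r by (simp add: norm_mult del: of_real_diff)
  qed
  finally have rho2: "norm (1 - cis (2 * pi * x)) \<le> 2 * \<rho>"
    using rho1 unfolding \<rho>_def e by (simp add: norm_minus_commute)
  \<comment> \<open>Reduction to \<open>sin v \<ge> v / 2\<close> for \<open>v \<le> pi / 2\<close>,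
    from the cubic Taylor remainder and \<open>v\<^sup>2 \<le> 3\<close>.\<close>
  have "\<bar>x\<bar> \<le> norm (1 - cis (2 * pi * x)) / 2"
  proof -
    define v where "v = pi * \<bar>x\<bar>"
    have v: "0 \<le> v" "v \<le> pi / 2" using x by (auto simp: v_def)
    have "\<bar>sin v - v\<bar> \<le> \<bar>v\<bar> ^ 3 / 6"
      using Maclaurin_sin_bound [of v 3]
      by (simp add: sin_coeff_def lessThan_nat_numeral lessThan_Suc fact_numeral)
    moreover have "\<bar>v\<bar> ^ 3 = v * v\<^sup>2" using v by (simp add: power3_eq_cube power2_eq_square)
    ultimately have "v - v * v\<^sup>2 / 6 \<le> sin v" by linarith
    moreover have "v\<^sup>2 \<le> 3"
    proof -
      have "v \<le> 17 / 10" using v pi_approx by simp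
      then have "v\<^sup>2 \<le> (17 / 10)\<^sup>2" using v by (intro power_mono) auto
      then show ?thesis by (simp add: power2_eq_square)
    qed
    then have "v * v\<^sup>2 \<le> v * 3" using v by (intro mult_left_mono)
    ultimately have "v / 2 \<le> sin v" by linarith
    moreover have "\<bar>x\<bar> \<le> v / 2" using mult_right_mono [OF pi_ge_two, of "\<bar>x\<bar>"] by (simp add: v_def)
    ultimately have "\<bar>x\<bar> \<le> sin v" by linarith
    moreover have "norm (1 - cis (2 * pi * x)) = 2 * \<bar>sin (pi * x)\<bar>"
    proof -
      have "(norm (1 - cis (2 * pi * x)))\<^sup>2 = (1 - cos (2 * (pi * x)))\<^sup>2 + (sin (2 * (pi * x)))\<^sup>2"
        by (simp add: cmod_power2 mult.assoc)
      also have "\<dots> = (2 * \<bar>sin (pi * x)\<bar>)\<^sup>2"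
        using sin_squared_eq [of "pi * x"]
        by (simp add: cos_double_sin sin_double power_mult_distrib) (simp add: power2_eq_square algebra_simps)
      finally show ?thesis by (rule power2_eq_imp_eq) simp_all
    qed
    moreover have "\<bar>sin (pi * x)\<bar> = \<bar>sin v\<bar>" by (cases "x \<ge> 0") (auto simp: v_def)
    ultimately show ?thesis by linarith
  qed
  with rho2 have rho3: "\<bar>x\<bar> \<le> \<rho>" by linarith
  have "exp (- (2 * pi * y)) \<le> 1 / (1 + 2 * pi * y)"
  proof -
    have "1 + 2 * pi * y \<le> exp (2 * pi * y)" by (rule exp_ge_add_one_self)
    then show ?thesis using y by (simp add: exp_minus field_simps add_pos_nonneg)
  qed
  also have "\<dots> \<le> 1 / (1 + 4 * y)"
  proof (rule divide_left_mono)
    show "1 + 4 * y \<le> 1 + 2 * pi * y" using y pi_ge_two by (simp add: mult_right_mono)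
    have "0 < 1 + 4 * y" "0 < 1 + 2 * pi * y" using y by (simp_all add: add_pos_nonneg)
    then show "0 < (1 + 2 * pi * y) * (1 + 4 * y)" by (intro mult_pos_pos)
  qed simp
  finally have "1 - 1 / (1 + 4 * y) \<le> \<rho>" using rho1 by (simp add: r_def)
  moreover have "1 - 1 / (1 + 4 * y) = 4 * y / (1 + 4 * y)" using y by (simp add: field_simps)
  ultimately have rho4: "4 * y / (1 + 4 * y) \<le> \<rho>" by simp
  have "min 1 (norm (w + of_int \<tau>)) / 3 \<le> \<rho>"
  proof (cases "y \<le> 1")
    case True
    have "y * (4 * y) \<le> y * 7" using y True by (intro mult_left_mono) auto
    then have "y / 2 \<le> 4 * y / (1 + 4 * y)" using y by (simp add: field_simps)
    then have "y \<le> 2 * \<rho>" using rho4 by linarith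
    moreover have "norm (w + of_int \<tau>) \<le> \<bar>x\<bar> + y"
      using cmod_le [of "w + of_int \<tau>"] y by (simp add: x_def y_def)
    ultimately show ?thesis using rho3 by linarith
  next
    case False
    then have "1 / 3 \<le> 4 * y / (1 + 4 * y)" by (simp add: field_simps)
    then show ?thesis using rho4 by linarith
  qed
  then show ?thesis using tau by (auto simp: \<rho>_def)
qed

lemma exp_2pi_i_eq_1_iff: "exp (2 * pi * \<i> * w) = 1 \<longleftrightarrow> Im w = 0 \<and> Re w \<in> \<int>"
proof -
  have "(\<exists>n. 2 * pi * Re w = of_int (2 * n) * pi) \<longleftrightarrow> Re w \<in> \<int>"
    by (auto simp: Ints_def)
  then show ?thesis by (auto simp: exp_eq_1)
qed

section \<open>Integrating factor and monodromy on the circle\<close>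

locale circle_ode =
  fixes a b A B :: "real \<Rightarrow> real" and \<alpha>0 \<beta>0 :: real
  assumes A: "\<And>t. (A has_vector_derivative a t) (at t)" and B: "\<And>t. (B has_vector_derivative b t) (at t)"
    and A_per: "\<And>t. A (t + 2 * pi) = A t + 2 * pi * \<alpha>0" and B_per: "\<And>t. B (t + 2 * pi) = B t + 2 * pi * \<beta>0"
begin

definition c :: "real \<Rightarrow> complex" where "c t = of_real (a t) + \<i> * of_real (b t)"

definition E :: "real \<Rightarrow> complex" where "E t = exp (\<i> * of_real (A t) - of_real (B t))"

text \<open>The multiplier of \<open>E\<close> over one period, inverse to the Floquet multiplier of
  the homogeneous equation. For \<open>z \<noteq> 1\<close> periodic solutions are unique; for
  \<open>z = 1\<close> a compatibility condition appears.\<close>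

definition z :: complex where "z = exp (2 * pi * \<i> * (of_real \<alpha>0 + \<i> * of_real \<beta>0))"

lemma A_cont: "continuous_on UNIV A" and B_cont: "continuous_on UNIV B"
  using A B by (metis continuous_at_imp_continuous_on has_vector_derivative_continuous)+

lemma E_cont: "continuous_on UNIV E"
  unfolding E_def by (intro continuous_intros A_cont B_cont)

lemma norm_E: "norm (E t) = exp (- B t)"
  by (simp add: E_def)

lemma E_nz [simp]: "E t \<noteq> 0"
  by (simp add: E_def)

lemma E_shift: "E (t + 2 * pi) = z * E t"
  unfolding E_def z_def exp_add [symmetric] A_per B_per by (simp add: algebra_simps)

lemma norm_z: "norm z = exp (- (2 * pi * \<beta>0))"
  by (simp add: z_def)

lemma z_nz [simp]: "z \<noteq> 0"
  by (simp add: z_def)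

lemma E_deriv: "(E has_vector_derivative \<i> * c t * E t) (at t)"
  and E_inverse_deriv: "((\<lambda>t. inverse (E t)) has_vector_derivative - (\<i> * c t) * inverse (E t)) (at t)"
proof -
  have "((\<lambda>t. \<i> * of_real (A t) - of_real (B t)) has_vector_derivative \<i> * of_real (a t) - of_real (b t)) (at t)"
    by (intro has_vector_derivative_diff has_vector_derivative_mult_right has_vector_derivative_of_real)
      (use A B in \<open>auto simp: has_real_derivative_iff_has_vector_derivative\<close>)
  also have "\<i> * of_real (a t) - of_real (b t) = \<i> * c t" by (simp add: c_def algebra_simps)
  finally have d: "((\<lambda>t. \<i> * of_real (A t) - of_real (B t)) has_vector_derivative \<i> * c t) (at t)" .
  from field_vector_diff_chain_at [OF d DERIV_exp] show "(E has_vector_derivative \<i> * c t * E t) (at t)"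
    by (simp add: E_def [abs_def] o_def)
  from has_vector_derivative_minus [OF d]
  have d': "((\<lambda>t. - (\<i> * of_real (A t) - of_real (B t))) has_vector_derivative - (\<i> * c t)) (at t)" .
  from field_vector_diff_chain_at [OF d' DERIV_exp]
  show "((\<lambda>t. inverse (E t)) has_vector_derivative - (\<i> * c t) * inverse (E t)) (at t)"
    by (simp add: E_def o_def exp_minus [symmetric])
qed

lemma integrating_factor:
  assumes "ode c f u"
  shows "((\<lambda>t. E t * u t) has_vector_derivative E t * f t) (at t)"
proof -
  have u: "(u has_vector_derivative f t - \<i> * c t * u t) (at t)" using assms by (simp add: ode_def)
  from has_vector_derivative_mult [OF E_deriv u] show ?thesis by (simp add: algebra_simps)
qed

lemma ode_integral:
  assumes "ode c f u" "s \<le> t"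
  shows "((\<lambda>t. E t * f t) has_integral E t * u t - E s * u s) {s..t}"
  by (rule has_integral_FTC [OF integrating_factor [OF assms(1)] assms(2)])

text \<open>The source of the small divisor: the solution at \<open>t\<close> is recovered from the
  right-hand side after division by \<open>z - 1\<close>. At \<open>z = 1\<close> the identity
  becomes the compatibility condition.\<close>

lemma ode_integral_period:
  assumes "ode c f u"
  shows "((\<lambda>t. E t * f t) has_integral (z - 1) * (E t * u t)) {t..t + 2 * pi}"
proof -
  have "u (t + 2 * pi) = u t" using assms by (simp add: ode_def)
  then have "E (t + 2 * pi) * u (t + 2 * pi) - E t * u t = (z - 1) * (E t * u t)"
    by (simp add: E_shift left_diff_distrib)
  then show ?thesis using ode_integral [OF assms, of t "t + 2 * pi"] by simp
qed

lemma ode_unique: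
  assumes "z \<noteq> 1" "ode c f u" "ode c f v"
  shows "u t = v t"
  using has_integral_unique [OF ode_integral_period [OF assms(2), of t] ode_integral_period [OF assms(3), of t]] assms(1)
  by simp

lemma ode_from_primitive:
  assumes G: "\<And>t. (G has_vector_derivative E t * f t) (at t)" and per: "\<And>t. G (t + 2 * pi) = z * G t"
  shows "ode c f (\<lambda>t. G t * inverse (E t))"
  unfolding ode_def
proof (intro conjI allI)
  fix t
  show "G (t + 2 * pi) * inverse (E (t + 2 * pi)) = G t * inverse (E t)"
    by (simp add: per E_shift)
  from has_vector_derivative_mult [OF G E_inverse_deriv]
  show "((\<lambda>t. G t * inverse (E t)) has_vector_derivative f t - \<i> * c t * (G t * inverse (E t))) (at t)"
    by (simp add: algebra_simps)
qed

lemma primitive_shift: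
  assumes G: "\<And>t. (G has_vector_derivative E t * f t) (at t)" and f: "\<And>t. f (t + 2 * pi) = f t"
  shows "G (t + 2 * pi) = z * G t + (G (2 * pi) - z * G 0)"
proof -
  have "((\<lambda>t. G (t + 2 * pi) - z * G t) has_vector_derivative 0) (at t)" for t
  proof -
    have "((\<lambda>t. t + 2 * pi) has_vector_derivative 1) (at t)" by (auto intro!: derivative_eq_intros)
    from vector_diff_chain_at [OF this G]
    have "((\<lambda>t. G (t + 2 * pi)) has_vector_derivative E (t + 2 * pi) * f (t + 2 * pi)) (at t)" by (simp add: o_def)
    from has_vector_derivative_diff [OF this has_vector_derivative_mult_right [OF G, of z]]
    show ?thesis by (simp add: E_shift f)
  qed
  from vector_derivative_0_const [OF this, of t 0] show ?thesis by (simp add: algebra_simps)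
qed

lemma ode_exists_nonresonant:
  assumes "z \<noteq> 1" "continuous_on UNIV f" "\<And>t. f (t + 2 * pi) = f t"
  shows "\<exists>u. ode c f u"
proof -
  obtain G where G: "\<And>t. (G has_vector_derivative E t * f t) (at t)"
    using ex_antiderivative [of "\<lambda>t. E t * f t"] E_cont assms(2) by (auto intro: continuous_on_mult)
  \<comment> \<open>A primitive is multiplied by \<open>z\<close> over a period up to an additive
    constant (\<open>primitive_shift\<close>); adding \<open>K\<close> removes it.\<close>
  define K where "K = (G (2 * pi) - z * G 0) / (z - 1)"
  have "ode c f (\<lambda>t. (G t + K) * inverse (E t))"
  proof (rule ode_from_primitive)
    show "((\<lambda>t. G t + K) has_vector_derivative E t * f t) (at t)" for t
      using has_vector_derivative_add [OF G [of t] has_vector_derivative_const [of K]] by simp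
    have "K * (z - 1) = G (2 * pi) - z * G 0" using assms(1) by (simp add: K_def)
    then have K: "z * K = K + (G (2 * pi) - z * G 0)" by (simp add: right_diff_distrib mult.commute diff_eq_eq add.commute)
    show "G (t + 2 * pi) + K = z * (G t + K)" for t
      unfolding primitive_shift [OF G assms(3), of t] distrib_left K by simp
  qed
  then show ?thesis by blast
qed

text \<open>The constant of integration is free when \<open>z = 1\<close>; it is spent on a zero at
  a prescribed \<open>t0\<close>, later a maximum point of the primitive of
  \<open>\<langle>\<xi>, \<beta>\<rangle>\<close>.\<close>

lemma ode_exists_resonant:
  assumes "z = 1" "continuous_on UNIV f" "\<And>t. f (t + 2 * pi) = f t" "((\<lambda>t. E t * f t) has_integral 0) {x..x + 2 * pi}"
  shows "\<exists>u. ode c f u \<and> u t0 = 0"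
proof -
  obtain G where G: "\<And>t. (G has_vector_derivative E t * f t) (at t)"
    using ex_antiderivative [of "\<lambda>t. E t * f t"] E_cont assms(2) by (auto intro: continuous_on_mult)
  have "G (x + 2 * pi) - G x = 0"
    by (rule has_integral_unique [OF has_integral_FTC [OF G] assms(4)]) simp
  then have per: "G (t + 2 * pi) = G t" for t
    using primitive_shift [OF G assms(3), of t] primitive_shift [OF G assms(3), of x] assms(1) by simp
  have "ode c f (\<lambda>t. (G t - G t0) * inverse (E t))"
  proof (rule ode_from_primitive)
    show "((\<lambda>t. G t - G t0) has_vector_derivative E t * f t) (at t)" for t
      using has_vector_derivative_diff [OF G [of t] has_vector_derivative_const [of "G t0"]] by simp
    show "G (t + 2 * pi) - G t0 = z * (G t - G t0)" for t by (simp add: per assms(1))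
  qed
  then show ?thesis by (intro exI [of _ "\<lambda>t. (G t - G t0) * inverse (E t)"]) simp
qed

lemma norm_ode_le_path:
  assumes "ode c f u" "s \<le> t" "\<And>x. norm (f x) \<le> F" "\<And>x. s \<le> x \<Longrightarrow> x \<le> t \<Longrightarrow> B x \<ge> m" "t - s \<le> 2 * pi"
  shows "norm (E t * u t - E s * u s) \<le> 2 * pi * F * exp (- m)"
proof -
  have F: "F \<ge> 0" using assms(3) [of 0] norm_ge_zero order_trans by blast
  have "norm (E t * u t - E s * u s) \<le> (t - s) * (exp (- m) * F)"
    by (rule norm_increment_le [OF integrating_factor [OF assms(1)] assms(2)])
       (use assms in \<open>auto simp: norm_mult norm_E intro!: mult_mono\<close>)
  also have "\<dots> \<le> (2 * pi) * (exp (- m) * F)" using assms F by (intro mult_right_mono) auto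
  finally show ?thesis by (simp add: mult_ac)
qed

lemma B_diff_le:
  assumes "\<And>t. m \<le> b t" "s \<le> t"
  shows "m * (t - s) \<le> B t - B s"
  using has_integral_le [OF _ has_integral_FTC [OF B assms(2)], of "\<lambda>_. m" "m * (t - s)"]
    has_integral_const_real [of m s t] assms
  by (simp add: mult.commute)

lemma B_diff_ge:
  assumes "\<And>t. b t \<le> m" "s \<le> t"
  shows "B t - B s \<le> m * (t - s)"
  using has_integral_le [OF has_integral_FTC [OF B assms(2)], of "\<lambda>_. m" "m * (t - s)"]
    has_integral_const_real [of m s t] assms
  by (simp add: mult.commute)

text \<open>Here \<open>B\<close> is nondecreasing, so over \<open>[t, t + 2 * pi]\<close> the
  kernel never exceeds its value at the starting point, and this value cancels.\<close>

lemma norm_ode_le_nonneg: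
  assumes "ode c f u" "\<And>x. norm (f x) \<le> F" "\<And>t. b t \<ge> 0"
  shows "norm (u t) * norm (z - 1) \<le> 2 * pi * F"
proof -
  have "norm (E (t + 2 * pi) * u (t + 2 * pi) - E t * u t) \<le> 2 * pi * F * exp (- B t)"
    by (rule norm_ode_le_path [OF assms(1) _ assms(2)]) (use B_diff_le [of 0] assms(3) in auto)
  moreover have "E (t + 2 * pi) * u (t + 2 * pi) - E t * u t = (z - 1) * u t * E t"
  proof -
    have "u (t + 2 * pi) = u t" using assms(1) unfolding ode_def by blast
    then show ?thesis unfolding E_shift by (simp add: algebra_simps)
  qed
  ultimately have "norm (z - 1) * norm (u t) * exp (- B t) \<le> 2 * pi * F * exp (- B t)"
    by (simp add: norm_mult norm_E)
  then show ?thesis by (simp add: mult.commute)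
qed

text \<open>Mirror case: the kernel is largest at the right end, so the identity is normalised there
  and \<open>inverse z\<close>, which now has modulus at most 1, takes the role of
  \<open>z\<close>.\<close>

lemma norm_ode_le_nonpos:
  assumes "ode c f u" "\<And>x. norm (f x) \<le> F" "\<And>t. b t \<le> 0"
  shows "norm (u t) * norm (inverse z - 1) \<le> 2 * pi * F"
proof -
  have "norm (E (t + 2 * pi) * u (t + 2 * pi) - E t * u t) \<le> 2 * pi * F * exp (- B (t + 2 * pi))"
    by (rule norm_ode_le_path [OF assms(1) _ assms(2)]) (use B_diff_ge [of 0] assms(3) in auto)
  moreover have "E (t + 2 * pi) * u (t + 2 * pi) - E t * u t = (1 - inverse z) * u t * E (t + 2 * pi)"
  proof -
    have "u (t + 2 * pi) = u t" using assms(1) unfolding ode_def by blast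
    moreover have "E t = inverse z * E (t + 2 * pi)" unfolding E_shift by simp
    ultimately show ?thesis by (simp add: left_diff_distrib)
  qed
  ultimately have "norm (1 - inverse z) * norm (u t) * exp (- B (t + 2 * pi)) \<le> 2 * pi * F * exp (- B (t + 2 * pi))"
    by (simp add: norm_mult norm_E)
  then show ?thesis by (simp add: mult.commute norm_minus_commute)
qed

end

section \<open>Sublevel sets on the circle\<close>

lemma circle_image_period:
  assumes "\<And>t. P (t + 2 * pi) = P t"
  shows "cis ` {t \<in> {0..2*pi}. P t} = cis ` {t. P t}"
proof
  show "cis ` {t. P t} \<subseteq> cis ` {t \<in> {0..2*pi}. P t}"
  proof clarify
    fix t assume t: "P t"
    define n where "n = \<lfloor>t / (2 * pi)\<rfloor>"
    have "t + of_int (- n) * (2 * pi) \<in> {0..2*pi}"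
      unfolding n_def using floor_divide_lower [of "2*pi" t] floor_divide_upper [of "2*pi" t] by (auto simp: algebra_simps)
    moreover have "P (t + of_int (- n) * (2 * pi))" using periodic_int_mult [of P "2 * pi" t "- n"] assms t by simp
    moreover have "cis (t + of_int (- n) * (2 * pi)) = cis t"
      using periodic_int_mult [of cis "2 * pi" t "- n"] by (simp add: cis_mult [symmetric])
    ultimately show "cis t \<in> cis ` {t \<in> {0..2*pi}. P t}" by (metis (mono_tags, lifting) image_eqI mem_Collect_eq)
  qed
qed auto

text \<open>Each half-angle sine changes sign when \<open>s\<close> grows by \<open>2 * pi\<close>,
  but the product is a real affine function of the point \<open>cis s\<close>. For distinct
  \<open>cis p\<close> and \<open>cis q\<close> it vanishes on the circle only there and has
  opposite signs on the two arcs between them.\<close>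

lemma sin_half_product:
  "sin ((s - p) / 2) * sin ((s - q) / 2) = (cos ((q - p) / 2) - Re (cis s * cis (- ((p + q) / 2)))) / 2"
proof -
  have "cis s * cis (- ((p + q) / 2)) = cis ((s - p) / 2 + (s - q) / 2)"
    unfolding cis_mult by (rule arg_cong [of _ _ cis]) (simp add: field_simps)
  moreover have "(q - p) / 2 = (s - p) / 2 - (s - q) / 2" by (simp add: field_simps)
  ultimately show ?thesis by (simp only: sin_times_sin cis.sel)
qed

text \<open>The point \<open>t0\<close> is a maximum of \<open>B\<close>; if both arcs from \<open>t\<close> to it dipped below \<open>B t\<close>, then \<open>t\<close> and \<open>t0\<close> would
  disconnect a sublevel set.\<close>

lemma connected_sublevel_imp_path:
  fixes B :: "real \<Rightarrow> real"
  assumes cont: "continuous_on UNIV B" and per: "\<And>t. B (t + 2 * pi) = B t"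
    and conn: "\<And>r. connected (cis ` {t. B t < r})"
  shows "\<exists>t0. \<forall>t. \<exists>m::int. let t1 = t0 + of_int m * (2 * pi) in
     \<bar>t - t1\<bar> \<le> 2 * pi \<and> (\<forall>s. min t t1 \<le> s \<longrightarrow> s \<le> max t t1 \<longrightarrow> B t \<le> B s)"
proof -
  have "\<exists>x\<in>{0..2*pi}. \<forall>y\<in>{0..2*pi}. B y \<le> B x"
    by (rule continuous_attains_sup) (auto intro: continuous_on_subset [OF cont])
  then obtain t0 where t0: "\<And>y. y \<in> {0..2*pi} \<Longrightarrow> B y \<le> B t0" by blast
  have int: "B (t + of_int m * (2 * pi)) = B t" for t m by (rule periodic_int_mult [of B, OF per])
  have max: "B t \<le> B t0" for t
  proof -
    have "t + of_int (- \<lfloor>t / (2 * pi)\<rfloor>) * (2 * pi) \<in> {0..2*pi}"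
      using floor_divide_lower [of "2*pi" t] floor_divide_upper [of "2*pi" t] by (auto simp: algebra_simps)
    from t0 [OF this] show ?thesis by (simp only: int)
  qed
  have base: "(\<forall>s. t0 \<le> s \<longrightarrow> s \<le> t \<longrightarrow> B t \<le> B s) \<or> (\<forall>s. t \<le> s \<longrightarrow> s \<le> t0 + 2 * pi \<longrightarrow> B t \<le> B s)"
    if t: "t0 \<le> t" "t \<le> t0 + 2 * pi" for t
  proof (rule ccontr)
    assume "\<not> ?thesis"
    then obtain p q where pq: "t0 \<le> p" "p \<le> t" "B p < B t" "t \<le> q" "q \<le> t0 + 2 * pi" "B q < B t"
      by (auto simp: not_le)
    have "p \<noteq> t0" "p \<noteq> t" "q \<noteq> t" "q \<noteq> t0 + 2 * pi" using pq max [of t] per [of t0] by auto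
    with pq have lt: "t0 < p" "p < t" "t < q" "q < t0 + 2 * pi" by auto
    \<comment> \<open>Separates the two arcs between \<open>cis t0\<close> and \<open>cis t\<close>.
      Neither point lies in the strict sublevel set, so \<open>\<Phi>\<close> has no zero there; yet
      its values at \<open>p\<close> and \<open>q\<close> force one if the set is connected.\<close>
    define \<Phi> where "\<Phi> w = (cos ((t - t0) / 2) - Re (w * cis (- ((t0 + t) / 2)))) / 2" for w
    have \<Phi>: "\<Phi> (cis s) = sin ((s - t0) / 2) * sin ((s - t) / 2)" for s
      unfolding \<Phi>_def sin_half_product ..
    have "connected (\<Phi> ` cis ` {s. B s < B t})"
      by (rule connected_continuous_image [OF _ conn]) (auto simp: \<Phi>_def intro!: continuous_intros)
    moreover have "\<Phi> (cis p) \<in> \<Phi> ` cis ` {s. B s < B t}" "\<Phi> (cis q) \<in> \<Phi> ` cis ` {s. B s < B t}"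
      using pq by auto
    moreover have "\<Phi> (cis p) \<le> 0"
    proof -
      have "sin ((p - t0) / 2) > 0" using lt t by (intro sin_gt_zero) auto
      moreover have "sin ((t - p) / 2) > 0" using lt t by (intro sin_gt_zero) auto
      moreover have "sin ((p - t) / 2) = - sin ((t - p) / 2)" unfolding sin_minus [symmetric] by (simp add: minus_divide_left)
      ultimately show ?thesis unfolding \<Phi> by (simp add: mult_nonneg_nonneg)
    qed
    moreover have "0 \<le> \<Phi> (cis q)"
      unfolding \<Phi> by (intro mult_nonneg_nonneg sin_ge_zero) (use lt in auto)
    ultimately have "0 \<in> \<Phi> ` cis ` {s. B s < B t}" by (rule connectedD_interval)
    then obtain s where s: "B s < B t" "sin ((s - t0) / 2) * sin ((s - t) / 2) = 0" unfolding \<Phi> [symmetric] by force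
    then consider i :: int where "(s - t0) / 2 = of_int i * pi" | i :: int where "(s - t) / 2 = of_int i * pi"
      by (auto simp: sin_zero_iff_int2)
    then show False
    proof cases
      case 1
      then have "s = t0 + of_int i * (2 * pi)" by (simp add: field_simps)
      then show ?thesis using int [of t0 i] max [of t] s by simp
    next
      case 2
      then have "s = t + of_int i * (2 * pi)" by (simp add: field_simps)
      then show ?thesis using int [of t i] s by simp
    qed
  qed
  show ?thesis
  proof (rule exI, rule allI)
    fix t
    define n where "n = \<lfloor>(t - t0) / (2 * pi)\<rfloor>"
    define t' where "t' = t - of_int n * (2 * pi)"
    have t': "t0 \<le> t'" "t' \<le> t0 + 2 * pi"
      unfolding t'_def n_def using floor_divide_lower [of "2*pi" "t - t0"] floor_divide_upper [of "2*pi" "t - t0"] by (auto simp: algebra_simps)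
    have Bt: "B t' = B t" using int [of t' n] by (simp add: t'_def)
    have sh: "B (s - of_int n * (2 * pi)) = B s" for s using int [of "s - of_int n * (2 * pi)" n] by simp
    from base [OF t'] show "\<exists>m::int. let t1 = t0 + of_int m * (2 * pi) in
     \<bar>t - t1\<bar> \<le> 2 * pi \<and> (\<forall>s. min t t1 \<le> s \<longrightarrow> s \<le> max t t1 \<longrightarrow> B t \<le> B s)"
    proof
      assume *: "\<forall>s. t0 \<le> s \<longrightarrow> s \<le> t' \<longrightarrow> B t' \<le> B s"
      have "B t \<le> B s" if "t0 + of_int n * (2 * pi) \<le> s" "s \<le> t" for s
        using *[rule_format, of "s - of_int n * (2 * pi)"] that sh [of s] Bt by (simp add: t'_def)
      then show ?thesis using t' by (intro exI [of _ n]) (auto simp: Let_def t'_def min_def max_def)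
    next
      assume *: "\<forall>s. t' \<le> s \<longrightarrow> s \<le> t0 + 2 * pi \<longrightarrow> B t' \<le> B s"
      have "B t \<le> B s" if "t \<le> s" "s \<le> t0 + of_int (n + 1) * (2 * pi)" for s
        using *[rule_format, of "s - of_int n * (2 * pi)"] that sh [of s] Bt by (simp add: t'_def algebra_simps)
      then show ?thesis using t' by (intro exI [of _ "n + 1"]) (auto simp: Let_def t'_def min_def max_def algebra_simps)
    qed
  qed
qed

text \<open>Two points in different components are joined by neither arc inside the set, so each arc
  reaches height \<open>r\<close>; \<open>t1\<close> and \<open>t2\<close> are the two points, read
  in suitable periods.\<close>

lemma disconnected_sublevel_imp_points:
  fixes B :: "real \<Rightarrow> real"
  assumes per: "\<And>t. B (t + 2 * pi) = B t" and "\<not> connected (cis ` {t. B t < r})"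
  shows "\<exists>p q t1 t2. p < t1 \<and> t1 < q \<and> q < t2 \<and> t2 < p + 2 * pi \<and> B p \<ge> r \<and> B q \<ge> r \<and> B t1 < r \<and> B t2 < r"
proof -
  let ?\<Omega> = "cis ` {t. B t < r}"
  have int: "B (t + of_int m * (2 * pi)) = B t" for t m by (rule periodic_int_mult [of B, OF per])
  have cint: "cis (t + of_int m * (2 * pi)) = cis t" for t and m :: int
    by (rule periodic_int_mult [of cis]) (simp add: cis_mult [symmetric])
  obtain x y where xy: "x \<in> ?\<Omega>" "y \<in> ?\<Omega>" "\<not> connected_component ?\<Omega> x y"
    using assms(2) unfolding connected_iff_connected_component by auto
  obtain s t where st: "B s < r" "B t < r" "x = cis s" "y = cis t" using xy(1,2) by auto
  have no: "False" if "connected T" "T \<subseteq> ?\<Omega>" "cis s \<in> T" "cis t \<in> T" for T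
    using that xy(3) st(3,4) unfolding connected_component_def by auto
  define n where "n = \<lfloor>(t - s) / (2 * pi)\<rfloor>"
  define t' where "t' = t + of_int (- n) * (2 * pi)"
  have t': "s \<le> t'" "t' < s + 2 * pi"
    unfolding t'_def n_def using floor_divide_lower [of "2*pi" "t - s"] floor_divide_upper [of "2*pi" "t - s"] by (auto simp: algebra_simps)
  have Bt: "B t' < r" "cis t' = cis t" unfolding t'_def int cint by (rule st) (rule refl)
  have arc: "\<exists>p. x \<le> p \<and> p \<le> y \<and> B p \<ge> r"
    if "x \<le> y" "cis x = cis s \<and> cis y = cis t \<or> cis x = cis t \<and> cis y = cis s" for x y
  proof (rule ccontr)
    assume "\<not> ?thesis"
    then have "\<And>p. p \<in> {x..y} \<Longrightarrow> B p < r" by (meson atLeastAtMost_iff not_le)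
    then have "cis ` {x..y} \<subseteq> ?\<Omega>" by auto
    moreover have "connected (cis ` {x..y})" by (intro connected_continuous_image continuous_intros) auto
    moreover have "cis x \<in> cis ` {x..y}" "cis y \<in> cis ` {x..y}" using that(1) by auto
    ultimately show False using no that(2) by metis
  qed
  obtain p where p: "s \<le> p" "p \<le> t'" "B p \<ge> r" using arc [of s t'] t' Bt by auto
  have "cis (s + 2 * pi) = cis s" using cint [of s 1] by simp
  then obtain q where q: "t' \<le> q" "q \<le> s + 2 * pi" "B q \<ge> r" using arc [of t' "s + 2 * pi"] t' Bt by auto
  have "p \<noteq> s" "p \<noteq> t'" "q \<noteq> t'" "q \<noteq> s + 2 * pi" using p q st Bt per [of s] by auto
  then show ?thesis using p q st Bt per [of s] by (intro exI [of _ p] exI [of _ q] exI [of _ t'] exI [of _ "s + 2 * pi"]) auto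
qed

section \<open>Regularity estimates uniform in the frequency\<close>

context weight_subadd
begin

text \<open>The order of quantifiers matters: \<open>K\<close> depends on \<open>\<delta>\<close>
  and \<open>D\<close> only, so \<eta> can be chosen after it and the loss
  \<open>exp (\<eta> * K * \<omega> Q)\<close> made as weak as desired, uniformly over all
  fibres.\<close>

lemma uniform_coefficient_decay:
  assumes "\<delta> > 0"
  shows "\<exists>K\<ge>1. \<forall>\<eta> Q ch fh G U u. 0 < \<eta> \<longrightarrow> \<eta> \<le> \<delta> / 2 \<longrightarrow> Q \<ge> 1 \<longrightarrow> decay_int (Q * D) \<delta> ch \<longrightarrow> decay_int G \<delta> fh
    \<longrightarrow> ode (fser ch) (fser fh) u \<longrightarrow> (\<forall>t. norm (u t) \<le> U) \<longrightarrow> decay_int (2 * (G + U * exp (\<eta> * K * \<omega> Q))) \<eta> (fcoef u)"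
proof -
  define M where "M = max 1 (2 * (D * isum (\<delta> / 2)))"
  have M: "M \<ge> 1" "D * isum (\<delta> / 2) \<le> M / 2" by (auto simp: M_def)
  have "decay_int (2 * (G + U * exp (\<eta> * (M + 1) * \<omega> Q))) \<eta> (fcoef u)"
    if \<eta>: "0 < \<eta>" "\<eta> \<le> \<delta> / 2" and Q: "Q \<ge> 1" and ch: "decay_int (Q * D) \<delta> ch" and fh: "decay_int G \<delta> fh"
      and u: "ode (fser ch) (fser fh) u" and U: "\<forall>t. norm (u t) \<le> U" for \<eta> Q ch fh G U u
  proof -
    have "decay_int (2 * (G + U * exp (\<eta> * \<omega> (M * Q)))) \<eta> (fcoef u)"
      by (rule ode_coefficient_decay [OF _ _ _ ch fh assms \<eta> Q M]) (use u U in \<open>auto simp: ode_def\<close>)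
    then show ?thesis
    proof (rule decay_int_mono)
      have "\<omega> (M * Q) \<le> (M + 1) * \<omega> Q" using M Q by (intro w_scale) auto
      then have "\<eta> * \<omega> (M * Q) \<le> \<eta> * (M + 1) * \<omega> Q" using \<eta> by (simp add: mult.assoc)
      moreover have "U \<ge> 0" using U norm_ge_zero order_trans by blast
      ultimately show "2 * (G + U * exp (\<eta> * \<omega> (M * Q))) \<le> 2 * (G + U * exp (\<eta> * (M + 1) * \<omega> Q))"
        by (intro mult_left_mono add_left_mono) auto
    qed simp
  qed
  with M(1) show ?thesis by (intro exI [of _ "M + 1"]) auto
qed

text \<open>\<open>\<omega>\<close> at the full frequency dominates its values at both parts, hence
  half of the exponent for each. The reverse passage \<open>decay_unslice\<close> uses subadditivity
  and loses nothing.\<close>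

lemma decay_slice:
  assumes "decay D \<epsilon> d" "\<epsilon> > 0"
  shows "decay_int (D * exp (- (\<epsilon> / 2) * \<omega> (l1 \<xi>))) (\<epsilon> / 2) (\<lambda>\<tau>. d (mk \<tau> \<xi>))"
  unfolding decay_int_def
proof
  fix \<tau>
  have "\<omega> \<bar>real_of_int \<tau>\<bar> + \<omega> (l1 \<xi>) \<le> 2 * \<omega> (l1 (mk \<tau> \<xi>))"
    using w_mono [of "\<bar>real_of_int \<tau>\<bar>" "l1 (mk \<tau> \<xi>)"] w_mono [of "l1 \<xi>" "l1 (mk \<tau> \<xi>)"] by (simp add: l1_mk)
  from mult_left_mono [OF this, of "\<epsilon> / 2"] assms(2)
  have "- \<epsilon> * \<omega> (l1 (mk \<tau> \<xi>)) \<le> - (\<epsilon> / 2) * \<omega> (l1 \<xi>) + - (\<epsilon> / 2) * \<omega> \<bar>real_of_int \<tau>\<bar>"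
    by (simp add: algebra_simps)
  then have "D * exp (- \<epsilon> * \<omega> (l1 (mk \<tau> \<xi>))) \<le> D * exp (- (\<epsilon> / 2) * \<omega> (l1 \<xi>) + - (\<epsilon> / 2) * \<omega> \<bar>real_of_int \<tau>\<bar>)"
    using decay_nonneg [OF assms(1)] by (intro mult_left_mono) auto
  then show "norm (d (mk \<tau> \<xi>)) \<le> D * exp (- (\<epsilon> / 2) * \<omega> (l1 \<xi>)) * exp (- (\<epsilon> / 2) * \<omega> \<bar>real_of_int \<tau>\<bar>)"
    using assms(1) unfolding decay_def exp_add by (metis mult.assoc order_trans)
qed

lemma decay_unslice:
  assumes "\<eta> > 0" "\<And>\<xi>. decay_int (D * exp (- \<eta> * \<omega> (l1 \<xi>))) \<eta> (\<lambda>\<tau>. d (mk \<tau> \<xi>))"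
  shows "decay D \<eta> d"
  unfolding decay_def
proof
  fix k :: "'a option \<Rightarrow> int"
  define \<xi> where "\<xi> = (\<lambda>j. k (Some j))"
  have k: "mk (k None) \<xi> = k" unfolding \<xi>_def by (rule mk_collapse)
  have "D * exp (- \<eta> * \<omega> (l1 \<xi>)) \<ge> 0" using decay_int_nonneg [OF assms(2)] .
  then have D: "D \<ge> 0" by (simp add: zero_le_mult_iff)
  have "norm (d k) \<le> D * exp (- \<eta> * \<omega> (l1 \<xi>)) * exp (- \<eta> * \<omega> \<bar>real_of_int (k None)\<bar>)"
    using assms(2) [of \<xi>] k unfolding decay_int_def by metis
  also have "\<dots> = D * exp (- \<eta> * (\<omega> \<bar>real_of_int (k None)\<bar> + \<omega> (l1 \<xi>)))"
    by (simp add: exp_add [symmetric] algebra_simps)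
  also have "\<dots> \<le> D * exp (- \<eta> * \<omega> (l1 k))"
  proof -
    have "\<omega> (l1 k) \<le> \<omega> \<bar>real_of_int (k None)\<bar> + \<omega> (l1 \<xi>)"
      using w_add [of "\<bar>real_of_int (k None)\<bar>" "l1 \<xi>"] by (subst k [symmetric]) (simp add: l1_mk)
    then show ?thesis using assms(1) D by (intro mult_left_mono) auto
  qed
  finally show "norm (d k) \<le> D * exp (- \<eta> * \<omega> (l1 k))" .
qed

lemma norm_fser_le:
  assumes "decay_int C \<epsilon> h" "\<epsilon> > 0"
  shows "norm (fser h t) \<le> C * isum \<epsilon>"
proof -
  have "norm (fser h t) \<le> (\<Sum>\<^sub>\<infinity>n::int. C * exp (- \<epsilon> * \<omega> \<bar>real_of_int n\<bar>))"
    unfolding fser_def using assms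
    by (intro norm_infsum_le_infsum(1) summable_on_cmult_right summable_exp_w_int) (auto simp: norm_mult decay_int_def)
  also have "\<dots> = C * isum \<epsilon>" unfolding isum_def by (rule infsum_cmult_right')
  finally show ?thesis .
qed

lemma isum_nonneg: "isum \<epsilon> \<ge> 0"
  unfolding isum_def by (rule infsum_nonneg) simp

lemma decay_int_add: "decay_int C \<epsilon> c \<Longrightarrow> decay_int D \<epsilon> d \<Longrightarrow> decay_int (C + D) \<epsilon> (\<lambda>k. c k + d k)"
  unfolding decay_int_def by (auto simp: distrib_right intro: order_trans [OF norm_triangle_ineq] add_mono)

lemma decay_int_cmult: "decay_int C \<epsilon> c \<Longrightarrow> decay_int (norm a * C) \<epsilon> (\<lambda>k. a * c k)"
  unfolding decay_int_def by (auto simp: norm_mult mult.assoc intro: mult_left_mono)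

lemma decay_int_sum:
  assumes "finite A" "\<And>i. i \<in> A \<Longrightarrow> decay_int (C i) \<epsilon> (c i)"
  shows "decay_int (\<Sum>i\<in>A. C i) \<epsilon> (\<lambda>k. \<Sum>i\<in>A. c i k)"
  using assms
proof (induction rule: finite_induct)
  case empty
  then show ?case by (simp add: decay_int_def)
next
  case (insert i A)
  then show ?case by (simp add: decay_int_add)
qed

end

lemma fser_cmult: "fser (\<lambda>k. a * c k) x = a * fser c x"
  unfolding fser_def mult.assoc by (rule infsum_cmult_right')

lemma fser_summable:
  assumes "(\<lambda>k. norm (c k)) summable_on UNIV"
  shows "(\<lambda>k. c k * cis (of_int k * x)) summable_on UNIV"
  by (rule norm_infsum_le_infsum(2) [OF assms]) (simp add: norm_mult)

lemma fser_add:
  assumes "(\<lambda>k. norm (c k)) summable_on UNIV" "(\<lambda>k. norm (d k)) summable_on UNIV"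
  shows "fser (\<lambda>k. c k + d k) x = fser c x + fser d x"
  unfolding fser_def distrib_right by (rule infsum_add) (auto intro: fser_summable assms)

lemma fser_sum:
  assumes "finite A" "\<And>i. i \<in> A \<Longrightarrow> (\<lambda>k. norm (c i k)) summable_on UNIV"
  shows "fser (\<lambda>k. \<Sum>i\<in>A. c i k) x = (\<Sum>i\<in>A. fser (c i) x)"
proof -
  have "((\<lambda>k. \<Sum>i\<in>A. c i k * cis (of_int k * x)) has_sum (\<Sum>i\<in>A. fser (c i) x)) UNIV"
    using assms
  proof (induction rule: finite_induct)
    case (insert i A)
    then show ?case
      unfolding fser_def by (subst (1 2) sum.insert) (auto intro!: has_sum_add has_sum_infsum fser_summable)
  qed simp
  then show ?thesis unfolding fser_def sum_distrib_right by (rule infsumI)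
qed

definition dot :: "('n::finite \<Rightarrow> int) \<Rightarrow> ('n \<Rightarrow> real \<Rightarrow> real) \<Rightarrow> real \<Rightarrow> real" where
  "dot \<xi> g t = (\<Sum>j\<in>UNIV. of_int (\<xi> j) * g j t)"

lemma symb_dot: "symb a b \<xi> t = of_real (dot \<xi> a t) + \<i> * of_real (dot \<xi> b t)"
  by (simp add: symb_def dot_def distrib_left sum.distrib sum_distrib_left mult.left_commute)

text \<open>Fixing one primitive per coefficient makes \<open>dot \<xi>\<close> of the primitives
  linear in \<xi>; multiples of a frequency then have exactly multiplied exponents.\<close>

definition prim :: "(real \<Rightarrow> real) \<Rightarrow> real \<Rightarrow> real" where
  "prim g = (SOME G. \<forall>t. (G has_vector_derivative g t) (at t))"

lemma prim_deriv:
  assumes "continuous_on UNIV g"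
  shows "(prim g has_vector_derivative g t) (at t)"
  using someI_ex [OF ex_antiderivative [OF assms]] unfolding prim_def by blast

lemma prim_integral:
  assumes "continuous_on UNIV g" "s \<le> t"
  shows "integral {s..t} g = prim g t - prim g s"
  by (rule integral_unique) (rule has_integral_FTC [OF prim_deriv [OF assms(1)] assms(2)])

lemma prim_shift:
  assumes "continuous_on UNIV g" "\<And>t. g (t + 2 * pi) = g t"
  shows "prim g (t + 2 * pi) = prim g t + 2 * pi * mean g"
  using prim_integral [OF assms(1), of t "t + 2 * pi"] integral_periodic_shift [OF assms, of t] by (simp add: mean_def)

lemma dot_deriv:
  assumes "\<And>j. (G j has_vector_derivative g j t) (at t)"
  shows "(dot \<xi> G has_vector_derivative dot \<xi> g t) (at t)"
  unfolding dot_def by (intro has_vector_derivative_sum has_vector_derivative_mult_right assms)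

section \<open>Fibre equations of the vector field\<close>

locale vector_field = weight_subadd +
  fixes a b :: "'n::finite \<Rightarrow> real \<Rightarrow> real"
  assumes aE: "E_omega \<omega> (\<lambda>v::real^1. complex_of_real (a j (v $ 1)))"
    and bE: "E_omega \<omega> (\<lambda>v::real^1. complex_of_real (b j (v $ 1)))"
begin

lemma coefficient_series:
  "\<exists>D \<delta> h. \<delta> > 0 \<and> (\<forall>j. decay_int D \<delta> (h j)) \<and> (\<forall>j t. of_real (g j t) = fser (h j) t)"
  if "\<And>j. E_omega \<omega> (\<lambda>v::real^1. complex_of_real (g j (v $ 1)))" for g :: "'n \<Rightarrow> real \<Rightarrow> real"
proof -
  have "\<exists>C \<epsilon> h. \<epsilon> > 0 \<and> decay_int C \<epsilon> h \<and> (\<lambda>t. of_real (g j t)) = fser h" for j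
    using E_omega_1_fser [OF that [of j]] by metis
  then obtain C \<epsilon> h where h: "\<And>j. \<epsilon> j > 0" "\<And>j. decay_int (C j) (\<epsilon> j) (h j)" "\<And>j. (\<lambda>t. of_real (g j t)) = fser (h j)"
    by metis
  define D where "D = Max (range C)"
  define \<delta> where "\<delta> = Min (range \<epsilon>)"
  have "decay_int D \<delta> (h j)" for j
    by (rule decay_int_mono [OF h(2)]) (auto simp: D_def \<delta>_def)
  moreover have "\<delta> > 0" using h(1) by (simp add: \<delta>_def)
  moreover have "of_real (g j t) = fser (h j) t" for j t using fun_cong [OF h(3)] by metis
  ultimately show ?thesis by blast
qed

lemma coefficient_regular:
  assumes "\<And>j. E_omega \<omega> (\<lambda>v::real^1. complex_of_real (g j (v $ 1)))"
  shows "continuous_on UNIV (g j)" "g j (t + 2 * pi) = g j t"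
proof -
  obtain C \<epsilon> h where h: "\<epsilon> > 0" "decay_int C \<epsilon> h" "(\<lambda>t. of_real (g j t)) = fser h"
    by (rule E_omega_1_fser [OF assms])
  have g: "g j = (\<lambda>t. Re (fser h t))" by (simp add: h(3) [symmetric])
  show "continuous_on UNIV (g j)"
    unfolding g by (intro continuous_intros fser_continuous decay_int_rapid(2) [OF h(2,1)])
  show "g j (t + 2 * pi) = g j t" by (simp add: g fser_periodic)
qed

lemmas a_cont = coefficient_regular(1) [of a, OF aE] and a_per = coefficient_regular(2) [of a, OF aE]
  and b_cont = coefficient_regular(1) [of b, OF bE] and b_per = coefficient_regular(2) [of b, OF bE]

definition \<alpha>m :: "('n \<Rightarrow> int) \<Rightarrow> real" where "\<alpha>m \<xi> = (\<Sum>j\<in>UNIV. of_int (\<xi> j) * mean (a j))"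
definition \<beta>m :: "('n \<Rightarrow> int) \<Rightarrow> real" where "\<beta>m \<xi> = (\<Sum>j\<in>UNIV. of_int (\<xi> j) * mean (b j))"
definition wm :: "('n \<Rightarrow> int) \<Rightarrow> complex" where "wm \<xi> = of_real (\<alpha>m \<xi>) + \<i> * of_real (\<beta>m \<xi>)"

lemma wm_eq: "wm \<xi> = (\<Sum>j\<in>UNIV. of_int (\<xi> j) * (complex_of_real (mean (a j)) + \<i> * complex_of_real (mean (b j))))"
  by (simp add: wm_def \<alpha>m_def \<beta>m_def distrib_left sum.distrib sum_distrib_left mult.left_commute)

text \<open>One copy of the circle theory per frequency; the multiplier becomes
  \<open>exp (2 * pi * \<i> * wm \<xi>)\<close>, so resonance means that \<open>wm \<xi>\<close> is
  an integer.\<close>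

sublocale fib: circle_ode "dot \<xi> a" "dot \<xi> b" "dot \<xi> (\<lambda>j. prim (a j))" "dot \<xi> (\<lambda>j. prim (b j))" "\<alpha>m \<xi>" "\<beta>m \<xi>" for \<xi>
proof
  fix t
  show "(dot \<xi> (\<lambda>j. prim (a j)) has_vector_derivative dot \<xi> a t) (at t)"
    by (intro dot_deriv prim_deriv a_cont)
  show "(dot \<xi> (\<lambda>j. prim (b j)) has_vector_derivative dot \<xi> b t) (at t)"
    by (intro dot_deriv prim_deriv b_cont)
  show "dot \<xi> (\<lambda>j. prim (a j)) (t + 2 * pi) = dot \<xi> (\<lambda>j. prim (a j)) t + 2 * pi * \<alpha>m \<xi>"
    by (simp add: dot_def \<alpha>m_def prim_shift [OF a_cont a_per] distrib_left sum.distrib sum_distrib_left mult.left_commute)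
  show "dot \<xi> (\<lambda>j. prim (b j)) (t + 2 * pi) = dot \<xi> (\<lambda>j. prim (b j)) t + 2 * pi * \<beta>m \<xi>"
    by (simp add: dot_def \<beta>m_def prim_shift [OF b_cont b_per] distrib_left sum.distrib sum_distrib_left mult.left_commute)
qed

abbreviation Bp :: "('n \<Rightarrow> int) \<Rightarrow> real \<Rightarrow> real" where "Bp \<xi> \<equiv> dot \<xi> (\<lambda>j. prim (b j))"
abbreviation Ap :: "('n \<Rightarrow> int) \<Rightarrow> real \<Rightarrow> real" where "Ap \<xi> \<equiv> dot \<xi> (\<lambda>j. prim (a j))"

lemma fib_c: "fib.c \<xi> = symb a b \<xi>"
  by (rule ext) (simp add: fib.c_def symb_dot)

lemma fib_z: "fib.z \<xi> = exp (2 * pi * \<i> * wm \<xi>)"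
  by (simp add: fib.z_def wm_def)

lemma fib_z_eq_1_iff: "fib.z \<xi> = 1 \<longleftrightarrow> \<beta>m \<xi> = 0 \<and> \<alpha>m \<xi> \<in> \<int>"
  unfolding fib_z exp_2pi_i_eq_1_iff by (simp add: wm_def)

text \<open>The symbol grows linearly in \<xi>, while the decay rate of its coefficients is the same
  for all \<xi>; this growth is the parameter \<open>Q\<close> of the regularity estimate.\<close>

lemma symbol_series:
  "\<exists>D \<delta> h. \<delta> > 0 \<and> D \<ge> 0 \<and> (\<forall>\<xi>. decay_int (l1 \<xi> * D) \<delta> (h \<xi>) \<and> fser (h \<xi>) = symb a b \<xi>)"
proof -
  obtain D1 \<delta>1 h1 where h1: "\<delta>1 > 0" "\<And>j. decay_int D1 \<delta>1 (h1 j)" "\<And>j t. of_real (a j t) = fser (h1 j) t"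
    using coefficient_series [of a, OF aE] by metis
  obtain D2 \<delta>2 h2 where h2: "\<delta>2 > 0" "\<And>j. decay_int D2 \<delta>2 (h2 j)" "\<And>j t. of_real (b j t) = fser (h2 j) t"
    using coefficient_series [of b, OF bE] by metis
  define \<delta> where "\<delta> = min \<delta>1 \<delta>2"
  have \<delta>: "\<delta> > 0" using h1 h2 by (simp add: \<delta>_def)
  define D where "D = D1 + D2"
  have D: "D \<ge> 0" unfolding D_def using decay_int_nonneg h1(2) h2(2) by (metis add_nonneg_nonneg)
  define h where "h \<xi> n = (\<Sum>j\<in>UNIV. of_int (\<xi> j) * (h1 j n + \<i> * h2 j n))" for \<xi> n
  have d: "decay_int D \<delta> (\<lambda>n. h1 j n + \<i> * h2 j n)" for j
  proof -
    have "decay_int D2 \<delta> (\<lambda>n. \<i> * h2 j n)"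
      using decay_int_cmult [of D2 \<delta> "h2 j" \<i>] decay_int_mono [OF h2(2)] by (simp add: \<delta>_def)
    moreover have "decay_int D1 \<delta> (h1 j)" using decay_int_mono [OF h1(2)] by (simp add: \<delta>_def)
    ultimately show ?thesis unfolding D_def by (intro decay_int_add)
  qed
  have "decay_int (l1 \<xi> * D) \<delta> (h \<xi>)" for \<xi>
  proof -
    have "decay_int (\<Sum>j\<in>UNIV. norm (complex_of_int (\<xi> j)) * D) \<delta> (\<lambda>n. \<Sum>j\<in>UNIV. of_int (\<xi> j) * (h1 j n + \<i> * h2 j n))"
      by (intro decay_int_sum decay_int_cmult d) simp
    then show ?thesis by (simp add: h_def [abs_def] l1_def sum_distrib_right)
  qed
  moreover have "fser (h \<xi>) = symb a b \<xi>" for \<xi>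
  proof
    fix t
    have s1: "(\<lambda>n. norm (h1 j n)) summable_on UNIV" and s2: "(\<lambda>n. norm (h2 j n)) summable_on UNIV" for j
      using decay_int_rapid(2) h1 h2 by blast+
    have s2': "(\<lambda>n. norm (\<i> * h2 j n)) summable_on UNIV" for j using s2 by (simp add: norm_mult)
    have s: "(\<lambda>n. norm (of_int (\<xi> j) * (h1 j n + \<i> * h2 j n))) summable_on UNIV" for j
      using decay_int_rapid(2) [OF decay_int_cmult [OF d] \<delta>] .
    show "fser (h \<xi>) t = symb a b \<xi> t"
      unfolding h_def [abs_def] symb_def h1(3) h2(3)
      by (subst fser_sum [OF _ s]) (simp_all add: fser_cmult fser_add [OF s1 s2'])
  qed
  ultimately show ?thesis using \<delta> D by blast
qed

lemma E_omega_L_op: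
  assumes "E_omega \<omega> f"
  shows "E_omega \<omega> (L_op a b f)"
proof -
  have "E_omega \<omega> (\<lambda>p::real^'n option. of_real (g j (p $ None)))"
    if gE: "\<And>j. E_omega \<omega> (\<lambda>v::real^1. complex_of_real (g j (v $ 1)))" for g :: "'n \<Rightarrow> real \<Rightarrow> real" and j
  proof -
    obtain C \<epsilon> h where h: "\<epsilon> > 0" "decay_int C \<epsilon> h" "(\<lambda>t. of_real (g j t)) = fser h"
      by (rule E_omega_1_fser [OF gE])
    show ?thesis using E_omega_fser_coord [OF h(2,1), of "None :: 'n option"] by (simp add: h(3) [symmetric])
  qed
  note this [OF aE] this [OF bE]
  then show ?thesis unfolding L_op_def [abs_def]
    by (intro E_omega_add E_omega_sum E_omega_mult E_omega_cmult E_omega_pd assms) auto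
qed

lemma E_omega_L_op_tser:
  assumes "E_omega \<omega> (tser c)" "rapid c"
  obtains d where "L_op a b (tser c) = tser d" "rapid d" "\<And>\<xi>. ode (symb a b \<xi>) (fser (\<lambda>\<tau>. d (mk \<tau> \<xi>))) (fser (\<lambda>\<tau>. c (mk \<tau> \<xi>)))"
proof -
  obtain D \<epsilon> d where d: "\<epsilon> > 0" "decay D \<epsilon> d" "L_op a b (tser c) = tser d" "rapid d"
    by (rule E_omegaE [OF E_omega_L_op [OF assms(1)]])
  show ?thesis
    by (rule that [OF d(3,4)]) (rule ode_of_L_op [OF assms(2) rapid_summable [OF d(4)] a_cont b_cont d(3)])
qed

text \<open>Pairing the \<open>\<xi>\<close>-th partial Fourier coefficient with the periodic solution \<open>E\<close> of the adjoint equation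
  yields an element of the kernel of the transpose, hence the compatibility condition at resonant frequencies.\<close>

lemma annihilator_compatibility:
  assumes z: "fib.z \<xi> = 1" and d: "E_omega \<omega> (tser d)" "rapid d"
    and ann: "\<And>\<mu>. E_dual \<omega> \<mu> \<Longrightarrow> (\<And>g. E_omega \<omega> g \<Longrightarrow> \<mu> (L_op a b g) = 0) \<Longrightarrow> \<mu> (tser d) = 0"
  shows "((\<lambda>t. fib.E \<xi> t * fser (\<lambda>\<tau>. d (mk \<tau> \<xi>)) t) has_integral 0) {0..0 + 2 * pi}"
proof -
  define S where "S f t = slice \<xi> f (\<chi> i. t)" for f t
  define \<mu> where "\<mu> f = integral {0..2*pi} (\<lambda>t. fib.E \<xi> t * S f t)" for f
  have Sc: "continuous_on A (S f)" if "E_omega \<omega> f" for A f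
    unfolding S_def using continuous_on_slice [OF E_omega_continuous [OF that]]
    by (rule continuous_on_compose2) (auto intro!: continuous_intros)
  have int: "(\<lambda>t. fib.E \<xi> t * S f t) integrable_on {0..2*pi}" if "E_omega \<omega> f" for f
    by (intro integrable_continuous_real continuous_intros Sc that continuous_on_subset [OF fib.E_cont]) simp
  have St: "S (tser e) t = fser (\<lambda>\<tau>. e (mk \<tau> \<xi>)) t" if "rapid e" for e t
    by (simp add: S_def slice_tser rapid_summable that)
  have "E_dual \<omega> \<mu>"
    unfolding E_dual_def
  proof (intro conjI allI impI)
    fix f g :: "real^'n option \<Rightarrow> complex" assume fg: "E_omega \<omega> f" "E_omega \<omega> g"
    then have "S (\<lambda>x. f x + g x) t = S f t + S g t" for t
      unfolding S_def by (intro slice_add E_omega_continuous)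
    then show "\<mu> (\<lambda>x. f x + g x) = \<mu> f + \<mu> g"
      by (simp add: \<mu>_def distrib_left integral_add int fg)
  next
    fix f :: "real^'n option \<Rightarrow> complex" and c assume f: "E_omega \<omega> f"
    have "(\<lambda>t. fib.E \<xi> t * S (\<lambda>x. c * f x) t) = (\<lambda>t. c * (fib.E \<xi> t * S f t))"
      unfolding S_def slice_cmult by (simp add: mult.left_commute)
    then show "\<mu> (\<lambda>x. c * f x) = c * \<mu> f" by (simp add: \<mu>_def)
  next
    fix k :: nat assume k: "k \<ge> 1"
    define lam where "lam = 1 / real k"
    have lam: "lam > 0" using k by (simp add: lam_def)
    have "compact (fib.E \<xi> ` {0..2*pi})"
      by (intro compact_continuous_image continuous_on_subset [OF fib.E_cont]) auto
    then obtain M where M: "M > 0" "\<And>t. t \<in> {0..2*pi} \<Longrightarrow> norm (fib.E \<xi> t) \<le> M"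
      using compact_imp_bounded [of "fib.E \<xi> ` {0..2*pi}"] unfolding bounded_pos by blast
    have "norm (\<mu> f) \<le> (M * exp (lam * phi_star \<omega> 0) * (2 * pi)) * norm_lam \<omega> lam f" if f: "E_lam \<omega> lam f" for f
    proof -
      have fE: "E_omega \<omega> f" using f lam unfolding E_omega_def by blast
      have "norm (f x) \<le> norm_lam \<omega> lam f * exp (lam * phi_star \<omega> 0)" for x
        using norm_pds_le [OF f, of "[]" x] by simp
      then have S: "norm (S f t) \<le> norm_lam \<omega> lam f * exp (lam * phi_star \<omega> 0)" for t
        unfolding S_def by (intro norm_slice_le E_omega_continuous fE)
      have "norm (\<mu> f) \<le> (M * (norm_lam \<omega> lam f * exp (lam * phi_star \<omega> 0))) * (2 * pi - 0)"
        unfolding \<mu>_def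
      proof (rule integral_bound)
        show "continuous_on {0..2 * pi} (\<lambda>t. fib.E \<xi> t * S f t)"
          by (intro continuous_intros Sc fE continuous_on_subset [OF fib.E_cont]) simp
        show "norm (fib.E \<xi> t * S f t) \<le> M * (norm_lam \<omega> lam f * exp (lam * phi_star \<omega> 0))" if "t \<in> {0..2*pi}" for t
          unfolding norm_mult using M(2) [OF that] S [of t] M(1) by (intro mult_mono) auto
      qed simp
      then show ?thesis by (simp add: mult_ac)
    qed
    then show "\<exists>C. \<forall>f. E_lam \<omega> (1 / real k) f \<longrightarrow> cmod (\<mu> f) \<le> C * norm_lam \<omega> (1 / real k) f"
      unfolding lam_def by blast
  qed
  moreover have "\<mu> (L_op a b g) = 0" if g: "E_omega \<omega> g" for g
  proof -
    obtain C \<epsilon> c where c: "\<epsilon> > 0" "decay C \<epsilon> c" "g = tser c" "rapid c" using g by (rule E_omegaE)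
    obtain e where e: "L_op a b (tser c) = tser e" "rapid e" "ode (symb a b \<xi>) (fser (\<lambda>\<tau>. e (mk \<tau> \<xi>))) (fser (\<lambda>\<tau>. c (mk \<tau> \<xi>)))"
      using E_omega_L_op_tser [of c] g c by metis
    \<comment> \<open>The boundary terms over a period carry the factor \<open>z - 1\<close>, which
      is zero, so \<open>\<mu>\<close> annihilates the range of the operator.\<close>
    have "((\<lambda>t. fib.E \<xi> t * fser (\<lambda>\<tau>. e (mk \<tau> \<xi>)) t) has_integral 0) {0..0 + 2 * pi}"
      using fib.ode_integral_period [of \<xi> _ _ 0, unfolded fib_c, OF e(3)] z by simp
    then show ?thesis by (simp add: \<mu>_def c e St integral_unique)
  qed
  ultimately have "\<mu> (tser d) = 0" by (rule ann)
  then have "integral {0..2*pi} (\<lambda>t. fib.E \<xi> t * fser (\<lambda>\<tau>. d (mk \<tau> \<xi>)) t) = 0"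
    by (simp add: \<mu>_def St d)
  then show ?thesis using integrable_integral [OF int [OF d(1)]] by (simp add: St d)
qed

lemma abs_\<alpha>m_le: "\<exists>R\<ge>0. \<forall>\<xi>. \<bar>\<alpha>m \<xi>\<bar> \<le> R * l1 \<xi>"
proof -
  define R where "R = (\<Sum>j\<in>UNIV. \<bar>mean (a j)\<bar>)"
  have "\<bar>\<alpha>m \<xi>\<bar> \<le> R * l1 \<xi>" for \<xi>
  proof -
    have "\<bar>\<alpha>m \<xi>\<bar> \<le> (\<Sum>j\<in>UNIV. \<bar>real_of_int (\<xi> j)\<bar> * \<bar>mean (a j)\<bar>)"
      unfolding \<alpha>m_def by (rule order_trans [OF sum_abs]) (simp add: abs_mult)
    also have "\<dots> \<le> (\<Sum>j\<in>UNIV. l1 \<xi> * \<bar>mean (a j)\<bar>)"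
      by (intro sum_mono mult_right_mono l1_ge_coord) auto
    finally show ?thesis by (simp add: R_def sum_distrib_left mult.commute)
  qed
  moreover have "R \<ge> 0" by (simp add: R_def sum_nonneg)
  ultimately show ?thesis by blast
qed

lemma euclid_le_l1: "sqrt (real_of_int \<tau> ^ 2 + (\<Sum>j\<in>UNIV. real_of_int (\<xi> j) ^ 2)) \<le> \<bar>real_of_int \<tau>\<bar> + l1 \<xi>"
  for \<xi> :: "'n \<Rightarrow> int"
proof -
  have "(\<Sum>j\<in>UNIV. real_of_int (\<xi> j) ^ 2) \<le> (\<Sum>j\<in>UNIV. \<bar>real_of_int (\<xi> j)\<bar> * l1 \<xi>)"
    by (rule sum_mono) (metis abs_ge_zero l1_ge_coord mult_left_mono power2_abs power2_eq_square)
  also have "\<dots> = (l1 \<xi>)\<^sup>2" by (simp add: l1_def power2_eq_square sum_distrib_right)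
  finally have "real_of_int \<tau> ^ 2 + (\<Sum>j\<in>UNIV. real_of_int (\<xi> j) ^ 2) \<le> (\<bar>real_of_int \<tau>\<bar> + l1 \<xi>)\<^sup>2"
    by (simp add: power2_sum add_increasing2)
  then show ?thesis by (simp add: real_le_lsqrt add_nonneg_nonneg real_sqrt_le_iff' sum_nonneg)
qed

text \<open>The relevant \<open>\<tau>\<close> is at most
  \<open>\<bar>\<alpha>m \<xi>\<bar> + 1\<close> in modulus, so the full frequency is bounded
  linearly by \<open>l1 \<xi> + 1\<close> and \<open>EDC2\<close> becomes a bound in \<xi> alone.
  The sign of \<open>\<beta>m \<xi>\<close> selects \<open>z\<close> or its inverse, whichever has
  modulus at most 1.\<close>

lemma small_divisor_bound:
  assumes "EDC2 \<omega> (\<lambda>j. mean (a j)) (\<lambda>j. mean (b j))" "\<epsilon> > 0"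
  shows "\<exists>C>0. \<forall>\<xi>. fib.z \<xi> \<noteq> 1 \<longrightarrow> (\<beta>m \<xi> \<ge> 0 \<longrightarrow> C * exp (- \<epsilon> * \<omega> (l1 \<xi>)) \<le> norm (fib.z \<xi> - 1))
     \<and> (\<beta>m \<xi> \<le> 0 \<longrightarrow> C * exp (- \<epsilon> * \<omega> (l1 \<xi>)) \<le> norm (inverse (fib.z \<xi>) - 1))"
proof -
  obtain R where R: "R \<ge> 0" "\<And>\<xi>. \<bar>\<alpha>m \<xi>\<bar> \<le> R * l1 \<xi>" using abs_\<alpha>m_le by blast
  \<comment> \<open>\<open>R + 2\<close> is the constant of \<open>w_scale\<close> for the factor
    \<open>R + 1\<close> between the norm of \<open>(\<tau>, \<xi>)\<close> and
    \<open>l1 \<xi> + 1\<close>.\<close>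
  define e where "e = \<epsilon> / (R + 2)"
  have e: "e > 0" using R assms(2) by (simp add: e_def)
  obtain C where "C > 0" and C0: "\<And>(\<tau>::int) \<xi>. let z = of_int \<tau> + wm \<xi> in z \<noteq> 0 \<longrightarrow>
      C * exp (- e * \<omega> (sqrt (real_of_int \<tau>^2 + (\<Sum>j\<in>UNIV. real_of_int (\<xi> j)^2)))) \<le> norm z"
    using assms(1) [unfolded EDC2_def, rule_format, OF e] unfolding wm_eq by blast
  have C: "C > 0" "\<And>(\<tau>::int) \<xi>. of_int \<tau> + wm \<xi> \<noteq> 0 \<Longrightarrow>
      C * exp (- e * \<omega> (sqrt (real_of_int \<tau>^2 + (\<Sum>j\<in>UNIV. real_of_int (\<xi> j)^2)))) \<le> norm (of_int \<tau> + wm \<xi>)"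
    using C0 \<open>C > 0\<close> by (auto simp: Let_def)
  define C' where "C' = min 1 C * exp (- \<epsilon> * \<omega> 1) / 3"
  have bound: "C' * exp (- \<epsilon> * \<omega> (l1 \<xi>)) \<le> min 1 (norm (wm \<xi> + of_int \<tau>)) / 3"
    if "wm \<xi> + of_int \<tau> \<noteq> 0" "\<bar>real_of_int \<tau>\<bar> \<le> \<bar>\<alpha>m \<xi>\<bar> + 1" for \<xi> \<tau>
  proof -
    have "\<omega> (sqrt (real_of_int \<tau>^2 + (\<Sum>j\<in>UNIV. real_of_int (\<xi> j)^2))) \<le> \<omega> ((R + 1) * (l1 \<xi> + 1))"
    proof (rule w_mono)
      have "\<bar>real_of_int \<tau>\<bar> + l1 \<xi> \<le> (R + 1) * (l1 \<xi> + 1)"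
        using that(2) R(2) [of \<xi>] R(1) by (simp add: algebra_simps)
      then show "sqrt (real_of_int \<tau>^2 + (\<Sum>j\<in>UNIV. real_of_int (\<xi> j)^2)) \<le> (R + 1) * (l1 \<xi> + 1)"
        using euclid_le_l1 order_trans by blast
    qed (simp add: sum_nonneg)
    also have "\<dots> \<le> (R + 2) * \<omega> (l1 \<xi> + 1)" using w_scale [of "R + 1" "l1 \<xi> + 1"] R by (simp add: add.commute [of 2])
    also have "\<dots> \<le> (R + 2) * (\<omega> (l1 \<xi>) + \<omega> 1)" using R by (intro mult_left_mono w_add) auto
    finally have "e * \<omega> (sqrt (real_of_int \<tau>^2 + (\<Sum>j\<in>UNIV. real_of_int (\<xi> j)^2))) \<le> e * ((R + 2) * (\<omega> (l1 \<xi>) + \<omega> 1))"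
      using e by simp
    also have "\<dots> = \<epsilon> * (\<omega> (l1 \<xi>) + \<omega> 1)" using R by (simp add: e_def)
    finally have "exp (- \<epsilon> * (\<omega> (l1 \<xi>) + \<omega> 1)) \<le> exp (- e * \<omega> (sqrt (real_of_int \<tau>^2 + (\<Sum>j\<in>UNIV. real_of_int (\<xi> j)^2))))"
      by simp
    then have "C * exp (- \<epsilon> * (\<omega> (l1 \<xi>) + \<omega> 1)) \<le> norm (wm \<xi> + of_int \<tau>)"
      using C(2) [of \<tau> \<xi>] that(1) C(1) by (auto simp: add.commute [of "wm \<xi>"] elim!: order_trans [rotated] intro!: mult_left_mono)
    moreover have "exp (- \<epsilon> * (\<omega> (l1 \<xi>) + \<omega> 1)) \<le> 1"
      using assms(2) w_nonneg [of "l1 \<xi>"] w_nonneg [of 1] by simp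
    moreover have "min 1 C * exp (- \<epsilon> * (\<omega> (l1 \<xi>) + \<omega> 1)) \<le> C * exp (- \<epsilon> * (\<omega> (l1 \<xi>) + \<omega> 1))"
      "min 1 C * exp (- \<epsilon> * (\<omega> (l1 \<xi>) + \<omega> 1)) \<le> 1 * exp (- \<epsilon> * (\<omega> (l1 \<xi>) + \<omega> 1))"
      by (intro mult_right_mono; simp)+
    ultimately have "min 1 C * exp (- \<epsilon> * (\<omega> (l1 \<xi>) + \<omega> 1)) \<le> min 1 (norm (wm \<xi> + of_int \<tau>))"
      unfolding min.bounded_iff by linarith
    moreover have "exp (- \<epsilon> * (\<omega> (l1 \<xi>) + \<omega> 1)) = exp (- \<epsilon> * \<omega> 1) * exp (- \<epsilon> * \<omega> (l1 \<xi>))"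
      by (simp add: exp_add [symmetric] algebra_simps)
    ultimately show ?thesis by (simp add: C'_def)
  qed
  have nz: "wm \<xi> + of_int \<tau> \<noteq> 0" if "fib.z \<xi> \<noteq> 1" for \<xi> \<tau>
  proof
    assume "wm \<xi> + of_int \<tau> = 0"
    then have "wm \<xi> = of_int (- \<tau>)" by (simp add: eq_neg_iff_add_eq_0)
    then have "\<alpha>m \<xi> = of_int (- \<tau>)" "\<beta>m \<xi> = 0" by (auto simp: wm_def complex_eq_iff)
    then show False using that unfolding fib_z_eq_1_iff by (metis Ints_of_int)
  qed
  have "C' > 0" using C(1) by (simp add: C'_def)
  moreover have "C' * exp (- \<epsilon> * \<omega> (l1 \<xi>)) \<le> norm (fib.z \<xi> - 1)" if nr: "fib.z \<xi> \<noteq> 1" and sg: "\<beta>m \<xi> \<ge> 0" for \<xi>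
  proof -
    obtain \<tau> :: int where \<tau>: "\<bar>real_of_int \<tau>\<bar> \<le> \<bar>\<alpha>m \<xi>\<bar> + 1" "min 1 (norm (wm \<xi> + of_int \<tau>)) / 3 \<le> norm (fib.z \<xi> - 1)"
      using exp_minus_one_lower_bound [of "wm \<xi>"] sg unfolding fib_z by (auto simp: wm_def)
    then show ?thesis using bound [OF nz [OF nr] \<tau>(1)] by linarith
  qed
  moreover have "C' * exp (- \<epsilon> * \<omega> (l1 \<xi>)) \<le> norm (inverse (fib.z \<xi>) - 1)" if nr: "fib.z \<xi> \<noteq> 1" and sg: "\<beta>m \<xi> \<le> 0" for \<xi>
  proof -
    have "inverse (fib.z \<xi>) = exp (2 * pi * \<i> * (- wm \<xi>))" by (simp add: fib_z exp_minus [symmetric])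
    then obtain \<tau> :: int where \<tau>: "\<bar>real_of_int \<tau>\<bar> \<le> \<bar>\<alpha>m \<xi>\<bar> + 1" "min 1 (norm (- wm \<xi> + of_int \<tau>)) / 3 \<le> norm (inverse (fib.z \<xi>) - 1)"
      using exp_minus_one_lower_bound [of "- wm \<xi>"] sg by (auto simp: wm_def)
    moreover have "norm (- wm \<xi> + of_int \<tau>) = norm (wm \<xi> + of_int (- \<tau>))"
      by (metis add_uminus_conv_diff minus_diff_eq norm_minus_cancel of_int_minus uminus_add_conv_diff)
    moreover have "C' * exp (- \<epsilon> * \<omega> (l1 \<xi>)) \<le> min 1 (norm (wm \<xi> + of_int (- \<tau>))) / 3"
      by (rule bound [OF nz [OF nr]]) (use \<tau>(1) in simp)
    ultimately show ?thesis by linarith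
  qed
  ultimately show ?thesis by blast
qed

section \<open>Sufficiency\<close>

lemma \<beta>m_sign:
  shows "(\<And>t. dot \<xi> b t \<ge> 0) \<Longrightarrow> \<beta>m \<xi> \<ge> 0" and "(\<And>t. dot \<xi> b t \<le> 0) \<Longrightarrow> \<beta>m \<xi> \<le> 0"
proof -
  have *: "2 * pi * \<beta>m \<xi> = Bp \<xi> (2 * pi) - Bp \<xi> 0" using fib.B_per [of \<xi> 0] by simp
  show "\<beta>m \<xi> \<ge> 0" if "\<And>t. dot \<xi> b t \<ge> 0"
    using fib.B_diff_le [of 0 \<xi> 0 "2 * pi"] that * mult_pos_neg [of "2 * pi" "\<beta>m \<xi>"] by fastforce
  show "\<beta>m \<xi> \<le> 0" if "\<And>t. dot \<xi> b t \<le> 0"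
    using fib.B_diff_ge [of \<xi> 0 0 "2 * pi"] that * mult_pos_pos [of "2 * pi" "\<beta>m \<xi>"] by fastforce
qed

text \<open>Vanishing mean makes the primitive periodic, so the image on the circle does not depend
  on the fundamental interval; the base point 0 shifts the level by
  \<open>Bp \<xi> 0\<close>.\<close>

lemma Omega_set_eq:
  assumes "\<beta>m \<xi> = 0"
  shows "Omega_set b \<xi> r = cis ` {t. Bp \<xi> t < r + Bp \<xi> 0}"
proof -
  have "integral {0..t} (\<lambda>\<tau>. \<Sum>j\<in>UNIV. of_int (\<xi> j) * b j \<tau>) = Bp \<xi> t - Bp \<xi> 0" if "t \<ge> 0" for t
    using has_integral_FTC [OF fib.B [of \<xi>] that] by (simp add: dot_def [abs_def] integral_unique)
  then have "{t \<in> {0..2*pi}. integral {0..t} (\<lambda>\<tau>. \<Sum>j\<in>UNIV. of_int (\<xi> j) * b j \<tau>) < r}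
     = {t \<in> {0..2*pi}. Bp \<xi> t < r + Bp \<xi> 0}" by auto
  then show ?thesis
    unfolding Omega_set_def by (simp only:) (rule circle_image_period, simp add: fib.B_per assms)
qed

lemma not_changes_sign: "\<not> changes_sign g \<Longrightarrow> (\<forall>t. g t \<ge> 0) \<or> (\<forall>t. g t \<le> 0)"
  unfolding changes_sign_def by (meson not_le)

text \<open>Without a sign change \<open>Bp \<xi>\<close> is monotone and periodic, hence constant,
  so its sublevel sets are empty or everything and connectedness is automatic.\<close>

lemma path_above:
  assumes "\<beta>m \<xi> = 0" "changes_sign (dot \<xi> b) \<Longrightarrow> \<forall>r. connected (Omega_set b \<xi> r)"
  shows "\<exists>t0. \<forall>t. \<exists>m::int. let t1 = t0 + of_int m * (2 * pi) in
     \<bar>t - t1\<bar> \<le> 2 * pi \<and> (\<forall>s. min t t1 \<le> s \<longrightarrow> s \<le> max t t1 \<longrightarrow> Bp \<xi> t \<le> Bp \<xi> s)"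
proof (rule connected_sublevel_imp_path [OF fib.B_cont])
  show per: "Bp \<xi> (t + 2 * pi) = Bp \<xi> t" for t by (simp add: fib.B_per assms)
  show "connected (cis ` {t. Bp \<xi> t < r})" for r
  proof (cases "changes_sign (dot \<xi> b)")
    case True
    have "connected (Omega_set b \<xi> (r - Bp \<xi> 0))" using assms(2) [OF True] by blast
    then show ?thesis unfolding Omega_set_eq [OF assms(1)] by simp
  next
    case False
    have const: "Bp \<xi> s = Bp \<xi> t" if "s \<le> t" for s t
    proof -
      define m where "m = \<lceil>(t - s) / (2 * pi)\<rceil>"
      have "(t - s) / (2 * pi) \<le> m" unfolding m_def by (rule le_of_int_ceiling)
      then have t: "t \<le> s + of_int m * (2 * pi)" by (simp add: field_simps)
      have "Bp \<xi> (s + of_int m * (2 * pi)) = Bp \<xi> s" by (rule periodic_int_mult [of "Bp \<xi>", OF per])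
      moreover have "(Bp \<xi> s \<le> Bp \<xi> t \<and> Bp \<xi> t \<le> Bp \<xi> (s + of_int m * (2 * pi))) \<or> (Bp \<xi> s \<ge> Bp \<xi> t \<and> Bp \<xi> t \<ge> Bp \<xi> (s + of_int m * (2 * pi)))"
        using not_changes_sign [OF False] fib.B_diff_le [of 0 \<xi>] fib.B_diff_ge [of \<xi> 0] that t by auto
      ultimately show ?thesis by auto
    qed
    have "{t. Bp \<xi> t < r} = {} \<or> {t. Bp \<xi> t < r} = UNIV" using const by (metis (mono_tags, lifting) Collect_empty_eq UNIV_eq_I linear mem_Collect_eq)
    moreover have "connected (cis ` (UNIV::real set))" by (intro connected_continuous_image continuous_intros) auto
    ultimately show ?thesis by auto
  qed
qed

text \<open>The solution is made to vanish at the maximum point, so \<open>E * u\<close> at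
  \<open>t\<close> is its increment along the path alone. No small quantity is divided by, and the
  bound involves only \<open>F\<close>.\<close>

lemma resonant_solution:
  assumes z: "fib.z \<xi> = 1" and conn: "changes_sign (dot \<xi> b) \<Longrightarrow> \<forall>r. connected (Omega_set b \<xi> r)"
    and f: "continuous_on UNIV f" "\<And>t. f (t + 2 * pi) = f t" "\<And>t. norm (f t) \<le> F"
    and comp: "((\<lambda>t. fib.E \<xi> t * f t) has_integral 0) {0..0 + 2 * pi}"
  shows "\<exists>u. ode (symb a b \<xi>) f u \<and> (\<forall>t. norm (u t) \<le> 2 * pi * F)"
proof -
  have "\<beta>m \<xi> = 0" using z by (simp add: fib_z_eq_1_iff)
  then obtain t0 where t0: "\<And>t. \<exists>m::int. let t1 = t0 + of_int m * (2 * pi) in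
     \<bar>t - t1\<bar> \<le> 2 * pi \<and> (\<forall>s. min t t1 \<le> s \<longrightarrow> s \<le> max t t1 \<longrightarrow> Bp \<xi> t \<le> Bp \<xi> s)"
    using path_above [OF _ conn] by blast
  obtain u where u: "ode (fib.c \<xi>) f u" "u t0 = 0"
    using fib.ode_exists_resonant [OF z f(1,2) comp, of t0] by blast
  have "norm (u t) \<le> 2 * pi * F" for t
  proof -
    obtain m :: int where m: "\<bar>t - (t0 + of_int m * (2 * pi))\<bar> \<le> 2 * pi"
      "\<And>s. min t (t0 + of_int m * (2 * pi)) \<le> s \<Longrightarrow> s \<le> max t (t0 + of_int m * (2 * pi)) \<Longrightarrow> Bp \<xi> t \<le> Bp \<xi> s"
      using t0 [of t] unfolding Let_def by blast
    define t1 where "t1 = t0 + of_int m * (2 * pi)"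
    have u1: "u t1 = 0" unfolding t1_def using u by (subst periodic_int_mult [of u]) (auto simp: ode_def)
    have "norm (fib.E \<xi> t * u t) \<le> 2 * pi * F * exp (- Bp \<xi> t)"
    proof (cases "t1 \<le> t")
      case True
      then have "norm (fib.E \<xi> t * u t - fib.E \<xi> t1 * u t1) \<le> 2 * pi * F * exp (- Bp \<xi> t)"
        using m by (intro fib.norm_ode_le_path [OF u(1) _ f(3)]) (auto simp: t1_def)
      then show ?thesis by (simp add: u1)
    next
      case False
      then have "norm (fib.E \<xi> t1 * u t1 - fib.E \<xi> t * u t) \<le> 2 * pi * F * exp (- Bp \<xi> t)"
        using m by (intro fib.norm_ode_le_path [OF u(1) _ f(3)]) (auto simp: t1_def)
      then show ?thesis by (simp add: u1)
    qed
    then show ?thesis by (simp add: norm_mult fib.norm_E mult.commute)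
  qed
  then show ?thesis using u(1) by (auto simp: fib_c)
qed

text \<open>Without a sign change the integration can be directed so that the kernel is bounded by \<open>1\<close>.\<close>

lemma nonresonant_solution:
  assumes z: "fib.z \<xi> \<noteq> 1" and sign: "\<not> changes_sign (dot \<xi> b)" and "\<kappa> > 0"
    and \<kappa>: "\<beta>m \<xi> \<ge> 0 \<Longrightarrow> \<kappa> \<le> norm (fib.z \<xi> - 1)" "\<beta>m \<xi> \<le> 0 \<Longrightarrow> \<kappa> \<le> norm (inverse (fib.z \<xi>) - 1)"
    and f: "continuous_on UNIV f" "\<And>t. f (t + 2 * pi) = f t" "\<And>t. norm (f t) \<le> F"
  shows "\<exists>u. ode (symb a b \<xi>) f u \<and> (\<forall>t. norm (u t) \<le> 2 * pi * F / \<kappa>)"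
proof -
  obtain u where u: "ode (fib.c \<xi>) f u" using fib.ode_exists_nonresonant [OF z f(1,2)] by blast
  have "norm (u t) * \<kappa> \<le> 2 * pi * F" for t
    using not_changes_sign [OF sign]
  proof
    assume b: "\<forall>t. dot \<xi> b t \<ge> 0"
    have "norm (u t) * \<kappa> \<le> norm (u t) * norm (fib.z \<xi> - 1)" using \<kappa>(1) \<beta>m_sign(1) b by (intro mult_left_mono) auto
    also have "\<dots> \<le> 2 * pi * F" by (rule fib.norm_ode_le_nonneg [OF u f(3)]) (use b in auto)
    finally show ?thesis .
  next
    assume b: "\<forall>t. dot \<xi> b t \<le> 0"
    have "norm (u t) * \<kappa> \<le> norm (u t) * norm (inverse (fib.z \<xi>) - 1)" using \<kappa>(2) \<beta>m_sign(2) b by (intro mult_left_mono) auto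
    also have "\<dots> \<le> 2 * pi * F" by (rule fib.norm_ode_le_nonpos [OF u f(3)]) (use b in auto)
    finally show ?thesis .
  qed
  then show ?thesis using u \<open>\<kappa> > 0\<close> by (auto simp: fib_c field_simps)
qed

text \<open>Fibre solutions decaying in \<xi> need decay in \<tau> as well before they form an
  admissible series on the torus. The regularity estimate supplies it at the price of part of the
  decay in \<xi>.\<close>

lemma E_omega_of_slices:
  assumes d: "decay D \<epsilon> d" "\<epsilon> > 0"
    and u: "\<And>\<xi>. ode (symb a b \<xi>) (fser (\<lambda>\<tau>. d (mk \<tau> \<xi>))) (u \<xi>)" and U: "\<And>\<xi> t. norm (u \<xi> t) \<le> C * exp (- \<epsilon> * \<omega> (l1 \<xi>))"
  shows "\<exists>g. E_omega \<omega> g \<and> L_op a b g = tser d"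
proof -
  obtain D0 \<delta>0 h where h: "\<delta>0 > 0" "D0 \<ge> 0" "\<And>\<xi>. decay_int (l1 \<xi> * D0) \<delta>0 (h \<xi>)" "\<And>\<xi>. fser (h \<xi>) = symb a b \<xi>"
    using symbol_series by blast
  define \<delta> where "\<delta> = min \<delta>0 (\<epsilon> / 2)"
  have \<delta>: "\<delta> > 0" using h d by (simp add: \<delta>_def)
  obtain K where K: "K \<ge> 1" and reg: "\<And>\<eta> Q ch fh G U u. 0 < \<eta> \<Longrightarrow> \<eta> \<le> \<delta> / 2 \<Longrightarrow> Q \<ge> 1 \<Longrightarrow> decay_int (Q * D0) \<delta> ch \<Longrightarrow> decay_int G \<delta> fh
    \<Longrightarrow> ode (fser ch) (fser fh) u \<Longrightarrow> (\<forall>t. norm (u t) \<le> U) \<Longrightarrow> decay_int (2 * (G + U * exp (\<eta> * K * \<omega> Q))) \<eta> (fcoef u)"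
    using uniform_coefficient_decay [OF \<delta>, of D0] by blast
  \<comment> \<open>The first entry is the range of the regularity estimate; the second gives
    \<open>\<eta> * K \<le> \<epsilon> / 2\<close>, the share of the exponent granted to its
    loss.\<close>
  define \<eta> where "\<eta> = min (\<delta> / 2) (\<epsilon> / (2 * K))"
  have \<eta>: "0 < \<eta>" "\<eta> \<le> \<delta> / 2" "\<eta> * K \<le> \<epsilon> / 2" "\<eta> \<le> \<epsilon> / 2"
    using \<delta> K d(2) by (auto simp: \<eta>_def min_def field_simps \<delta>_def)
  have C: "C \<ge> 0"
  proof -
    have "0 \<le> C * exp (- \<epsilon> * \<omega> (l1 (\<lambda>_::'n. 0)))" using U norm_ge_zero order_trans by blast
    then show ?thesis by (simp add: zero_le_mult_iff)
  qed
  have D: "D \<ge> 0" using decay_nonneg [OF d(1)] .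
  define c where "c k = fcoef (u (\<lambda>j. k (Some j))) (k None)" for k
  have cmk: "(\<lambda>\<tau>. c (mk \<tau> \<xi>)) = fcoef (u \<xi>)" for \<xi> by (simp add: c_def)
  define C' where "C' = 2 * (D + C * exp (\<epsilon> / 2 * \<omega> 1))"
  have "decay_int (C' * exp (- \<eta> * \<omega> (l1 \<xi>))) \<eta> (fcoef (u \<xi>))" for \<xi>
  proof -
    have "decay_int (2 * (D * exp (- (\<epsilon> / 2) * \<omega> (l1 \<xi>)) + C * exp (- \<epsilon> * \<omega> (l1 \<xi>)) * exp (\<eta> * K * \<omega> (l1 \<xi> + 1)))) \<eta> (fcoef (u \<xi>))"
    proof (rule reg [OF \<eta>(1,2)])
      \<comment> \<open>\<open>Q\<close> is \<open>l1 \<xi> + 1\<close> because the estimate asks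
        for \<open>Q \<ge> 1\<close> even at frequency 0.\<close>
      show "1 \<le> l1 \<xi> + 1" by simp
      show "decay_int ((l1 \<xi> + 1) * D0) \<delta> (h \<xi>)"
        by (rule decay_int_mono [OF h(3)]) (use h in \<open>auto simp: \<delta>_def intro: mult_right_mono\<close>)
      show "decay_int (D * exp (- (\<epsilon> / 2) * \<omega> (l1 \<xi>))) \<delta> (\<lambda>\<tau>. d (mk \<tau> \<xi>))"
        by (rule decay_int_mono [OF decay_slice [OF d]]) (auto simp: \<delta>_def)
    qed (use u U in \<open>auto simp: h\<close>)
    then show ?thesis
    proof (rule decay_int_mono)
      have "\<eta> * K * \<omega> (l1 \<xi> + 1) \<le> \<epsilon> / 2 * (\<omega> (l1 \<xi>) + \<omega> 1)"
        using \<eta> K d(2) w_nonneg [of "l1 \<xi> + 1"] by (intro mult_mono w_add) auto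
      then have "exp (- \<epsilon> * \<omega> (l1 \<xi>)) * exp (\<eta> * K * \<omega> (l1 \<xi> + 1)) \<le> exp (\<epsilon> / 2 * \<omega> 1) * exp (- (\<epsilon> / 2) * \<omega> (l1 \<xi>))"
        unfolding exp_add [symmetric] by (simp add: algebra_simps)
      then have "C * exp (- \<epsilon> * \<omega> (l1 \<xi>)) * exp (\<eta> * K * \<omega> (l1 \<xi> + 1)) \<le> C * exp (\<epsilon> / 2 * \<omega> 1) * exp (- (\<epsilon> / 2) * \<omega> (l1 \<xi>))"
        using C by (simp add: mult.assoc mult_left_mono)
      then have "2 * (D * exp (- (\<epsilon> / 2) * \<omega> (l1 \<xi>)) + C * exp (- \<epsilon> * \<omega> (l1 \<xi>)) * exp (\<eta> * K * \<omega> (l1 \<xi> + 1))) \<le> C' * exp (- (\<epsilon> / 2) * \<omega> (l1 \<xi>))"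
        by (simp add: C'_def algebra_simps)
      also have "\<dots> \<le> C' * exp (- \<eta> * \<omega> (l1 \<xi>))"
      proof (rule mult_left_mono)
        show "exp (- (\<epsilon> / 2) * \<omega> (l1 \<xi>)) \<le> exp (- \<eta> * \<omega> (l1 \<xi>))"
          using mult_right_mono [OF \<eta>(4) w_nonneg [of "l1 \<xi>"]] by simp
      qed (use C D in \<open>simp add: C'_def\<close>)
      finally show "2 * (D * exp (- (\<epsilon> / 2) * \<omega> (l1 \<xi>)) + C * exp (- \<epsilon> * \<omega> (l1 \<xi>)) * exp (\<eta> * K * \<omega> (l1 \<xi> + 1))) \<le> C' * exp (- \<eta> * \<omega> (l1 \<xi>))" .
    qed simp
  qed
  then have c: "decay C' \<eta> c" by (intro decay_unslice \<eta>(1)) (simp only: cmk)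
  have rc: "rapid c" by (rule decay_rapid [OF c \<eta>(1)])
  have "fser (fcoef (u \<xi>)) = u \<xi>" for \<xi>
  proof (rule fser_fcoef)
    show "continuous_on UNIV (u \<xi>)"
      using u [of \<xi>] unfolding ode_def by (metis continuous_at_imp_continuous_on has_vector_derivative_continuous)
    show "u \<xi> (t + 2 * pi) = u \<xi> t" for t using u [of \<xi>] by (simp add: ode_def)
    show "(\<lambda>n. norm (fcoef (u \<xi>) n)) summable_on UNIV" using rapid_mk(2) [OF rc, of \<xi>] by (simp add: c_def)
  qed
  then have "L_op a b (tser c) = tser d"
    by (intro L_op_of_ode rc rapid_summable decay_rapid [OF d] a_cont b_cont a_per b_per) (simp only: cmk u)
  then show ?thesis using tser_E_omega [OF c \<eta>(1)] by blast
qed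

lemma solvable_of_conditions:
  assumes sign: "\<And>\<xi>. changes_sign (dot \<xi> b) \<Longrightarrow> \<beta>m \<xi> = 0 \<and> \<alpha>m \<xi> \<in> \<int> \<and> (\<forall>r. connected (Omega_set b \<xi> r))"
    and edc: "EDC2 \<omega> (\<lambda>j. mean (a j)) (\<lambda>j. mean (b j))"
  shows "globally_solvable \<omega> (L_op a b)"
  unfolding globally_solvable_def
proof (intro equalityI subsetI)
  fix f assume "f \<in> {L_op a b g |g. E_omega \<omega> g}"
  then show "f \<in> {f. E_omega \<omega> f \<and> (\<forall>\<mu>. E_dual \<omega> \<mu> \<longrightarrow> (\<forall>g. E_omega \<omega> g \<longrightarrow> \<mu> (L_op a b g) = 0) \<longrightarrow> \<mu> f = 0)}"
    by (auto simp: E_omega_L_op)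
next
  fix f assume "f \<in> {f. E_omega \<omega> f \<and> (\<forall>\<mu>. E_dual \<omega> \<mu> \<longrightarrow> (\<forall>g. E_omega \<omega> g \<longrightarrow> \<mu> (L_op a b g) = 0) \<longrightarrow> \<mu> f = 0)}"
  then have fE: "E_omega \<omega> f" and ann: "\<And>\<mu>. E_dual \<omega> \<mu> \<Longrightarrow> (\<And>g. E_omega \<omega> g \<Longrightarrow> \<mu> (L_op a b g) = 0) \<Longrightarrow> \<mu> f = 0"
    by auto
  obtain D \<epsilon> d where d: "\<epsilon> > 0" "decay D \<epsilon> d" "f = tser d" "rapid d" using fE by (rule E_omegaE)
  \<comment> \<open>Slices of \<open>f\<close> decay with exponent
    \<open>\<epsilon> / 2 = 2 * \<epsilon>'\<close>: one share of \<open>\<epsilon>'\<close> is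
    spent on the small divisor, the other remains for the solution.\<close>
  define \<epsilon>' where "\<epsilon>' = \<epsilon> / 4"
  have \<epsilon>': "\<epsilon>' > 0" using d by (simp add: \<epsilon>'_def)
  obtain C0 where C0: "C0 > 0" and sd: "\<And>\<xi>. fib.z \<xi> \<noteq> 1 \<Longrightarrow> \<beta>m \<xi> \<ge> 0 \<Longrightarrow> C0 * exp (- \<epsilon>' * \<omega> (l1 \<xi>)) \<le> norm (fib.z \<xi> - 1)"
     "\<And>\<xi>. fib.z \<xi> \<noteq> 1 \<Longrightarrow> \<beta>m \<xi> \<le> 0 \<Longrightarrow> C0 * exp (- \<epsilon>' * \<omega> (l1 \<xi>)) \<le> norm (inverse (fib.z \<xi>) - 1)"
    using small_divisor_bound [OF edc \<epsilon>'] by blast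
  define F where "F \<xi> = D * isum (\<epsilon> / 2) * exp (- (2 * \<epsilon>') * \<omega> (l1 \<xi>))" for \<xi> :: "'n \<Rightarrow> int"
  define C where "C = 2 * pi * (D * isum (\<epsilon> / 2)) * (1 + 1 / C0)"
  have DI: "D * isum (\<epsilon> / 2) \<ge> 0" using decay_nonneg [OF d(2)] isum_nonneg by simp
  have "\<exists>u. ode (symb a b \<xi>) (fser (\<lambda>\<tau>. d (mk \<tau> \<xi>))) u \<and> (\<forall>t. norm (u t) \<le> C * exp (- \<epsilon>' * \<omega> (l1 \<xi>)))" for \<xi>
  proof -
    let ?f = "fser (\<lambda>\<tau>. d (mk \<tau> \<xi>))"
    have f: "continuous_on UNIV ?f" "\<And>t. ?f (t + 2 * pi) = ?f t" "\<And>t. norm (?f t) \<le> F \<xi>"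
    proof -
      show "continuous_on UNIV ?f" by (rule fser_continuous [OF rapid_mk(2) [OF d(4)]])
      show "?f (t + 2 * pi) = ?f t" for t by (rule fser_periodic)
      show "norm (?f t) \<le> F \<xi>" for t
        using norm_fser_le [OF decay_slice [OF d(2,1), of \<xi>], of t] d(1) by (simp add: F_def \<epsilon>'_def mult_ac)
    qed
    have F1: "2 * pi * F \<xi> \<le> C * exp (- \<epsilon>' * \<omega> (l1 \<xi>))" and F2: "2 * pi * F \<xi> / (C0 * exp (- \<epsilon>' * \<omega> (l1 \<xi>))) \<le> C * exp (- \<epsilon>' * \<omega> (l1 \<xi>))"
    proof -
      have e: "exp (- (2 * \<epsilon>') * \<omega> (l1 \<xi>)) = exp (- \<epsilon>' * \<omega> (l1 \<xi>)) * exp (- \<epsilon>' * \<omega> (l1 \<xi>))"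
        by (simp add: exp_add [symmetric])
      have e1: "exp (- \<epsilon>' * \<omega> (l1 \<xi>)) \<le> 1 + 1 / C0"
        by (rule order_trans [of _ 1]) (use \<epsilon>' C0 w_nonneg [of "l1 \<xi>"] in auto)
      have X: "2 * pi * F \<xi> = 2 * pi * (D * isum (\<epsilon> / 2)) * exp (- \<epsilon>' * \<omega> (l1 \<xi>)) * exp (- \<epsilon>' * \<omega> (l1 \<xi>))"
        unfolding F_def e by simp
      also have "\<dots> \<le> 2 * pi * (D * isum (\<epsilon> / 2)) * (1 + 1 / C0) * exp (- \<epsilon>' * \<omega> (l1 \<xi>))"
        using DI e1 by (intro mult_right_mono mult_left_mono) auto
      finally show "2 * pi * F \<xi> \<le> C * exp (- \<epsilon>' * \<omega> (l1 \<xi>))" by (simp add: C_def)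
      have "2 * pi * F \<xi> / (C0 * exp (- \<epsilon>' * \<omega> (l1 \<xi>))) = 2 * pi * (D * isum (\<epsilon> / 2)) * (1 / C0) * exp (- \<epsilon>' * \<omega> (l1 \<xi>))"
        unfolding X by simp
      also have "\<dots> \<le> C * exp (- \<epsilon>' * \<omega> (l1 \<xi>))"
        unfolding C_def using DI by (intro mult_right_mono mult_left_mono) auto
      finally show "2 * pi * F \<xi> / (C0 * exp (- \<epsilon>' * \<omega> (l1 \<xi>))) \<le> C * exp (- \<epsilon>' * \<omega> (l1 \<xi>))" .
    qed
    show ?thesis
    proof (cases "fib.z \<xi> = 1")
      case True
      have "((\<lambda>t. fib.E \<xi> t * ?f t) has_integral 0) {0..0 + 2 * pi}"
        by (rule annihilator_compatibility [OF True _ d(4)]) (use fE ann d(3) in auto)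
      then obtain u where "ode (symb a b \<xi>) ?f u" "\<And>t. norm (u t) \<le> 2 * pi * F \<xi>"
        using resonant_solution [OF True _ f] sign by blast
      then show ?thesis using F1 order_trans by blast
    next
      case False
      \<comment> \<open>A sign change would force resonance by the first condition, so nonresonant
        fibres have a definite direction of integration.\<close>
      then have "\<not> changes_sign (dot \<xi> b)" using sign [of \<xi>] by (auto simp: fib_z_eq_1_iff)
      then obtain u where "ode (symb a b \<xi>) ?f u" "\<And>t. norm (u t) \<le> 2 * pi * F \<xi> / (C0 * exp (- \<epsilon>' * \<omega> (l1 \<xi>)))"
        using nonresonant_solution [OF False _ _ sd [OF False] f] C0 by auto
      then show ?thesis using F2 order_trans by blast
    qed
  qed
  then obtain u where u: "\<And>\<xi>. ode (symb a b \<xi>) (fser (\<lambda>\<tau>. d (mk \<tau> \<xi>))) (u \<xi>)" "\<And>\<xi> t. norm (u \<xi> t) \<le> C * exp (- \<epsilon>' * \<omega> (l1 \<xi>))"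
    by metis
  have "decay D \<epsilon>' d" by (rule decay_mono [OF d(2)]) (use d(1) in \<open>auto simp: \<epsilon>'_def\<close>)
  from E_omega_of_slices [OF this \<epsilon>' u] show "f \<in> {L_op a b g |g. E_omega \<omega> g}"
    using d(3) by (metis (mono_tags, lifting) mem_Collect_eq)
qed

end

section \<open>Necessity\<close>

lemma finite_l1_ball: "finite {\<xi>::'n::finite \<Rightarrow> int. l1 \<xi> \<le> R}"
proof (rule finite_subset)
  show "{\<xi>::'n \<Rightarrow> int. l1 \<xi> \<le> R} \<subseteq> PiE UNIV (\<lambda>_. {-\<lceil>R\<rceil>..\<lceil>R\<rceil>})"
  proof
    fix \<xi> :: "'n \<Rightarrow> int" assume "\<xi> \<in> {\<xi>. l1 \<xi> \<le> R}"
    then have "\<bar>real_of_int (\<xi> j)\<bar> \<le> R" for j using l1_ge_coord [of \<xi> j] by simp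
    then have "- \<lceil>R\<rceil> \<le> \<xi> j \<and> \<xi> j \<le> \<lceil>R\<rceil>" for j by (smt (verit) le_of_int_ceiling of_int_le_iff of_int_minus)
    then show "\<xi> \<in> PiE UNIV (\<lambda>_. {-\<lceil>R\<rceil>..\<lceil>R\<rceil>})" by auto
  qed
qed (intro finite_PiE; simp)

text \<open>Attainment matters beyond boundedness: normalising at a maximum point gives homogeneous
  solutions whose modulus is exactly 1 there.\<close>

lemma periodic_bounded:
  fixes u :: "real \<Rightarrow> complex"
  assumes "continuous_on UNIV u" "\<And>t. u (t + 2 * pi) = u t"
  shows "\<exists>t0. \<forall>t. norm (u t) \<le> norm (u t0)"
proof -
  have "\<exists>x\<in>{0..2*pi}. \<forall>y\<in>{0..2*pi}. norm (u y) \<le> norm (u x)"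
    by (rule continuous_attains_sup) (auto intro!: continuous_intros continuous_on_subset [OF assms(1)])
  then obtain t0 where t0: "\<And>y. y \<in> {0..2*pi} \<Longrightarrow> norm (u y) \<le> norm (u t0)" by blast
  have "norm (u t) \<le> norm (u t0)" for t
  proof -
    have "t + of_int (- \<lfloor>t / (2 * pi)\<rfloor>) * (2 * pi) \<in> {0..2*pi}"
      using floor_divide_lower [of "2*pi" t] floor_divide_upper [of "2*pi" t] by (auto simp: algebra_simps)
    from t0 [OF this] show ?thesis by (simp only: periodic_int_mult [of u, OF assms(2)])
  qed
  then show ?thesis by blast
qed

lemma ode_continuous: "ode c f u \<Longrightarrow> continuous_on UNIV u"
  unfolding ode_def by (metis continuous_at_imp_continuous_on has_vector_derivative_continuous)

lemma fser_zero [simp]: "fser (\<lambda>_. 0) = (\<lambda>_. 0)"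
  by (simp add: fser_def [abs_def])

lemma fser_single: "fser (\<lambda>n. if n = 0 then \<mu> else 0) t = \<mu>"
proof -
  have "fser (\<lambda>n. if n = 0 then \<mu> else 0) t = (\<Sum>\<^sub>\<infinity>n\<in>{0}. (if n = 0 then \<mu> else 0) * cis (of_int n * t))"
    unfolding fser_def by (rule infsum_cong_neutral) auto
  then show ?thesis by simp
qed

text \<open>Laplace-type estimate: near \<open>s0\<close> the exponent stays \<open>\<kappa>\<close>
  below \<open>m\<close> and \<open>g\<close> above half its value, so one fixed small interval
  yields the rate for all \<open>k\<close> at once.\<close>

lemma exp_weighted_integral_lower_bound:
  fixes B g :: "real \<Rightarrow> real"
  assumes B: "continuous_on UNIV B" and g: "continuous_on UNIV g" "\<And>s. x \<le> s \<Longrightarrow> s \<le> y \<Longrightarrow> g s \<ge> 0"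
    and s0: "x < s0" "s0 < y" "g s0 > 0" "B s0 < m"
  shows "\<exists>c \<kappa>. c > 0 \<and> \<kappa> > 0 \<and> (\<forall>k::nat. c * exp (- real k * (m - \<kappa>)) \<le> integral {x..y} (\<lambda>s. exp (- real k * B s) * g s))"
proof -
  define \<kappa> where "\<kappa> = (m - B s0) / 2"
  have \<kappa>: "\<kappa> > 0" "B s0 < m - \<kappa>" using s0 by (auto simp: \<kappa>_def field_simps)
  have "open ({s. B s < m - \<kappa>} \<inter> {s. g s0 / 2 < g s} \<inter> {x<..<y})"
    by (intro open_Int open_Collect_less B g continuous_intros open_greaterThanLessThan)
  moreover have "s0 \<in> {s. B s < m - \<kappa>} \<inter> {s. g s0 / 2 < g s} \<inter> {x<..<y}" using s0 \<kappa> by auto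
  ultimately obtain \<delta> where \<delta>: "\<delta> > 0" "cball s0 \<delta> \<subseteq> {s. B s < m - \<kappa>} \<inter> {s. g s0 / 2 < g s} \<inter> {x<..<y}"
    using open_contains_cball by metis
  have sub: "B s < m - \<kappa> \<and> g s0 / 2 < g s \<and> x < s \<and> s < y" if "s \<in> {s0 - \<delta>..s0 + \<delta>}" for s
    using that \<delta>(2) by (auto simp: cball_def dist_real_def subset_iff abs_le_iff)
  have "g s0 * \<delta> * exp (- real k * (m - \<kappa>)) \<le> integral {x..y} (\<lambda>s. exp (- real k * B s) * g s)" for k :: nat
  proof -
    have int: "(\<lambda>s. exp (- real k * B s) * g s) integrable_on {u..v}" for u v
      by (intro integrable_continuous_real continuous_intros continuous_on_subset [OF B] continuous_on_subset [OF g(1)]) auto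
    have "g s0 * \<delta> * exp (- real k * (m - \<kappa>)) = integral {s0 - \<delta>..s0 + \<delta>} (\<lambda>s. exp (- real k * (m - \<kappa>)) * (g s0 / 2))"
      using \<delta> by simp
    also have "\<dots> \<le> integral {s0 - \<delta>..s0 + \<delta>} (\<lambda>s. exp (- real k * B s) * g s)"
    proof (intro integral_le int integrable_const_ivl)
      fix s assume "s \<in> {s0 - \<delta>..s0 + \<delta>}"
      from sub [OF this] s0(3) show "exp (- real k * (m - \<kappa>)) * (g s0 / 2) \<le> exp (- real k * B s) * g s"
        by (intro mult_mono) (auto intro!: mult_left_mono)
    qed
    also have "\<dots> \<le> integral {x..y} (\<lambda>s. exp (- real k * B s) * g s)"
      using sub g(2) \<delta>(1) by (intro integral_subset_le int) (auto intro: less_imp_le)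
    finally show ?thesis .
  qed
  then show ?thesis using \<kappa>(1) s0(3) \<delta>(1) by (intro exI [of _ "g s0 * \<delta>"] exI [of _ \<kappa>]) auto
qed

section \<open>Solvability yields bounded fibre solutions\<close>

context vector_field
begin

text \<open>An element of \<open>E_omega\<close> all of whose fibre equations are solvable lies in the annihilator, because it is the limit of
  its truncations to finitely many \<open>\<xi>\<close>, which are in the range of the operator.\<close>

lemma solvable_imp_bounded_solutions:
  assumes solv: "globally_solvable \<omega> (L_op a b)" and d: "decay D \<epsilon> d" "\<epsilon> > 0"
    and ex: "\<And>\<xi>. \<exists>u. ode (symb a b \<xi>) (fser (\<lambda>\<tau>. d (mk \<tau> \<xi>))) u"
  shows "\<exists>U. \<forall>\<xi>. \<exists>v. ode (symb a b \<xi>) (fser (\<lambda>\<tau>. d (mk \<tau> \<xi>))) v \<and> (\<forall>t. norm (v t) \<le> U)"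
proof -
  obtain u where u: "\<And>\<xi>. ode (symb a b \<xi>) (fser (\<lambda>\<tau>. d (mk \<tau> \<xi>))) (u \<xi>)" using ex by metis
  have "\<exists>M\<ge>0. \<forall>t. norm (u \<xi> t) \<le> M" for \<xi>
    using periodic_bounded [OF ode_continuous [OF u]] u unfolding ode_def by (meson norm_ge_zero)
  then obtain M where M: "\<And>\<xi>. M \<xi> \<ge> 0" "\<And>\<xi> t. norm (u \<xi> t) \<le> M \<xi>" by metis
  define cut where "cut R k = (if l1 (\<lambda>j. k (Some j)) \<le> R then d k else 0)" for R and k :: "'n option \<Rightarrow> int"
  define rest where "rest R k = (if l1 (\<lambda>j. k (Some j)) \<le> R then 0 else d k)" for R and k :: "'n option \<Rightarrow> int"
  have D: "D \<ge> 0" using decay_nonneg [OF d(1)] .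
  have cut_decay: "decay D \<epsilon> (cut R)" for R using d(1) D by (auto simp: decay_def cut_def)
  have cut_range: "\<exists>g. E_omega \<omega> g \<and> L_op a b g = tser (cut R)" for R
  proof (rule E_omega_of_slices [OF cut_decay d(2)])
    \<comment> \<open>Only finitely many fibres survive the cut, so arbitrary bounds
      \<open>M \<xi>\<close> fit under one exponential.\<close>
    define C where "C = (\<Sum>\<xi>\<in>{\<xi>. l1 \<xi> \<le> R}. M \<xi> * exp (\<epsilon> * \<omega> (l1 \<xi>)))"
    show "ode (symb a b \<xi>) (fser (\<lambda>\<tau>. cut R (mk \<tau> \<xi>))) (if l1 \<xi> \<le> R then u \<xi> else (\<lambda>_. 0))" for \<xi>
      using u [of \<xi>] by (auto simp: cut_def ode_def)
    show "norm ((if l1 \<xi> \<le> R then u \<xi> else (\<lambda>_. 0)) t) \<le> C * exp (- \<epsilon> * \<omega> (l1 \<xi>))" for \<xi> t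
    proof (cases "l1 \<xi> \<le> R")
      case True
      have "M \<xi> * exp (\<epsilon> * \<omega> (l1 \<xi>)) \<le> C"
        unfolding C_def by (rule member_le_sum) (use True M finite_l1_ball in auto)
      then have "M \<xi> \<le> C * exp (- \<epsilon> * \<omega> (l1 \<xi>))" by (simp add: exp_minus field_simps)
      then show ?thesis using True M(2) [of \<xi> t] by simp
    next
      case False
      have "C \<ge> 0" unfolding C_def using M by (intro sum_nonneg) auto
      then show ?thesis using False by simp
    qed
  qed
  have dE: "E_omega \<omega> (tser d)" by (rule tser_E_omega [OF d])
  have "\<mu> (tser d) = 0" if \<mu>: "E_dual \<omega> \<mu>" and ker: "\<And>g. E_omega \<omega> g \<Longrightarrow> \<mu> (L_op a b g) = 0" for \<mu>
  proof -
    \<comment> \<open>A sequence with exponent \<open>2 / k\<close> lies in the step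
      \<open>1 / k\<close>; the choice leaves the other \<open>\<epsilon> / 2\<close> of the decay
      of \<open>d\<close> for making the tail small.\<close>
    define k where "k = nat \<lceil>4 / \<epsilon>\<rceil> + 1"
    have k: "k \<ge> 1" "2 / real k \<le> \<epsilon> / 2"
    proof -
      have "4 / \<epsilon> \<le> real k" unfolding k_def by linarith
      moreover have "0 < real k" by (simp add: k_def)
      ultimately show "2 / real k \<le> \<epsilon> / 2" using d(2) by (simp add: field_simps)
    qed (simp add: k_def)
    obtain C where C: "\<And>f. E_lam \<omega> (1 / real k) f \<Longrightarrow> norm (\<mu> f) \<le> C * norm_lam \<omega> (1 / real k) f"
      using \<mu> k(1) unfolding E_dual_def by blast
    define K where "K = exp (1 / real k * \<omega> 1) * wsum TYPE('n option) (1 / real k)"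
    have K: "K \<ge> 0" unfolding K_def wsum_def by (intro mult_nonneg_nonneg infsum_nonneg) auto
    obtain P where P: "P > 0" "\<And>t. t \<ge> 0 \<Longrightarrow> (1 + t) ^ 1 \<le> P * exp (\<epsilon> / 2 * \<omega> t)"
      using w_poly [of "\<epsilon> / 2" 1] d(2) by auto
    \<comment> \<open>The tail beyond \<open>R\<close> is of order
      \<open>exp (- (\<epsilon> / 2) * \<omega> R)\<close> in the step \<open>1 / k\<close>, hence
      \<open>O(1 / (1 + R))\<close>; on the cut part \<open>\<mu>\<close> vanishes.\<close>
    have bound: "norm (\<mu> (tser d)) * (1 + real R) \<le> \<bar>C\<bar> * (D * P * K)" for R :: nat
    proof -
      define q where "q = D * exp (- (\<epsilon> / 2) * \<omega> (real R))"
      have "decay q (2 / real k) (rest (real R))"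
        unfolding decay_def
      proof
        fix l :: "'n option \<Rightarrow> int"
        show "norm (rest (real R) l) \<le> q * exp (- (2 / real k) * \<omega> (l1 l))"
        proof (cases "l1 (\<lambda>j. l (Some j)) \<le> real R")
          case True
          then show ?thesis using D by (simp add: rest_def q_def)
        next
          case False
          have "real R \<le> l1 l"
            using False l1_mk [of "l None" "\<lambda>j. l (Some j)"] by (simp add: mk_collapse)
          then have "\<epsilon> / 2 * \<omega> (real R) + 2 / real k * \<omega> (l1 l) \<le> \<epsilon> / 2 * \<omega> (l1 l) + \<epsilon> / 2 * \<omega> (l1 l)"
            using d(2) k(2) w_nonneg [of "l1 l"] by (intro add_mono mult_left_mono mult_right_mono w_mono) auto
          then have "exp (- \<epsilon> * \<omega> (l1 l)) \<le> exp (- (\<epsilon> / 2) * \<omega> (real R)) * exp (- (2 / real k) * \<omega> (l1 l))"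
            unfolding exp_add [symmetric] by simp
          from mult_left_mono [OF this D] show ?thesis
            using d(1) False unfolding decay_def rest_def q_def by (auto simp: mult.assoc intro: order_trans)
        qed
      qed
      then have rd: "decay q (2 / real k) (rest (real R))" .
      have k0: "2 / real k > 0" using k(1) by simp
      have El: "E_lam \<omega> (1 / real k) (tser (rest (real R)))" and
        nl: "norm_lam \<omega> (1 / real k) (tser (rest (real R))) \<le> q * K"
        using tser_E_lam [OF rd k0] norm_lam_tser_le [OF rd k0] by (simp_all add: K_def)
      have "0 \<le> norm_lam \<omega> (1 / real k) (tser (rest (real R))) * exp (1 / real k * phi_star \<omega> (real (length ([] :: 'n option list)) / (1 / real k)))"
        using norm_pds_le [OF El, of "[]" 0] norm_ge_zero order_trans by blast
      then have nl0: "0 \<le> norm_lam \<omega> (1 / real k) (tser (rest (real R)))" by (simp add: zero_le_mult_iff)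
      have "norm (\<mu> (tser (rest (real R)))) \<le> C * norm_lam \<omega> (1 / real k) (tser (rest (real R)))" by (rule C [OF El])
      also have "\<dots> \<le> \<bar>C\<bar> * (q * K)" using nl nl0 by (intro mult_mono) auto
      finally have "norm (\<mu> (tser (rest (real R)))) \<le> \<bar>C\<bar> * (q * K)" .
      moreover have "\<mu> (tser d) = \<mu> (tser (rest (real R)))"
      proof -
        have "d = (\<lambda>k. cut (real R) k + rest (real R) k)" by (auto simp: cut_def rest_def)
        then have "tser d = (\<lambda>x. tser (cut (real R)) x + tser (rest (real R)) x)"
          using tser_add [OF rapid_summable [OF decay_rapid [OF cut_decay [of "real R"] d(2)]] rapid_summable [OF decay_rapid [OF rd k0]]]
          by presburger
        moreover have "\<mu> (\<lambda>x. tser (cut (real R)) x + tser (rest (real R)) x) = \<mu> (tser (cut (real R))) + \<mu> (tser (rest (real R)))"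
          using \<mu> tser_E_omega [OF cut_decay d(2)] tser_E_omega [OF rd k0] unfolding E_dual_def by blast
        moreover have "\<mu> (tser (cut (real R))) = 0" using cut_range [of "real R"] ker by metis
        ultimately show ?thesis by simp
      qed
      ultimately have "norm (\<mu> (tser d)) * (1 + real R) \<le> \<bar>C\<bar> * (q * K) * (1 + real R)"
        by (intro mult_right_mono) auto
      also have "\<dots> = \<bar>C\<bar> * (q * (1 + real R) * K)" by simp
      also have "\<dots> \<le> \<bar>C\<bar> * (D * P * K)"
      proof -
        have "exp (- (\<epsilon> / 2) * \<omega> (real R)) * (1 + real R) \<le> P"
          using P(2) [of "real R"] by (simp add: exp_minus field_simps)
        then have "q * (1 + real R) \<le> D * P" unfolding q_def using D by (simp add: mult.assoc mult_left_mono)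
        then show ?thesis using K by (intro mult_left_mono mult_right_mono) auto
      qed
      finally show ?thesis .
    qed
    show ?thesis
    proof (rule ccontr)
      assume nz: "\<mu> (tser d) \<noteq> 0"
      obtain R :: nat where "\<bar>C\<bar> * (D * P * K) / norm (\<mu> (tser d)) < real R" using reals_Archimedean2 by blast
      then have "\<bar>C\<bar> * (D * P * K) < norm (\<mu> (tser d)) * real R" using nz by (simp add: field_simps)
      with bound [of R] show False using norm_ge_zero [of "\<mu> (tser d)"] by (simp add: distrib_left)
    qed
  qed
  then have "tser d \<in> {L_op a b g |g. E_omega \<omega> g}"
    using solv dE unfolding globally_solvable_def by blast
  then obtain g where g: "E_omega \<omega> g" "L_op a b g = tser d" by auto
  obtain C \<delta> c where c: "\<delta> > 0" "decay C \<delta> c" "g = tser c" "rapid c" using g(1) by (rule E_omegaE)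
  have "\<exists>v. ode (symb a b \<xi>) (fser (\<lambda>\<tau>. d (mk \<tau> \<xi>))) v \<and> (\<forall>t. norm (v t) \<le> C * isum (\<delta> / 2))" for \<xi>
  proof (intro exI conjI allI)
    show "ode (symb a b \<xi>) (fser (\<lambda>\<tau>. d (mk \<tau> \<xi>))) (fser (\<lambda>\<tau>. c (mk \<tau> \<xi>)))"
      using g(2) unfolding c(3) by (intro ode_of_L_op c rapid_summable decay_rapid [OF d] a_cont b_cont)
    fix t
    have "C * exp (- (\<delta> / 2) * \<omega> (l1 \<xi>)) \<le> C * 1"
      using decay_nonneg [OF c(2)] c(1) w_nonneg [of "l1 \<xi>"] by (intro mult_left_mono) auto
    then have "decay_int C (\<delta> / 2) (\<lambda>\<tau>. c (mk \<tau> \<xi>))"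
      by (intro decay_int_mono [OF decay_slice [OF c(2,1), of \<xi>]]) auto
    then show "norm (fser (\<lambda>\<tau>. c (mk \<tau> \<xi>)) t) \<le> C * isum (\<delta> / 2)" by (rule norm_fser_le) (use c(1) in simp)
  qed
  then show ?thesis by blast
qed

text \<open>The regularity estimate with right-hand side zero and sup norm at most 1. It places
  exponentials of primitives in the class; the shift \<open>\<mu>\<close> adapts it both to phases
  and to small divisors.\<close>

lemma homogeneous_coefficient_decay:
  assumes "R \<ge> 0" "\<epsilon> > 0"
  shows "\<exists>C\<ge>0. \<exists>\<eta>. 0 < \<eta> \<and> \<eta> \<le> \<epsilon> \<and> (\<forall>\<xi> \<mu> w. norm \<mu> \<le> R * (l1 \<xi> + 1) \<longrightarrow> ode (\<lambda>t. symb a b \<xi> t + \<mu>) (\<lambda>_. 0) w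
    \<longrightarrow> (\<forall>t. norm (w t) \<le> 1) \<longrightarrow> decay_int (C * exp (\<epsilon> * \<omega> (l1 \<xi>))) \<eta> (fcoef w) \<and> fser (fcoef w) = w)"
proof -
  obtain D0 \<delta> h where h: "\<delta> > 0" "D0 \<ge> 0" "\<And>\<xi>. decay_int (l1 \<xi> * D0) \<delta> (h \<xi>)" "\<And>\<xi>. fser (h \<xi>) = symb a b \<xi>"
    using symbol_series by blast
  \<comment> \<open>The constant \<open>\<mu>\<close> sits at frequency 0, where the weight is
    \<open>\<omega> 0\<close>; hence the compensating exponential.\<close>
  define D1 where "D1 = D0 + R * exp (\<delta> * \<omega> 0)"
  obtain K where K: "K \<ge> 1" and reg: "\<And>\<eta> Q ch fh G U u. 0 < \<eta> \<Longrightarrow> \<eta> \<le> \<delta> / 2 \<Longrightarrow> Q \<ge> 1 \<Longrightarrow> decay_int (Q * D1) \<delta> ch \<Longrightarrow> decay_int G \<delta> fh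
    \<Longrightarrow> ode (fser ch) (fser fh) u \<Longrightarrow> (\<forall>t. norm (u t) \<le> U) \<Longrightarrow> decay_int (2 * (G + U * exp (\<eta> * K * \<omega> Q))) \<eta> (fcoef u)"
    using uniform_coefficient_decay [OF h(1), of D1] by blast
  define \<eta> where "\<eta> = min (\<delta> / 2) (\<epsilon> / K)"
  have \<eta>: "0 < \<eta>" "\<eta> \<le> \<delta> / 2" "\<eta> * K \<le> \<epsilon>"
    using h K assms(2) by (auto simp: \<eta>_def min_def field_simps)
  have "\<eta> * 1 \<le> \<eta> * K" using K \<eta>(1) by (intro mult_left_mono) auto
  then have \<eta>': "\<eta> \<le> \<epsilon>" using \<eta>(3) by simp
  define C where "C = 2 * exp (\<epsilon> * \<omega> 1)"
  have "decay_int (C * exp (\<epsilon> * \<omega> (l1 \<xi>))) \<eta> (fcoef w) \<and> fser (fcoef w) = w"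
    if \<mu>: "norm \<mu> \<le> R * (l1 \<xi> + 1)" and w: "ode (\<lambda>t. symb a b \<xi> t + \<mu>) (\<lambda>_. 0) w" "\<And>t. norm (w t) \<le> 1" for \<xi> \<mu> w
  proof -
    define ch where "ch n = h \<xi> n + (if n = 0 then \<mu> else 0)" for n
    have d0: "decay_int (R * (l1 \<xi> + 1) * exp (\<delta> * \<omega> 0)) \<delta> (\<lambda>n. if n = 0 then \<mu> else 0)"
      unfolding decay_int_def using \<mu> assms(1) by (auto simp: mult.assoc exp_add [symmetric])
    have d1: "decay_int ((l1 \<xi> + 1) * D0) \<delta> (h \<xi>)"
      by (rule decay_int_mono [OF h(3)]) (use h in \<open>auto intro: mult_right_mono\<close>)
    have ch: "decay_int ((l1 \<xi> + 1) * D1) \<delta> ch"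
      using decay_int_add [OF d1 d0] by (simp add: ch_def [abs_def] D1_def algebra_simps)
    have "fser ch t = symb a b \<xi> t + \<mu>" for t
      unfolding ch_def [abs_def] using fser_add [OF decay_int_rapid(2) [OF d1 h(1)] decay_int_rapid(2) [OF d0 h(1)]]
      by (simp add: h(4) fser_single)
    then have "fser ch = (\<lambda>t. symb a b \<xi> t + \<mu>)" by auto
    then have "decay_int (2 * (0 + 1 * exp (\<eta> * K * \<omega> (l1 \<xi> + 1)))) \<eta> (fcoef w)"
      using w by (intro reg [OF \<eta>(1,2) _ ch, of _ "\<lambda>_. 0"]) (auto simp: decay_int_def)
    then have dw: "decay_int (C * exp (\<epsilon> * \<omega> (l1 \<xi>))) \<eta> (fcoef w)"
    proof (rule decay_int_mono)
      have "\<eta> * K * \<omega> (l1 \<xi> + 1) \<le> \<epsilon> * (\<omega> (l1 \<xi>) + \<omega> 1)"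
        using \<eta> K assms(2) w_nonneg [of "l1 \<xi> + 1"] by (intro mult_mono w_add) auto
      then have "exp (\<eta> * K * \<omega> (l1 \<xi> + 1)) \<le> exp (\<epsilon> * \<omega> 1) * exp (\<epsilon> * \<omega> (l1 \<xi>))"
        unfolding exp_add [symmetric] by (simp add: algebra_simps)
      then show "2 * (0 + 1 * exp (\<eta> * K * \<omega> (l1 \<xi> + 1))) \<le> C * exp (\<epsilon> * \<omega> (l1 \<xi>))" by (simp add: C_def)
    qed simp
    moreover have "fser (fcoef w) = w"
      by (rule fser_fcoef [OF ode_continuous [OF w(1)] _ decay_int_rapid(2) [OF dw \<eta>(1)]]) (use w(1) in \<open>simp add: ode_def\<close>)
    ultimately show ?thesis by simp
  qed
  moreover have "C \<ge> 0" by (simp add: C_def)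
  ultimately show ?thesis using \<eta>(1) \<eta>' by (intro exI [of _ C] conjI exI [of _ \<eta>]) blast+
qed

text \<open>The locale is symmetric in \<open>a\<close> and \<open>b\<close>, so the estimate for
  the means of \<open>a\<close> is reused with exchanged roles.\<close>

lemma abs_\<beta>m_le: "\<exists>R\<ge>0. \<forall>\<xi>. \<bar>\<beta>m \<xi>\<bar> \<le> R * l1 \<xi>"
proof -
  interpret S: vector_field \<omega> b a by unfold_locales (use aE bE in auto)
  have "S.\<alpha>m \<xi> = \<beta>m \<xi>" for \<xi> by (simp add: S.\<alpha>m_def \<beta>m_def)
  then show ?thesis using S.abs_\<alpha>m_le by simp
qed

text \<open>The factor \<open>exp (- (2 * \<epsilon>) * \<omega> (l1 \<xi>))\<close> outweighs the
  growth of the constants and leaves decay in \<xi>; it is the price in size of an admissible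
  right-hand side.\<close>

lemma decay_slices_scaled:
  fixes c :: "('n \<Rightarrow> int) \<Rightarrow> int \<Rightarrow> complex"
  assumes "0 < \<eta>" "\<eta> \<le> \<epsilon>"
    and "\<And>\<xi>. decay_int (C * exp (\<epsilon> * \<omega> (l1 \<xi>))) \<eta> (c \<xi>)"
  shows "decay C \<eta> (\<lambda>k. exp (- (2 * \<epsilon>) * \<omega> (l1 (\<lambda>j. k (Some j)))) * c (\<lambda>j. k (Some j)) (k None))"
proof (rule decay_unslice [OF assms(1)])
  fix \<xi> :: "'n \<Rightarrow> int"
  have "0 \<le> C * exp (\<epsilon> * \<omega> (l1 \<xi>))" by (rule decay_int_nonneg [OF assms(3)])
  then have C: "C \<ge> 0" by (simp add: zero_le_mult_iff)
  have "decay_int (norm (complex_of_real (exp (- (2 * \<epsilon>) * \<omega> (l1 \<xi>)))) * (C * exp (\<epsilon> * \<omega> (l1 \<xi>)))) \<eta>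
     (\<lambda>\<tau>. complex_of_real (exp (- (2 * \<epsilon>) * \<omega> (l1 \<xi>))) * c \<xi> \<tau>)"
    by (rule decay_int_cmult [OF assms(3)])
  then have "decay_int (C * exp (- \<eta> * \<omega> (l1 \<xi>))) \<eta> (\<lambda>\<tau>. complex_of_real (exp (- (2 * \<epsilon>) * \<omega> (l1 \<xi>))) * c \<xi> \<tau>)"
  proof (rule decay_int_mono)
    have "norm (complex_of_real (exp (- (2 * \<epsilon>) * \<omega> (l1 \<xi>)))) * (C * exp (\<epsilon> * \<omega> (l1 \<xi>))) = C * exp (- \<epsilon> * \<omega> (l1 \<xi>))"
      by (simp add: exp_add [symmetric] mult.left_commute)
    also have "\<dots> \<le> C * exp (- \<eta> * \<omega> (l1 \<xi>))"
      using C mult_right_mono [OF assms(2) w_nonneg [of "l1 \<xi>"]] by (intro mult_left_mono) auto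
    finally show "norm (complex_of_real (exp (- (2 * \<epsilon>) * \<omega> (l1 \<xi>)))) * (C * exp (\<epsilon> * \<omega> (l1 \<xi>))) \<le> C * exp (- \<eta> * \<omega> (l1 \<xi>))" .
  qed simp
  then show "decay_int (C * exp (- \<eta> * \<omega> (l1 \<xi>))) \<eta>
     (\<lambda>\<tau>. complex_of_real (exp (- (2 * \<epsilon>) * \<omega> (l1 (\<lambda>j. mk \<tau> \<xi> (Some j))))) * c (\<lambda>j. mk \<tau> \<xi> (Some j)) (mk \<tau> \<xi> None))" by simp
qed

end

section \<open>Phase factors and exponential growth along multiples of a frequency\<close>

lemma exp_i_deriv:
  assumes "(g has_vector_derivative g') (at t)"
  shows "((\<lambda>t. cis (g t)) has_vector_derivative \<i> * of_real g' * cis (g t)) (at t)"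
proof -
  have "((\<lambda>t. \<i> * of_real (g t)) has_vector_derivative \<i> * of_real g') (at t)"
    by (intro has_vector_derivative_mult_right has_vector_derivative_of_real)
       (use assms in \<open>simp add: has_real_derivative_iff_has_vector_derivative\<close>)
  from field_vector_diff_chain_at [OF this DERIV_exp] show ?thesis
    by (simp add: o_def cis_conv_exp)
qed

context weight_subadd
begin

text \<open>As \<open>\<omega>\<close> grows at most linearly, the given \<epsilon> keeps the
  damping below half of the gain \<open>k * \<kappa>\<close>; the other half is unbounded.
  \<open>P\<close> restricts \<open>k\<close> to an infinite set, since powers of a nonresonant
  multiplier may return to 1.\<close>

lemma exponential_growth_unbounded:
  assumes "c > 0" "\<kappa> > 0" "n \<ge> 0" and \<epsilon>: "\<epsilon> = \<kappa> / (4 * (n + 1) * (\<omega> 1 + 1))"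
    and inf: "\<And>N. \<exists>k\<ge>N. P k"
    and le: "\<And>k. k \<ge> 1 \<Longrightarrow> P k \<Longrightarrow> exp (- (2 * \<epsilon>) * \<omega> (real k * n)) * (c * exp (- real k * (m - \<kappa>))) \<le> U * exp (- real k * m)"
  shows False
proof -
  have w1: "\<omega> 1 \<ge> 0" by (rule w_nonneg) simp
  have "c * (1 + real k * (\<kappa> / 2)) \<le> U" if k: "k \<ge> 1" "P k" for k
  proof -
    have "real k * n + 1 \<le> real k * (n + 1)" using k by (simp add: distrib_left)
    then have "\<omega> (real k * n) \<le> real k * (n + 1) * (\<omega> 1 + 1)"
      using w_linear [of "real k * n"] assms(3) w1 mult_mono [of "real k * n + 1" "real k * (n + 1)" "\<omega> 1" "\<omega> 1 + 1"] by simp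
    then have "2 * \<epsilon> * \<omega> (real k * n) \<le> 2 * \<epsilon> * (real k * (n + 1) * (\<omega> 1 + 1))"
      using assms(2,3) w1 by (intro mult_left_mono) (auto simp: \<epsilon>)
    also have "\<dots> = real k * (\<kappa> / 2)"
    proof -
      define X where "X = (n + 1) * (\<omega> 1 + 1)"
      have "X > 0" unfolding X_def using assms(3) w1 by (intro mult_pos_pos) auto
      moreover have "\<epsilon> = \<kappa> / (4 * X)" by (simp add: \<epsilon> X_def mult.assoc)
      ultimately have "2 * \<epsilon> * (real k * X) = real k * (\<kappa> / 2)" by (simp add: field_simps)
      then show ?thesis by (simp add: X_def mult.assoc)
    qed
    finally have *: "2 * \<epsilon> * \<omega> (real k * n) \<le> real k * (\<kappa> / 2)" .
    have "c * (1 + real k * (\<kappa> / 2)) \<le> c * exp (real k * (\<kappa> / 2))"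
      using assms(1) by (intro mult_left_mono exp_ge_add_one_self) auto
    also have "\<dots> \<le> c * exp (- (2 * \<epsilon>) * \<omega> (real k * n) + real k * \<kappa>)"
      using * assms(1) by (intro mult_left_mono) (auto simp: algebra_simps)
    also have "\<dots> = exp (- (2 * \<epsilon>) * \<omega> (real k * n)) * (c * exp (- real k * (m - \<kappa>))) * exp (real k * m)"
      by (simp add: exp_add [symmetric] mult.left_commute [of _ c] mult.assoc algebra_simps)
    also have "\<dots> \<le> U * exp (- real k * m) * exp (real k * m)" by (intro mult_right_mono le k) simp
    also have "\<dots> = U" by (simp add: exp_minus)
    finally show ?thesis .
  qed
  moreover obtain N :: nat where N: "(U / c) / (\<kappa> / 2) < real N" using reals_Archimedean2 by blast
  moreover obtain k where k: "k \<ge> max N 1" "P k" using inf by blast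
  ultimately have "c * (1 + real k * (\<kappa> / 2)) \<le> U" by simp
  moreover have "U / c < real N * (\<kappa> / 2)" using N assms(2) by (simp only: pos_divide_less_eq half_gt_zero)
  then have "U < c * (real N * (\<kappa> / 2))" using assms(1) by (metis mult.commute pos_divide_less_eq)
  moreover have "c * (real N * (\<kappa> / 2)) \<le> c * (1 + real k * (\<kappa> / 2))"
  proof -
    have "real N * (\<kappa> / 2) \<le> real k * (\<kappa> / 2)" using k assms(2) by (intro mult_right_mono) auto
    then show ?thesis using assms(1) by (intro mult_left_mono) auto
  qed
  ultimately show False by linarith
qed

end

context vector_field
begin

text \<open>\<open>ph\<close> removes the oscillation of the integrating factor: see \<open>E_ph\<close>.\<close>

definition ph :: "('n \<Rightarrow> int) \<Rightarrow> int \<Rightarrow> real \<Rightarrow> complex" where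
  "ph \<xi> \<sigma> t = cis ((\<alpha>m \<xi> - of_int \<sigma>) * t - Ap \<xi> t)"

lemma E_ph: "fib.E \<xi> t * ph \<xi> \<sigma> t = of_real (exp (- Bp \<xi> t)) * cis ((\<alpha>m \<xi> - of_int \<sigma>) * t)"
  unfolding fib.E_def ph_def
  by (simp add: cis_conv_exp exp_add [symmetric] exp_of_real [symmetric] algebra_simps del: exp_of_real)

text \<open>Periodicity holds because \<sigma> is an integer. As a homogeneous solution for a
  shifted real symbol, the phase falls under the regularity estimate.\<close>

lemma ph_ode: "ode (\<lambda>t. of_real (dot \<xi> a t) + of_real (of_int \<sigma> - \<alpha>m \<xi>)) (\<lambda>_. 0) (ph \<xi> \<sigma>)"
  unfolding ode_def
proof (intro conjI allI)
  fix t
  have "(\<alpha>m \<xi> - of_int \<sigma>) * (t + 2 * pi) - Ap \<xi> (t + 2 * pi) = ((\<alpha>m \<xi> - of_int \<sigma>) * t - Ap \<xi> t) + of_int (- \<sigma>) * (2 * pi)"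
    unfolding fib.A_per by (simp add: algebra_simps)
  then show "ph \<xi> \<sigma> (t + 2 * pi) = ph \<xi> \<sigma> t"
    unfolding ph_def by (simp only: periodic_int_mult [of cis "2 * pi", OF cis_int_shift [of 1, simplified]])
  have "((\<lambda>t. (\<alpha>m \<xi> - of_int \<sigma>) * t - Ap \<xi> t) has_vector_derivative (\<alpha>m \<xi> - of_int \<sigma>) * 1 - dot \<xi> a t) (at t)"
    by (intro has_vector_derivative_diff fib.A has_vector_derivative_mult_right has_vector_derivative_id [unfolded id_def])
  from exp_i_deriv [OF this] show "(ph \<xi> \<sigma> has_vector_derivative 0 - \<i> * (of_real (dot \<xi> a t) + of_real (of_int \<sigma> - \<alpha>m \<xi>)) * ph \<xi> \<sigma> t) (at t)"
    by (simp add: ph_def [abs_def] algebra_simps)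
qed

text \<open>The estimate is applied to the field with zero imaginary part. The bound 2 admits the
  integer part of \<open>\<alpha>m \<xi>\<close> and both its neighbours.\<close>

lemma ph_coefficient_decay:
  assumes "\<epsilon> > 0"
  shows "\<exists>C\<ge>0. \<exists>\<eta>. 0 < \<eta> \<and> \<eta> \<le> \<epsilon> \<and> (\<forall>\<xi> \<sigma>. \<bar>of_int \<sigma> - \<alpha>m \<xi>\<bar> \<le> 2 \<longrightarrow>
    decay_int (C * exp (\<epsilon> * \<omega> (l1 \<xi>))) \<eta> (fcoef (ph \<xi> \<sigma>)) \<and> fser (fcoef (ph \<xi> \<sigma>)) = ph \<xi> \<sigma>)"
proof -
  interpret Z: vector_field \<omega> a "\<lambda>_ _. 0"
    by unfold_locales (use aE E_omega_sum [of "{}"] in auto)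
  obtain C \<eta> where C: "C \<ge> 0" "0 < \<eta>" "\<eta> \<le> \<epsilon>" and dec: "\<And>\<xi> \<mu> w. norm \<mu> \<le> 2 * (l1 \<xi> + 1) \<Longrightarrow> ode (\<lambda>t. symb a (\<lambda>_ _. 0) \<xi> t + \<mu>) (\<lambda>_. 0) w
    \<Longrightarrow> (\<forall>t. norm (w t) \<le> 1) \<Longrightarrow> decay_int (C * exp (\<epsilon> * \<omega> (l1 \<xi>))) \<eta> (fcoef w) \<and> fser (fcoef w) = w"
    using Z.homogeneous_coefficient_decay [of 2 \<epsilon>] assms by auto
  have s: "symb a (\<lambda>_ _. 0) \<xi> t = of_real (dot \<xi> a t)" for \<xi> t by (simp add: symb_dot dot_def [of _ "\<lambda>_ _. 0"])
  have "decay_int (C * exp (\<epsilon> * \<omega> (l1 \<xi>))) \<eta> (fcoef (ph \<xi> \<sigma>)) \<and> fser (fcoef (ph \<xi> \<sigma>)) = ph \<xi> \<sigma>"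
    if "\<bar>of_int \<sigma> - \<alpha>m \<xi>\<bar> \<le> 2" for \<xi> \<sigma>
  proof (rule dec)
    have "norm (complex_of_real (of_int \<sigma> - \<alpha>m \<xi>)) \<le> 2" using that by (simp only: norm_of_real real_norm_def)
    then show "norm (complex_of_real (of_int \<sigma> - \<alpha>m \<xi>)) \<le> 2 * (l1 \<xi> + 1)" by (rule order_trans) simp
    show "ode (\<lambda>t. symb a (\<lambda>_ _. 0) \<xi> t + complex_of_real (of_int \<sigma> - \<alpha>m \<xi>)) (\<lambda>_. 0) (ph \<xi> \<sigma>)"
      unfolding s by (rule ph_ode)
  qed (simp add: ph_def)
  with C show ?thesis by blast
qed

text \<open>Neighbouring phases differ by a factor \<open>cis (- t)\<close> or \<open>cis t\<close>,
  so the three terms provide trigonometric amplitudes of degree one over a base phase, with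
  coefficients bounded uniformly in \<xi>.\<close>

lemma bounded_solutions_ph:
  assumes solv: "globally_solvable \<omega> (L_op a b)" and "\<epsilon> > 0"
    and \<kappa>: "\<And>\<xi>. norm (\<kappa>0 \<xi>) \<le> 2" "\<And>\<xi>. norm (\<kappa>1 \<xi>) \<le> 2" "\<And>\<xi>. norm (\<kappa>2 \<xi>) \<le> 2"
    and ex: "\<And>\<xi>. \<exists>u. ode (symb a b \<xi>) (\<lambda>t. of_real (exp (- (2 * \<epsilon>) * \<omega> (l1 \<xi>))) *
      (\<kappa>0 \<xi> * ph \<xi> \<lfloor>\<alpha>m \<xi>\<rfloor> t + (\<kappa>1 \<xi> * ph \<xi> (\<lfloor>\<alpha>m \<xi>\<rfloor> + 1) t + \<kappa>2 \<xi> * ph \<xi> (\<lfloor>\<alpha>m \<xi>\<rfloor> - 1) t))) u"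
  shows "\<exists>U. \<forall>\<xi>. \<exists>v. ode (symb a b \<xi>) (\<lambda>t. of_real (exp (- (2 * \<epsilon>) * \<omega> (l1 \<xi>))) *
      (\<kappa>0 \<xi> * ph \<xi> \<lfloor>\<alpha>m \<xi>\<rfloor> t + (\<kappa>1 \<xi> * ph \<xi> (\<lfloor>\<alpha>m \<xi>\<rfloor> + 1) t + \<kappa>2 \<xi> * ph \<xi> (\<lfloor>\<alpha>m \<xi>\<rfloor> - 1) t))) v \<and> (\<forall>t. norm (v t) \<le> U)"
proof -
  let ?\<sigma> = "\<lambda>\<xi>. \<lfloor>\<alpha>m \<xi>\<rfloor>"
  obtain C \<eta> where C: "C \<ge> 0" "0 < \<eta>" "\<eta> \<le> \<epsilon>" and dec: "\<And>\<xi> \<sigma>. \<bar>of_int \<sigma> - \<alpha>m \<xi>\<bar> \<le> 2 \<Longrightarrow>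
    decay_int (C * exp (\<epsilon> * \<omega> (l1 \<xi>))) \<eta> (fcoef (ph \<xi> \<sigma>)) \<and> fser (fcoef (ph \<xi> \<sigma>)) = ph \<xi> \<sigma>"
    using ph_coefficient_decay [OF assms(2)] by blast
  define c where "c \<xi> n = \<kappa>0 \<xi> * fcoef (ph \<xi> (?\<sigma> \<xi>)) n + (\<kappa>1 \<xi> * fcoef (ph \<xi> (?\<sigma> \<xi> + 1)) n + \<kappa>2 \<xi> * fcoef (ph \<xi> (?\<sigma> \<xi> - 1)) n)" for \<xi> n
  have trm: "decay_int (2 * C * exp (\<epsilon> * \<omega> (l1 \<xi>))) \<eta> (\<lambda>n. q * fcoef (ph \<xi> \<sigma>) n)"
    if "norm q \<le> 2" "\<bar>of_int \<sigma> - \<alpha>m \<xi>\<bar> \<le> 2" for q \<xi> \<sigma>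
    by (rule decay_int_mono [OF decay_int_cmult [OF conjunct1 [OF dec [OF that(2)]]]]) (use that(1) C(1) in \<open>auto simp: mult.assoc intro!: mult_right_mono\<close>)
  have \<sigma>: "\<bar>of_int (?\<sigma> \<xi>) - \<alpha>m \<xi>\<bar> \<le> 2" "\<bar>of_int (?\<sigma> \<xi> + 1) - \<alpha>m \<xi>\<bar> \<le> 2" "\<bar>of_int (?\<sigma> \<xi> - 1) - \<alpha>m \<xi>\<bar> \<le> 2" for \<xi>
    by linarith+
  have cd: "decay_int ((6 * C) * exp (\<epsilon> * \<omega> (l1 \<xi>))) \<eta> (c \<xi>)" for \<xi>
    using decay_int_add [OF trm [OF \<kappa>(1) [of \<xi>] \<sigma>(1) [of \<xi>]] decay_int_add [OF trm [OF \<kappa>(2) [of \<xi>] \<sigma>(2) [of \<xi>]] trm [OF \<kappa>(3) [of \<xi>] \<sigma>(3) [of \<xi>]]]]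
    by (simp add: c_def [abs_def] mult.assoc)
  define d where "d k = exp (- (2 * \<epsilon>) * \<omega> (l1 (\<lambda>j. k (Some j)))) * c (\<lambda>j. k (Some j)) (k None)" for k
  have dd: "decay (6 * C) \<eta> d"
    using decay_slices_scaled [OF C(2,3) cd] by (simp add: d_def [abs_def])
  have f: "fser (\<lambda>\<tau>. d (mk \<tau> \<xi>)) = (\<lambda>t. of_real (exp (- (2 * \<epsilon>) * \<omega> (l1 \<xi>))) *
      (\<kappa>0 \<xi> * ph \<xi> (?\<sigma> \<xi>) t + (\<kappa>1 \<xi> * ph \<xi> (?\<sigma> \<xi> + 1) t + \<kappa>2 \<xi> * ph \<xi> (?\<sigma> \<xi> - 1) t)))" for \<xi>
  proof
    fix t
    have s: "(\<lambda>n. norm (q * fcoef (ph \<xi> \<sigma>) n)) summable_on UNIV" if "norm q \<le> 2" "\<bar>of_int \<sigma> - \<alpha>m \<xi>\<bar> \<le> 2" for q \<sigma>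
      by (rule decay_int_rapid(2) [OF trm [OF that] C(2)])
    have "fser (c \<xi>) t = \<kappa>0 \<xi> * ph \<xi> (?\<sigma> \<xi>) t + (\<kappa>1 \<xi> * ph \<xi> (?\<sigma> \<xi> + 1) t + \<kappa>2 \<xi> * ph \<xi> (?\<sigma> \<xi> - 1) t)"
      unfolding c_def [abs_def]
      by (subst fser_add [OF s [OF \<kappa>(1) \<sigma>(1)]], rule decay_int_rapid(2) [OF decay_int_add [OF trm [OF \<kappa>(2) \<sigma>(2)] trm [OF \<kappa>(3) \<sigma>(3)]] C(2)],
          subst fser_add [OF s [OF \<kappa>(2) \<sigma>(2)] s [OF \<kappa>(3) \<sigma>(3)]])
         (simp add: fser_cmult conjunct2 [OF dec [OF \<sigma>(1)]] conjunct2 [OF dec [OF \<sigma>(2)]] conjunct2 [OF dec [OF \<sigma>(3)]])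
    then show "fser (\<lambda>\<tau>. d (mk \<tau> \<xi>)) t = of_real (exp (- (2 * \<epsilon>) * \<omega> (l1 \<xi>))) *
      (\<kappa>0 \<xi> * ph \<xi> (?\<sigma> \<xi>) t + (\<kappa>1 \<xi> * ph \<xi> (?\<sigma> \<xi> + 1) t + \<kappa>2 \<xi> * ph \<xi> (?\<sigma> \<xi> - 1) t))"
      by (simp add: d_def fser_cmult)
  qed
  show ?thesis
    using solvable_imp_bounded_solutions [OF solv dd C(2)] ex unfolding f by blast
qed

section \<open>A sign change forces resonance\<close>

definition mulx :: "nat \<Rightarrow> ('n \<Rightarrow> int) \<Rightarrow> 'n \<Rightarrow> int" where "mulx k \<xi> = (\<lambda>j. int k * \<xi> j)"

lemma mulx_simps:
  "dot (mulx k \<xi>) g t = real k * dot \<xi> g t" "l1 (mulx k \<xi>) = real k * l1 \<xi>"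
  "\<alpha>m (mulx k \<xi>) = real k * \<alpha>m \<xi>" "\<beta>m (mulx k \<xi>) = real k * \<beta>m \<xi>" "fib.z (mulx k \<xi>) = fib.z \<xi> ^ k"
proof -
  show ab: "\<alpha>m (mulx k \<xi>) = real k * \<alpha>m \<xi>" "\<beta>m (mulx k \<xi>) = real k * \<beta>m \<xi>"
    by (simp_all add: \<alpha>m_def \<beta>m_def mulx_def sum_distrib_left mult.assoc)
  have "wm (mulx k \<xi>) = of_nat k * wm \<xi>" by (simp add: wm_def ab algebra_simps)
  then show "fib.z (mulx k \<xi>) = fib.z \<xi> ^ k"
    by (simp add: fib_z exp_of_nat_mult [symmetric] mult.left_commute mult.assoc)
qed (simp_all add: dot_def l1_def mulx_def abs_mult sum_distrib_left mult.assoc)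

text \<open>The two phases combine to a factor \<open>sin ((s - x) / 2)\<close>, zero at both ends
  of the period; the unimodular \<open>q\<close> centres the remaining oscillation at the
  midpoint.\<close>

lemma nonresonant_kernel_real_part:
  fixes \<theta> x s :: real
  defines "q \<equiv> cis (- (\<theta> * x)) * (- \<i>) * cis (- ((\<theta> - 1 / 2) * pi))"
  shows "Re (q * (cis (\<theta> * s) - cis x * cis ((\<theta> - 1) * s))) = 2 * sin ((s - x) / 2) * cos ((\<theta> - 1 / 2) * ((s - x) - pi))"
proof -
  define r where "r = (s - x) / 2"
  have s: "s = x + 2 * r" by (simp add: r_def field_simps)
  have "cis (\<theta> * s) - cis x * cis ((\<theta> - 1) * s) = cis (\<theta> * s - r) * (cis r - cis (- r))"
    by (simp add: right_diff_distrib cis_mult s algebra_simps)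
  also have "cis r - cis (- r) = 2 * \<i> * sin r" by (simp add: complex_eq_iff)
  finally have "q * (cis (\<theta> * s) - cis x * cis ((\<theta> - 1) * s))
     = (cis (- (\<theta> * x)) * cis (- ((\<theta> - 1 / 2) * pi)) * cis (\<theta> * s - r)) * of_real (2 * sin r)"
    by (simp add: q_def algebra_simps)
  also have "cis (- (\<theta> * x)) * cis (- ((\<theta> - 1 / 2) * pi)) * cis (\<theta> * s - r) = cis ((\<theta> - 1 / 2) * ((s - x) - pi))"
    unfolding cis_mult by (rule arg_cong [of _ _ cis]) (simp add: s algebra_simps)
  finally show ?thesis by (simp add: r_def)
qed

text \<open>The fractional part \<theta> varies with the multiple \<open>k\<close>, so a bound free
  of \<theta> is required: \<open>\<theta> - 1 / 2\<close> is at most one half in modulus, and in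
  the extreme case the cosine equals \<open>sin ((s - x) / 2)\<close>.\<close>

lemma nonresonant_kernel_lower_bound:
  fixes \<theta> x s :: real
  assumes "0 \<le> \<theta>" "\<theta> \<le> 1" "x \<le> s" "s \<le> x + 2 * pi"
  shows "2 * (sin ((s - x) / 2))\<^sup>2 \<le> 2 * sin ((s - x) / 2) * cos ((\<theta> - 1 / 2) * ((s - x) - pi))"
proof -
  have s: "sin ((s - x) / 2) \<ge> 0" using assms by (intro sin_ge_zero) auto
  have le: "\<bar>(\<theta> - 1 / 2) * ((s - x) - pi)\<bar> \<le> \<bar>((s - x) - pi) / 2\<bar>"
  proof -
    have "\<bar>\<theta> - 1 / 2\<bar> * \<bar>(s - x) - pi\<bar> \<le> (1 / 2) * \<bar>(s - x) - pi\<bar>"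
      using assms by (intro mult_right_mono) (auto simp: abs_if)
    then show ?thesis by (simp add: abs_mult)
  qed
  have "\<bar>((s - x) - pi) / 2\<bar> \<le> pi" using assms by (simp add: abs_le_iff field_simps)
  then have "cos \<bar>((s - x) - pi) / 2\<bar> \<le> cos \<bar>(\<theta> - 1 / 2) * ((s - x) - pi)\<bar>"
    using le by (intro cos_monotone_0_pi_le) auto
  moreover have "cos (((s - x) - pi) / 2) = sin ((s - x) / 2)"
  proof -
    have "((s - x) - pi) / 2 = - (pi / 2 - (s - x) / 2)" by (simp add: field_simps)
    then show ?thesis using cos_minus [of "pi / 2 - (s - x) / 2"] sin_cos_eq [of "(s - x) / 2"]
      by (simp only: of_real_eq_id id_apply)
  qed
  ultimately have "sin ((s - x) / 2) \<le> cos ((\<theta> - 1 / 2) * ((s - x) - pi))" by (simp only: cos_abs_real)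
  then show ?thesis using s by (simp add: power2_eq_square mult.assoc mult_left_mono)
qed

lemma nonresonant_power_unbounded:
  assumes "fib.z \<xi> \<noteq> 1"
  shows "\<exists>k\<ge>N. fib.z \<xi> ^ k \<noteq> 1"
proof (cases "fib.z \<xi> ^ N = 1")
  case True
  then have "fib.z \<xi> ^ Suc N \<noteq> 1" using assms by simp
  then show ?thesis by (intro exI [of _ "Suc N"]) auto
qed auto

text \<open>A window of one period in which \<open>Bp \<xi>\<close> dips below \<open>m\<close>, its
  smaller end value; the boundary factor of the period identity is then at most
  \<open>2 * exp (- k * m)\<close>. For nonnegative mean the window starts at a descent, for
  negative mean it ends at an ascent.\<close>

lemma sign_change_imp_drop:
  assumes "changes_sign (dot \<xi> b)"
  shows "\<exists>x m s0. x < s0 \<and> s0 < x + 2 * pi \<and> Bp \<xi> s0 < m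
     \<and> (\<forall>k. norm (fib.z \<xi> ^ k - 1) * exp (- real k * Bp \<xi> x) \<le> 2 * exp (- real k * m))"
proof -
  have Bd: "(Bp \<xi> has_real_derivative dot \<xi> b t) (at t)" for t
    using fib.B by (simp add: has_real_derivative_iff_has_vector_derivative)
  have nz: "norm (fib.z \<xi> ^ k) = exp (- real k * (2 * pi * \<beta>m \<xi>))" for k
    by (simp add: norm_power fib.norm_z exp_of_nat_mult [symmetric])
  have nd: "norm (fib.z \<xi> ^ k - 1) \<le> norm (fib.z \<xi> ^ k) + 1" for k
    using norm_triangle_ineq4 [of "fib.z \<xi> ^ k" 1] by simp
  show ?thesis
  proof (cases "\<beta>m \<xi> \<ge> 0")
    case True
    obtain x where x: "dot \<xi> b x < 0" using assms unfolding changes_sign_def by blast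
    obtain h where h: "h > 0" "\<And>e. 0 < e \<Longrightarrow> e < h \<Longrightarrow> Bp \<xi> (x + e) < Bp \<xi> x"
      using DERIV_neg_dec_right [OF Bd x] by blast
    define e where "e = min (h / 2) pi"
    have e: "0 < e" "e < h" "e < 2 * pi" using h pi_gt_zero by (auto simp: e_def min_def)
    have "norm (fib.z \<xi> ^ k - 1) * exp (- real k * Bp \<xi> x) \<le> 2 * exp (- real k * Bp \<xi> x)" for k
      using nd [of k] True unfolding nz by (intro mult_right_mono) (auto intro: order_trans)
    then show ?thesis using e h(2) [OF e(1,2)] by (intro exI [of _ x] exI [of _ "Bp \<xi> x"] exI [of _ "x + e"]) auto
  next
    case False
    obtain y where y: "dot \<xi> b y > 0" using assms unfolding changes_sign_def by blast
    obtain h where h: "h > 0" "\<And>e. 0 < e \<Longrightarrow> e < h \<Longrightarrow> Bp \<xi> (y - e) < Bp \<xi> y"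
      using DERIV_pos_inc_left [OF Bd y] by blast
    define e where "e = min (h / 2) pi"
    have e: "0 < e" "e < h" "e < 2 * pi" using h pi_gt_zero by (auto simp: e_def min_def)
    define x where "x = y - 2 * pi"
    have By: "Bp \<xi> y = Bp \<xi> x + 2 * pi * \<beta>m \<xi>" using fib.B_per [of \<xi> x] by (simp add: x_def)
    have "norm (fib.z \<xi> ^ k - 1) * exp (- real k * Bp \<xi> x) \<le> 2 * exp (- real k * Bp \<xi> y)" for k
    proof -
      have "1 \<le> norm (fib.z \<xi> ^ k)" unfolding nz using False by (simp add: mult_nonneg_nonpos)
      then have "norm (fib.z \<xi> ^ k - 1) * exp (- real k * Bp \<xi> x) \<le> (2 * norm (fib.z \<xi> ^ k)) * exp (- real k * Bp \<xi> x)"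
        using nd [of k] by (intro mult_right_mono) auto
      also have "\<dots> = 2 * exp (- real k * Bp \<xi> y)"
        unfolding nz By by (simp add: exp_add [symmetric] algebra_simps)
      finally show ?thesis .
    qed
    then show ?thesis using e h(2) [OF e(1,2)] by (intro exI [of _ x] exI [of _ "Bp \<xi> y"] exI [of _ "y - e"]) (auto simp: x_def)
  qed
qed

text \<open>For multiples of a nonresonant frequency the period identity equates a kernel integral
  of order at least \<open>exp (- k * (m - \<kappa>))\<close>, up to damping, with boundary terms of
  order \<open>exp (- k * m)\<close> if solutions are bounded.\<close>

lemma sign_change_imp_resonant:
  assumes solv: "globally_solvable \<omega> (L_op a b)" and sign: "changes_sign (dot \<xi>0 b)"
  shows "fib.z \<xi>0 = 1"
proof (rule ccontr)
  assume nr: "fib.z \<xi>0 \<noteq> 1"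
  obtain x m s0 where xm: "x < s0" "s0 < x + 2 * pi" "Bp \<xi>0 s0 < m"
    and zb: "\<And>k. norm (fib.z \<xi>0 ^ k - 1) * exp (- real k * Bp \<xi>0 x) \<le> 2 * exp (- real k * m)"
    using sign_change_imp_drop [OF sign] by blast
  define g where "g s = 2 * (sin ((s - x) / 2))\<^sup>2" for s
  have "sin ((s0 - x) / 2) > 0" using xm by (intro sin_gt_zero) auto
  then have "g s0 > 0" by (simp add: g_def)
  then obtain c \<kappa> where c: "c > 0" "\<kappa> > 0" "\<And>k::nat. c * exp (- real k * (m - \<kappa>)) \<le> integral {x..x + 2 * pi} (\<lambda>s. exp (- real k * Bp \<xi>0 s) * g s)"
  proof -
    have "continuous_on UNIV g" "g s \<ge> 0" for s unfolding g_def by (intro continuous_intros) auto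
    from exp_weighted_integral_lower_bound [OF fib.B_cont this xm(1,2) \<open>g s0 > 0\<close> xm(3)] show ?thesis
      using that by blast
  qed
  define \<epsilon> where "\<epsilon> = \<kappa> / (4 * (l1 \<xi>0 + 1) * (\<omega> 1 + 1))"
  have \<epsilon>: "\<epsilon> > 0" using c(2) w_nonneg [of 1] by (simp add: \<epsilon>_def add_nonneg_pos)
  \<comment> \<open>Resonant fibres receive zero, so no compatibility condition arises for
    them.\<close>
  define \<kappa>0 where "\<kappa>0 \<xi> = (if fib.z \<xi> \<noteq> 1 then 1 else 0 :: complex)" for \<xi>
  \<comment> \<open>The next phase is subtracted with equal value at \<open>x\<close>; this creates
    the zeros at both ends of the window.\<close>
  define \<kappa>1 where "\<kappa>1 \<xi> = (if fib.z \<xi> \<noteq> 1 then - cis x else 0)" for \<xi>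
  define f where "f \<xi> t = of_real (exp (- (2 * \<epsilon>) * \<omega> (l1 \<xi>))) *
      (\<kappa>0 \<xi> * ph \<xi> \<lfloor>\<alpha>m \<xi>\<rfloor> t + (\<kappa>1 \<xi> * ph \<xi> (\<lfloor>\<alpha>m \<xi>\<rfloor> + 1) t + 0 * ph \<xi> (\<lfloor>\<alpha>m \<xi>\<rfloor> - 1) t))" for \<xi> t
  have ex: "\<exists>u. ode (symb a b \<xi>) (f \<xi>) u" for \<xi>
  proof (cases "fib.z \<xi> = 1")
    case True
    then have "f \<xi> = (\<lambda>_. 0)" by (auto simp: f_def \<kappa>0_def \<kappa>1_def)
    then show ?thesis by (intro exI [of _ "\<lambda>_. 0"]) (auto simp: ode_def)
  next
    case False
    have "continuous_on UNIV (f \<xi>)" unfolding f_def by (intro continuous_intros ode_continuous [OF ph_ode])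
    moreover have "f \<xi> (t + 2 * pi) = f \<xi> t" for t using ph_ode [of \<xi>] by (simp add: f_def ode_def)
    ultimately show ?thesis using fib.ode_exists_nonresonant [OF False] unfolding fib_c by blast
  qed
  have "\<exists>U. \<forall>\<xi>. \<exists>v. ode (symb a b \<xi>) (f \<xi>) v \<and> (\<forall>t. norm (v t) \<le> U)"
    unfolding f_def
    by (rule bounded_solutions_ph [OF solv \<epsilon>, of \<kappa>0 \<kappa>1 "\<lambda>_. 0"]) (use ex in \<open>auto simp: f_def [abs_def] \<kappa>0_def \<kappa>1_def\<close>)
  then obtain U where U: "\<And>\<xi>. \<exists>v. ode (symb a b \<xi>) (f \<xi>) v \<and> (\<forall>t. norm (v t) \<le> U)" by blast
  show False
  proof (rule exponential_growth_unbounded [OF c(1,2) _ \<epsilon>_def])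
    show "\<exists>k\<ge>N. fib.z \<xi>0 ^ k \<noteq> 1" for N by (rule nonresonant_power_unbounded [OF nr])
    fix k :: nat assume k: "k \<ge> 1" "fib.z \<xi>0 ^ k \<noteq> 1"
    define \<xi> where "\<xi> = mulx k \<xi>0"
    have z: "fib.z \<xi> = fib.z \<xi>0 ^ k" unfolding \<xi>_def by (rule mulx_simps)
    have Bk: "Bp \<xi> s = real k * Bp \<xi>0 s" for s unfolding \<xi>_def by (rule mulx_simps)
    obtain v where v: "ode (symb a b \<xi>) (f \<xi>) v" "\<And>t. norm (v t) \<le> U" using U by blast
    define \<theta> where "\<theta> = \<alpha>m \<xi> - of_int \<lfloor>\<alpha>m \<xi>\<rfloor>"
    have \<theta>: "0 \<le> \<theta>" "\<theta> \<le> 1" unfolding \<theta>_def by linarith+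
    define q where "q = cis (- (\<theta> * x)) * (- \<i>) * cis (- ((\<theta> - 1 / 2) * pi))"
    define e where "e = exp (- (2 * \<epsilon>) * \<omega> (l1 \<xi>))"
    define I where "I = (fib.z \<xi> - 1) * (fib.E \<xi> x * v x)"
    have Ef: "fib.E \<xi> s * f \<xi> s = of_real (e * exp (- Bp \<xi> s)) * (cis (\<theta> * s) - cis x * cis ((\<theta> - 1) * s))" for s
    proof -
      have "fib.E \<xi> s * f \<xi> s = of_real e * (fib.E \<xi> s * ph \<xi> \<lfloor>\<alpha>m \<xi>\<rfloor> s - cis x * (fib.E \<xi> s * ph \<xi> (\<lfloor>\<alpha>m \<xi>\<rfloor> + 1) s))"
        using k(2) by (simp add: f_def \<kappa>0_def \<kappa>1_def z e_def algebra_simps)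
      also have "\<dots> = of_real (e * exp (- Bp \<xi> s)) * (cis (\<theta> * s) - cis x * cis ((\<theta> - 1) * s))"
        unfolding E_ph by (simp add: \<theta>_def right_diff_distrib mult.left_commute diff_diff_eq)
      finally show ?thesis .
    qed
    have "((\<lambda>s. fib.E \<xi> s * f \<xi> s) has_integral I) {x..x + 2 * pi}"
      unfolding I_def using fib.ode_integral_period [unfolded fib_c, OF v(1)] .
    from has_integral_linear [OF has_integral_mult_right [OF this, of q] bounded_linear_Re]
    have "((\<lambda>s. Re (q * (fib.E \<xi> s * f \<xi> s))) has_integral Re (q * I)) {x..x + 2 * pi}"
      by (simp only: o_def)
    moreover have "Re (q * (fib.E \<xi> s * f \<xi> s)) = e * exp (- Bp \<xi> s) * (2 * sin ((s - x) / 2) * cos ((\<theta> - 1 / 2) * ((s - x) - pi)))" for s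
    proof -
      have "q * (fib.E \<xi> s * f \<xi> s) = of_real (e * exp (- Bp \<xi> s)) * (q * (cis (\<theta> * s) - cis x * cis ((\<theta> - 1) * s)))"
        unfolding Ef by (rule mult.left_commute)
      then show ?thesis
        by (simp only: scaleR_conv_of_real [symmetric] scaleR_complex.sel nonresonant_kernel_real_part [of \<theta> x s, folded q_def])
    qed
    ultimately have up: "((\<lambda>s. e * exp (- Bp \<xi> s) * (2 * sin ((s - x) / 2) * cos ((\<theta> - 1 / 2) * ((s - x) - pi)))) has_integral Re (q * I)) {x..x + 2 * pi}"
      by simp
    have lo: "((\<lambda>s. e * (exp (- real k * Bp \<xi>0 s) * g s)) has_integral e * integral {x..x + 2 * pi} (\<lambda>s. exp (- real k * Bp \<xi>0 s) * g s)) {x..x + 2 * pi}"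
      unfolding g_def
      by (intro has_integral_mult_right integrable_integral integrable_continuous_real continuous_intros continuous_on_subset [OF fib.B_cont]) auto
    have "e * integral {x..x + 2 * pi} (\<lambda>s. exp (- real k * Bp \<xi>0 s) * g s) \<le> Re (q * I)"
    proof (rule has_integral_le [OF lo up])
      fix s assume "s \<in> {x..x + 2 * pi}"
      then have "g s \<le> 2 * sin ((s - x) / 2) * cos ((\<theta> - 1 / 2) * ((s - x) - pi))"
        unfolding g_def using \<theta> by (intro nonresonant_kernel_lower_bound) auto
      then show "e * (exp (- real k * Bp \<xi>0 s) * g s) \<le> e * exp (- Bp \<xi> s) * (2 * sin ((s - x) / 2) * cos ((\<theta> - 1 / 2) * ((s - x) - pi)))"
        unfolding Bk mult.assoc [of e] by (intro mult_left_mono) (auto simp: e_def)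
    qed
    also have "\<dots> \<le> norm (q * I)" by (rule complex_Re_le_cmod)
    also have "\<dots> = norm (fib.z \<xi>0 ^ k - 1) * exp (- real k * Bp \<xi>0 x) * norm (v x)"
      by (simp add: q_def I_def norm_mult fib.norm_E Bk z)
    also have "\<dots> \<le> 2 * exp (- real k * m) * U"
      using v(2) by (intro mult_mono zb) auto
    finally have "e * integral {x..x + 2 * pi} (\<lambda>s. exp (- real k * Bp \<xi>0 s) * g s) \<le> 2 * exp (- real k * m) * U" .
    moreover have "e * (c * exp (- real k * (m - \<kappa>))) \<le> e * integral {x..x + 2 * pi} (\<lambda>s. exp (- real k * Bp \<xi>0 s) * g s)"
      by (intro mult_left_mono c(3)) (simp add: e_def)
    ultimately have "e * (c * exp (- real k * (m - \<kappa>))) \<le> 2 * exp (- real k * m) * U" by (rule order_trans [rotated])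
    then show "exp (- (2 * \<epsilon>) * \<omega> (real k * l1 \<xi>0)) * (c * exp (- real k * (m - \<kappa>))) \<le> (2 * U) * exp (- real k * m)"
      by (simp add: e_def \<xi>_def mulx_simps mult_ac)
  qed simp
qed

text \<open>The ends \<open>p\<close>, \<open>q\<close> have height at least \<open>r\<close>, so
  boundary terms are of order \<open>exp (- k * r)\<close>, while both arcs dip below
  \<open>r\<close>. A compatible right-hand side built from opposite signs on the arcs transports an
  amount of order \<open>exp (- k * (r - \<kappa>))\<close>, up to damping, which bounded solutions
  cannot carry.\<close>

lemma resonant_imp_connected:
  assumes solv: "globally_solvable \<omega> (L_op a b)" and z0: "fib.z \<xi>0 = 1"
  shows "connected (Omega_set b \<xi>0 r0)"
proof (rule ccontr)
  assume disc: "\<not> connected (Omega_set b \<xi>0 r0)"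
  have \<beta>0: "\<beta>m \<xi>0 = 0" using z0 by (simp add: fib_z_eq_1_iff)
  define r where "r = r0 + Bp \<xi>0 0"
  have per: "Bp \<xi>0 (t + 2 * pi) = Bp \<xi>0 t" for t by (simp add: fib.B_per \<beta>0)
  obtain p q t1 t2 where pq: "p < t1" "t1 < q" "q < t2" "t2 < p + 2 * pi"
    and Bpq: "Bp \<xi>0 p \<ge> r" "Bp \<xi>0 q \<ge> r" "Bp \<xi>0 t1 < r" "Bp \<xi>0 t2 < r"
    using disconnected_sublevel_imp_points [of "Bp \<xi>0" r, OF per] disc unfolding Omega_set_eq [OF \<beta>0] r_def by blast
  define h where "h s = sin ((s - p) / 2) * sin ((s - q) / 2)" for s
    \<comment> \<open>a trigonometric polynomial of degree one, negative on \<open>(p, q)\<close> and positive on \<open>(q, p + 2 * pi)\<close>\<close>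
  have hc: "continuous_on A h" for A unfolding h_def by (intro continuous_intros) auto
  have h_le: "\<bar>h s\<bar> \<le> 1" for s
    unfolding h_def abs_mult using mult_mono [of "\<bar>sin ((s - p) / 2)\<bar>" 1 "\<bar>sin ((s - q) / 2)\<bar>" 1] by simp
  have h1: "h s \<le> 0" if "p \<le> s" "s \<le> q" for s
  proof -
    have "sin ((s - p) / 2) \<ge> 0" "sin ((q - s) / 2) \<ge> 0" using that pq by (auto intro!: sin_ge_zero)
    moreover have "sin ((s - q) / 2) = - sin ((q - s) / 2)" unfolding sin_minus [symmetric] by (simp add: minus_divide_left)
    ultimately show ?thesis by (simp add: h_def mult_nonneg_nonneg)
  qed
  have h2: "h s \<ge> 0" if "q \<le> s" "s \<le> p + 2 * pi" for s
    unfolding h_def using that pq by (intro mult_nonneg_nonneg sin_ge_zero) auto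
  have ht1: "- h t1 > 0"
  proof -
    have "sin ((t1 - p) / 2) > 0" "sin ((q - t1) / 2) > 0" using pq by (auto intro!: sin_gt_zero)
    moreover have "sin ((t1 - q) / 2) = - sin ((q - t1) / 2)" unfolding sin_minus [symmetric] by (simp add: minus_divide_left)
    ultimately show ?thesis by (simp add: h_def)
  qed
  have ht2: "h t2 > 0" unfolding h_def using pq by (intro mult_pos_pos sin_gt_zero) auto
  have "continuous_on UNIV (\<lambda>s. - h s)" "- h s \<ge> 0" if "p \<le> s" "s \<le> q" for s
    using h1 [OF that] hc by (auto intro: continuous_on_minus)
  then obtain c1 \<kappa>1 where c1: "c1 > 0" "\<kappa>1 > 0" "\<And>k::nat. c1 * exp (- real k * (r - \<kappa>1)) \<le> integral {p..q} (\<lambda>s. exp (- real k * Bp \<xi>0 s) * - h s)"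
    using exp_weighted_integral_lower_bound [OF fib.B_cont continuous_on_minus [OF hc] _ pq(1,2) ht1 Bpq(3)] pq by fastforce
  obtain c2 \<kappa>2 where c2: "c2 > 0" "\<kappa>2 > 0" "\<And>k::nat. c2 * exp (- real k * (r - \<kappa>2)) \<le> integral {q..p + 2 * pi} (\<lambda>s. exp (- real k * Bp \<xi>0 s) * h s)"
    using exp_weighted_integral_lower_bound [OF fib.B_cont hc h2 pq(3,4) ht2 Bpq(4)] by blast
  define c where "c = min c1 c2"
  define \<kappa> where "\<kappa> = min \<kappa>1 \<kappa>2"
  have c: "c > 0" "\<kappa> > 0" using c1 c2 by (auto simp: c_def \<kappa>_def)
  define \<epsilon> where "\<epsilon> = \<kappa> / (4 * (l1 \<xi>0 + 1) * (\<omega> 1 + 1))"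
  have \<epsilon>: "\<epsilon> > 0" using c(2) w_nonneg [of 1] by (simp add: \<epsilon>_def add_nonneg_pos)
  define W where "W \<xi> s = exp (- Bp \<xi> s)" for \<xi> s
  have Wc: "continuous_on A (W \<xi>)" for A \<xi> unfolding W_def by (intro continuous_intros continuous_on_subset [OF fib.B_cont]) auto
  have int: "W \<xi> integrable_on {x..y}" "(\<lambda>s. W \<xi> s * h s) integrable_on {x..y}" for \<xi> x y
    by (intro integrable_continuous_real continuous_intros Wc hc)+
  define lm where "lm \<xi> = integral {p..p + 2 * pi} (\<lambda>s. W \<xi> s * h s) / integral {p..p + 2 * pi} (W \<xi>)" for \<xi>
    \<comment> \<open>makes \<open>h - lm \<xi>\<close> orthogonal to the kernel, as resonance requires\<close>
  have Wpos: "integral {p..p + 2 * pi} (W \<xi>) > 0" for \<xi>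
  proof -
    have "integral {p..p + 2 * pi} (W \<xi>) \<noteq> 0"
      using integral_eq_0_iff [OF Wc, of p "p + 2 * pi" \<xi>] pi_gt_zero by (auto simp: W_def)
    moreover have "integral {p..p + 2 * pi} (W \<xi>) \<ge> 0" by (intro integral_nonneg int) (simp add: W_def)
    ultimately show ?thesis by simp
  qed
  have lm_le: "\<bar>lm \<xi>\<bar> \<le> 1" for \<xi>
  proof -
    have "norm (integral {p..p + 2 * pi} (\<lambda>s. W \<xi> s * h s)) \<le> integral {p..p + 2 * pi} (W \<xi>)"
      by (intro integral_norm_bound_integral int) (use h_le in \<open>auto simp: W_def abs_mult\<close>)
    then show ?thesis using Wpos [of \<xi>] by (simp add: lm_def divide_le_eq)
  qed
  define M where "M = (p + q) / 2"
  \<comment> \<open>Coefficients of \<open>h - lm \<xi>\<close> in the characters 1,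
    \<open>cis (- s)\<close> and \<open>cis s\<close>, read off from the product formula with
    midpoint \<open>M\<close>.\<close>
  define \<kappa>0 where "\<kappa>0 \<xi> = (if fib.z \<xi> = 1 then of_real (cos ((q - p) / 2) / 2 - lm \<xi>) else 0 :: complex)" for \<xi>
  define \<kappa>1' where "\<kappa>1' \<xi> = (if fib.z \<xi> = 1 then - cis M / 4 else 0)" for \<xi>
  define \<kappa>2' where "\<kappa>2' \<xi> = (if fib.z \<xi> = 1 then - cis (- M) / 4 else 0)" for \<xi>
  define f where "f \<xi> t = of_real (exp (- (2 * \<epsilon>) * \<omega> (l1 \<xi>))) *
      (\<kappa>0 \<xi> * ph \<xi> \<lfloor>\<alpha>m \<xi>\<rfloor> t + (\<kappa>1' \<xi> * ph \<xi> (\<lfloor>\<alpha>m \<xi>\<rfloor> + 1) t + \<kappa>2' \<xi> * ph \<xi> (\<lfloor>\<alpha>m \<xi>\<rfloor> - 1) t))" for \<xi> t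
  have Ef: "fib.E \<xi> s * f \<xi> s = of_real (exp (- (2 * \<epsilon>) * \<omega> (l1 \<xi>)) * (W \<xi> s * h s - lm \<xi> * W \<xi> s))"
    if "fib.z \<xi> = 1" for \<xi> s
  proof -
    \<comment> \<open>Resonance makes the integer part exact, so multiplication by \<open>E\<close>
      cancels the base phase completely and the amplitude stays real.\<close>
    have "\<alpha>m \<xi> \<in> \<int>" using that by (simp add: fib_z_eq_1_iff)
    then have \<alpha>: "\<alpha>m \<xi> = of_int \<lfloor>\<alpha>m \<xi>\<rfloor>" by (metis Ints_cases floor_of_int)
    have E0: "fib.E \<xi> s * ph \<xi> \<lfloor>\<alpha>m \<xi>\<rfloor> s = of_real (W \<xi> s)"
      unfolding E_ph W_def by (subst \<alpha>) simp
    have E1: "fib.E \<xi> s * ph \<xi> (\<lfloor>\<alpha>m \<xi>\<rfloor> + 1) s = of_real (W \<xi> s) * cis (- s)"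
      unfolding E_ph W_def by (subst \<alpha>) simp
    have E2: "fib.E \<xi> s * ph \<xi> (\<lfloor>\<alpha>m \<xi>\<rfloor> - 1) s = of_real (W \<xi> s) * cis s"
      unfolding E_ph W_def by (subst \<alpha>) simp
    have hs: "of_real (h s) = of_real (cos ((q - p) / 2) / 2) - cis M / 4 * cis (- s) - cis (- M) / 4 * cis s"
    proof -
      have "h s = (cos ((q - p) / 2) - cos (s - M)) / 2"
        unfolding h_def sin_half_product by (simp add: M_def cis_mult)
      then have 1: "complex_of_real (h s) = of_real (cos ((q - p) / 2) / 2) - of_real (cos (s - M)) / 2"
        by (simp add: diff_divide_distrib)
      have "cis M * cis (- s) + cis (- M) * cis s = 2 * of_real (cos (s - M))"
        unfolding cis_mult by (simp add: complex_eq_iff cos_diff sin_diff)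
      moreover have "cis M / 4 * cis (- s) + cis (- M) / 4 * cis s = (cis M * cis (- s) + cis (- M) * cis s) / 4"
        by (simp add: add_divide_distrib)
      ultimately have 2: "of_real (cos (s - M)) / 2 = cis M / 4 * cis (- s) + cis (- M) / 4 * cis s" by simp
      show ?thesis unfolding 1 2 by simp
    qed
    have "fib.E \<xi> s * f \<xi> s = of_real (exp (- (2 * \<epsilon>) * \<omega> (l1 \<xi>))) *
      (\<kappa>0 \<xi> * (fib.E \<xi> s * ph \<xi> \<lfloor>\<alpha>m \<xi>\<rfloor> s) + (\<kappa>1' \<xi> * (fib.E \<xi> s * ph \<xi> (\<lfloor>\<alpha>m \<xi>\<rfloor> + 1) s) + \<kappa>2' \<xi> * (fib.E \<xi> s * ph \<xi> (\<lfloor>\<alpha>m \<xi>\<rfloor> - 1) s)))"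
      unfolding f_def by (simp only: distrib_left mult.left_commute)
    also have "\<dots> = of_real (exp (- (2 * \<epsilon>) * \<omega> (l1 \<xi>))) * (of_real (W \<xi> s) * (of_real (h s) - of_real (lm \<xi>)))"
      unfolding E0 E1 E2 hs using that by (simp add: \<kappa>0_def \<kappa>1'_def \<kappa>2'_def algebra_simps)
    finally show ?thesis by (simp add: algebra_simps)
  qed
  have ex: "\<exists>u. ode (symb a b \<xi>) (f \<xi>) u" for \<xi>
  proof (cases "fib.z \<xi> = 1")
    case False
    then have "f \<xi> = (\<lambda>_. 0)" by (auto simp: f_def \<kappa>0_def \<kappa>1'_def \<kappa>2'_def)
    then show ?thesis by (intro exI [of _ "\<lambda>_. 0"]) (auto simp: ode_def)
  next
    case True
    have fc: "continuous_on UNIV (f \<xi>)" unfolding f_def by (intro continuous_intros ode_continuous [OF ph_ode])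
    have fp: "f \<xi> (t + 2 * pi) = f \<xi> t" for t using ph_ode [of \<xi>] by (simp add: f_def ode_def)
    have "((\<lambda>s. W \<xi> s * h s - lm \<xi> * W \<xi> s) has_integral
        integral {p..p + 2 * pi} (\<lambda>s. W \<xi> s * h s) - lm \<xi> * integral {p..p + 2 * pi} (W \<xi>)) {p..p + 2 * pi}"
      by (intro has_integral_diff has_integral_mult_right integrable_integral int)
    then have "((\<lambda>s. W \<xi> s * h s - lm \<xi> * W \<xi> s) has_integral 0) {p..p + 2 * pi}"
      using Wpos [of \<xi>] by (simp add: lm_def)
    from has_integral_linear [OF has_integral_mult_right [OF this, of "exp (- (2 * \<epsilon>) * \<omega> (l1 \<xi>))"] bounded_linear_of_real]
    have "((\<lambda>s. fib.E \<xi> s * f \<xi> s) has_integral 0) {p..p + 2 * pi}"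
      unfolding Ef [OF True] by (simp add: o_def)
    then show ?thesis using fib.ode_exists_resonant [OF True fc fp] unfolding fib_c by blast
  qed
  have "\<exists>U. \<forall>\<xi>. \<exists>v. ode (symb a b \<xi>) (f \<xi>) v \<and> (\<forall>t. norm (v t) \<le> U)"
    unfolding f_def
  proof (rule bounded_solutions_ph [OF solv \<epsilon>])
    show "norm (\<kappa>0 \<xi>) \<le> 2" for \<xi>
    proof -
      have "\<bar>cos ((q - p) / 2) / 2 - lm \<xi>\<bar> \<le> 2" using lm_le [of \<xi>] abs_cos_le_one [of "(q - p) / 2"] by linarith
      then show ?thesis by (simp add: \<kappa>0_def del: of_real_diff)
    qed
    show "norm (\<kappa>1' \<xi>) \<le> 2" "norm (\<kappa>2' \<xi>) \<le> 2" for \<xi> by (simp_all add: \<kappa>1'_def \<kappa>2'_def norm_divide)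
  qed (use ex in \<open>simp add: f_def [abs_def]\<close>)
  then obtain U where U: "\<And>\<xi>. \<exists>v. ode (symb a b \<xi>) (f \<xi>) v \<and> (\<forall>t. norm (v t) \<le> U)" by blast
  show False
  proof (rule exponential_growth_unbounded [OF c _ \<epsilon>_def, of "\<lambda>_. True"])
    fix k :: nat assume "k \<ge> 1"
    define \<xi> where "\<xi> = mulx k \<xi>0"
    have z: "fib.z \<xi> = 1" unfolding \<xi>_def by (simp add: mulx_simps(5) z0)
    have Bk: "Bp \<xi> s = real k * Bp \<xi>0 s" for s unfolding \<xi>_def by (rule mulx_simps)
    obtain v where v: "ode (symb a b \<xi>) (f \<xi>) v" "\<And>t. norm (v t) \<le> U" using U by blast
    define e where "e = exp (- (2 * \<epsilon>) * \<omega> (l1 \<xi>))"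
    have e: "e > 0" by (simp add: e_def)
    define X where "X = integral {p..q} (\<lambda>s. W \<xi> s * - h s)"
    define Y where "Y = integral {q..p + 2 * pi} (\<lambda>s. W \<xi> s * h s)"
    define w1 where "w1 = integral {p..q} (W \<xi>)"
    define w2 where "w2 = integral {q..p + 2 * pi} (W \<xi>)"
    have X': "integral {p..q} (\<lambda>s. W \<xi> s * h s) = - X" by (simp add: X_def)
    have w: "w1 \<ge> 0" "w2 \<ge> 0" unfolding w1_def w2_def by (intro integral_nonneg int; simp add: W_def)+
    have wsum: "integral {p..p + 2 * pi} (W \<xi>) = w1 + w2"
      unfolding w1_def w2_def by (rule Henstock_Kurzweil_Integration.integral_combine [symmetric]) (use pq int in auto)
    have hsum: "integral {p..p + 2 * pi} (\<lambda>s. W \<xi> s * h s) = - X + Y"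
      unfolding X' [symmetric] Y_def by (rule Henstock_Kurzweil_Integration.integral_combine [symmetric]) (use pq int in auto)
    have wpos: "w1 + w2 > 0" using Wpos [of \<xi>] wsum by simp
    have lam: "lm \<xi> = (Y - X) / (w1 + w2)" by (simp add: lm_def wsum hsum)
    have "((\<lambda>s. W \<xi> s * h s - lm \<xi> * W \<xi> s) has_integral - X - lm \<xi> * w1) {p..q}"
      unfolding X' [symmetric] w1_def by (intro has_integral_diff has_integral_mult_right integrable_integral int)
    from has_integral_linear [OF has_integral_mult_right [OF this, of e] bounded_linear_of_real]
    have I1: "((\<lambda>s. fib.E \<xi> s * f \<xi> s) has_integral complex_of_real (e * (- X - lm \<xi> * w1))) {p..q}"
      unfolding Ef [OF z] e_def by (simp only: o_def)
    have I2: "((\<lambda>s. fib.E \<xi> s * f \<xi> s) has_integral fib.E \<xi> q * v q - fib.E \<xi> p * v p) {p..q}"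
      by (rule fib.ode_integral [unfolded fib_c, OF v(1)]) (use pq in simp)
    have "norm (complex_of_real (e * (- X - lm \<xi> * w1))) = norm (fib.E \<xi> q * v q - fib.E \<xi> p * v p)"
      by (rule arg_cong [OF has_integral_unique [OF I1 I2]])
    also have "\<dots> \<le> norm (fib.E \<xi> q) * norm (v q) + norm (fib.E \<xi> p) * norm (v p)"
      unfolding norm_mult [symmetric] by (rule norm_triangle_ineq4)
    also have "\<dots> \<le> exp (- real k * r) * U + exp (- real k * r) * U"
      unfolding fib.norm_E Bk using v(2) Bpq by (intro add_mono mult_mono) (auto intro: mult_left_mono)
    finally have up: "e * \<bar>- X - lm \<xi> * w1\<bar> \<le> 2 * U * exp (- real k * r)"
      using e by (simp add: norm_mult abs_mult del: of_real_mult of_real_diff)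
    have kap: "c * exp (- real k * (r - \<kappa>)) \<le> c' * exp (- real k * (r - \<kappa>'))" if "c \<le> c'" "\<kappa> \<le> \<kappa>'" for c' \<kappa>'
      using that c by (intro mult_mono) (auto intro: mult_left_mono)
    have lo: "c * exp (- real k * (r - \<kappa>)) \<le> X" "c * exp (- real k * (r - \<kappa>)) \<le> Y"
      using order_trans [OF kap c1(3) [of k]] order_trans [OF kap c2(3) [of k]]
      by (auto simp: c_def \<kappa>_def X_def Y_def W_def Bk)
    let ?L = "c * exp (- real k * (r - \<kappa>))"
    \<comment> \<open>Up to sign this is a convex combination of \<open>X\<close> and
      \<open>Y\<close>, so the correction by \<open>lm \<xi>\<close> cannot bring it below the
      smaller of the two.\<close>
    have "- X - lm \<xi> * w1 = - ((X * w2 + Y * w1) / (w1 + w2))"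
      unfolding lam using wpos by (simp add: field_simps)
    moreover have "?L \<le> (X * w2 + Y * w1) / (w1 + w2)"
    proof -
      have "?L * w2 + ?L * w1 \<le> X * w2 + Y * w1" using lo w by (intro add_mono mult_right_mono)
      then show ?thesis using wpos by (simp add: le_divide_eq distrib_left add.commute)
    qed
    ultimately have "?L \<le> \<bar>- X - lm \<xi> * w1\<bar>" by linarith
    from mult_left_mono [OF this less_imp_le [OF e]] up
    have "e * ?L \<le> 2 * U * exp (- real k * r)" by linarith
    then show "exp (- (2 * \<epsilon>) * \<omega> (real k * l1 \<xi>0)) * ?L \<le> (2 * U) * exp (- real k * r)"
      unfolding e_def \<xi>_def mulx_simps .
  qed auto
qed

section \<open>Small divisors from solvability\<close>

lemma l1_le_euclid: "l1 \<xi> \<le> real CARD('n) * sqrt (real_of_int \<tau> ^ 2 + (\<Sum>j\<in>UNIV. real_of_int (\<xi> j) ^ 2))"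
  for \<xi> :: "'n \<Rightarrow> int"
proof -
  obtain i where i: "l1 \<xi> \<le> real CARD('n) * \<bar>real_of_int (\<xi> i)\<bar>" using l1_le_card_coord by blast
  have "real_of_int (\<xi> i) ^ 2 \<le> (\<Sum>j\<in>UNIV. real_of_int (\<xi> j) ^ 2)" by (rule member_le_sum) auto
  then have "\<bar>real_of_int (\<xi> i)\<bar> \<le> sqrt (real_of_int \<tau> ^ 2 + (\<Sum>j\<in>UNIV. real_of_int (\<xi> j) ^ 2))"
    by (intro real_le_rsqrt) (simp add: add_increasing)
  then show ?thesis using i by (meson mult_left_mono of_nat_0_le_iff order_trans)
qed

text \<open>If \<open>w\<close> solves the homogeneous equation with symbol shifted by
  \<open>- \<nu>\<close>, then \<open>w / (\<i> * \<nu>)\<close> solves the original one with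
  right-hand side \<open>w\<close>. Its sup norm is explicit, so a bound on the unique solution is a
  lower bound for \<open>\<nu>\<close>.\<close>

lemma EDC2_of_solvable:
  assumes solv: "globally_solvable \<omega> (L_op a b)"
  shows "EDC2 \<omega> (\<lambda>j. mean (a j)) (\<lambda>j. mean (b j))"
proof -
  define \<nu> where "\<nu> \<xi> = wm \<xi> + of_int (- round (\<alpha>m \<xi>))" for \<xi>
    \<comment> \<open>the divisor of smallest modulus at \<open>\<xi>\<close>; shifting the symbol by it makes the homogeneous equation resonant\<close>
  have nz: "\<nu> \<xi> \<noteq> 0" if "fib.z \<xi> \<noteq> 1" for \<xi>
  proof
    assume "\<nu> \<xi> = 0"
    then have "wm \<xi> = of_int (round (\<alpha>m \<xi>))" by (simp add: \<nu>_def)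
    then have "\<alpha>m \<xi> = of_int (round (\<alpha>m \<xi>))" "\<beta>m \<xi> = 0" by (auto simp: wm_def complex_eq_iff)
    then show False using that unfolding fib_z_eq_1_iff by (metis Ints_of_int)
  qed
  obtain R where R: "R \<ge> 0" "\<And>\<xi>. \<bar>\<beta>m \<xi>\<bar> \<le> R * l1 \<xi>" using abs_\<beta>m_le by blast
  have \<nu>_le: "norm (- \<nu> \<xi>) \<le> (R + 1) * (l1 \<xi> + 1)" for \<xi>
  proof -
    have "norm (\<nu> \<xi>) \<le> \<bar>Re (\<nu> \<xi>)\<bar> + \<bar>Im (\<nu> \<xi>)\<bar>" by (rule cmod_le)
    also have "\<dots> \<le> 1 + R * l1 \<xi>"
      using R(2) [of \<xi>] of_int_round_abs_le [of "\<alpha>m \<xi>"] by (simp add: \<nu>_def wm_def abs_minus_commute)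
    also have "\<dots> \<le> (R + 1) * (l1 \<xi> + 1)" using R(1) l1_nonneg [of \<xi>] by (simp add: algebra_simps)
    finally show ?thesis by simp
  qed
  \<comment> \<open>The exponential has multiplier \<open>exp (2 * pi * \<i> * \<nu> \<xi>)\<close>,
    equal to that of \<open>E\<close>, so the quotient is periodic.\<close>
  define V where "V \<xi> t = exp (\<i> * \<nu> \<xi> * of_real t) * inverse (fib.E \<xi> t)" for \<xi> t
  have Vd: "(V \<xi> has_vector_derivative - \<i> * (symb a b \<xi> t - \<nu> \<xi>) * V \<xi> t) (at t)" for \<xi> t
  proof -
    have "((\<lambda>t. \<i> * \<nu> \<xi> * of_real t) has_vector_derivative \<i> * \<nu> \<xi> * of_real 1) (at t)"
      by (intro has_vector_derivative_mult_right has_vector_derivative_of_real) (rule DERIV_ident)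
    from field_vector_diff_chain_at [OF this DERIV_exp]
    have "((\<lambda>t. exp (\<i> * \<nu> \<xi> * of_real t)) has_vector_derivative \<i> * \<nu> \<xi> * exp (\<i> * \<nu> \<xi> * of_real t)) (at t)"
      by (simp add: o_def)
    from has_vector_derivative_mult [OF this fib.E_inverse_deriv] show ?thesis
      unfolding V_def [abs_def] fib_c by (simp add: algebra_simps)
  qed
  have Vp: "V \<xi> (t + 2 * pi) = V \<xi> t" for \<xi> t
  proof -
    have "exp (2 * pi * \<i> * of_int (- round (\<alpha>m \<xi>))) = 1" unfolding exp_2pi_i_eq_1_iff by simp
    then have "exp (2 * pi * \<i> * \<nu> \<xi>) = fib.z \<xi>"
      unfolding \<nu>_def distrib_left exp_add fib_z by simp
    moreover have "exp (\<i> * \<nu> \<xi> * of_real (t + 2 * pi)) = exp (\<i> * \<nu> \<xi> * of_real t) * exp (2 * pi * \<i> * \<nu> \<xi>)"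
      unfolding exp_add [symmetric] by (simp add: algebra_simps)
    ultimately show ?thesis by (simp add: V_def fib.E_shift)
  qed
  have "\<exists>t0. \<forall>t. norm (V \<xi> t) \<le> norm (V \<xi> t0)" for \<xi>
    by (rule periodic_bounded [of "V \<xi>", OF _ Vp]) (metis Vd continuous_at_imp_continuous_on has_vector_derivative_continuous)
  then obtain t0 where t0: "\<And>\<xi> t. norm (V \<xi> t) \<le> norm (V \<xi> (t0 \<xi>))" by metis
  have Vnz: "V \<xi> t \<noteq> 0" for \<xi> t by (simp add: V_def)
  define w where "w \<xi> t = V \<xi> t * inverse (V \<xi> (t0 \<xi>))" for \<xi> t
  have w1: "w \<xi> (t0 \<xi>) = 1" for \<xi> using Vnz by (simp add: w_def)
  have wd: "(w \<xi> has_vector_derivative - \<i> * (symb a b \<xi> t - \<nu> \<xi>) * w \<xi> t) (at t)" for \<xi> t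
    unfolding w_def [abs_def] using has_vector_derivative_mult_left [OF Vd [of \<xi> t], of "inverse (V \<xi> (t0 \<xi>))"] by (simp add: mult.assoc)
  have wp: "w \<xi> (t + 2 * pi) = w \<xi> t" for \<xi> t by (simp add: w_def Vp)
  have wode: "ode (\<lambda>t. symb a b \<xi> t + - \<nu> \<xi>) (\<lambda>_. 0) (w \<xi>)" for \<xi>
    using wd [of \<xi>] wp by (auto simp: ode_def)
  have wn: "norm (w \<xi> t) \<le> 1" for \<xi> t
    using t0 [of \<xi> t] Vnz [of \<xi> "t0 \<xi>"] by (simp add: w_def divide_le_eq norm_divide flip: divide_inverse)
  show ?thesis
    unfolding EDC2_def
  proof (intro allI impI)
    fix e :: real assume e: "e > 0"
    \<comment> \<open>Anticipates the factor \<open>2 * \<epsilon>\<close> of the scaling and the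
      constant \<open>CARD('n) + 1\<close> for passing from \<open>l1 \<xi>\<close> to the Euclidean
      norm.\<close>
    define \<epsilon> where "\<epsilon> = e / (2 * (real CARD('n) + 1))"
    have \<epsilon>: "\<epsilon> > 0" using e by (simp add: \<epsilon>_def)
    have R1: "R + 1 \<ge> 0" using R(1) by simp
    obtain C \<eta> where C: "C \<ge> 0" "0 < \<eta>" "\<eta> \<le> \<epsilon>" and dec: "\<And>\<xi> \<mu> w. norm \<mu> \<le> (R + 1) * (l1 \<xi> + 1) \<Longrightarrow> ode (\<lambda>t. symb a b \<xi> t + \<mu>) (\<lambda>_. 0) w
      \<Longrightarrow> (\<forall>t. norm (w t) \<le> 1) \<Longrightarrow> decay_int (C * exp (\<epsilon> * \<omega> (l1 \<xi>))) \<eta> (fcoef w) \<and> fser (fcoef w) = w"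
      using homogeneous_coefficient_decay [OF R1 \<epsilon>] by blast
    note wdec = dec [OF \<nu>_le wode allI, OF wn]
    define c where "c \<xi> n = (if fib.z \<xi> = 1 then 0 else fcoef (w \<xi>) n)" for \<xi> n
    have cd: "decay_int (C * exp (\<epsilon> * \<omega> (l1 \<xi>))) \<eta> (c \<xi>)" for \<xi>
      using wdec [of \<xi>] C(1) by (cases "fib.z \<xi> = 1") (auto simp: c_def [abs_def] decay_int_def)
    define d where "d k = exp (- (2 * \<epsilon>) * \<omega> (l1 (\<lambda>j. k (Some j)))) * c (\<lambda>j. k (Some j)) (k None)" for k
    have dd: "decay C \<eta> d"
      using decay_slices_scaled [OF C(2,3) cd] by (simp add: d_def [abs_def])
    define f where "f \<xi> = fser (\<lambda>\<tau>. d (mk \<tau> \<xi>))" for \<xi>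
    have f0: "f \<xi> = (\<lambda>_. 0)" if "fib.z \<xi> = 1" for \<xi>
      using that by (simp add: f_def d_def c_def)
    have f1: "f \<xi> = (\<lambda>t. of_real (exp (- (2 * \<epsilon>) * \<omega> (l1 \<xi>))) * w \<xi> t)" if "fib.z \<xi> \<noteq> 1" for \<xi>
      using that conjunct2 [OF wdec [of \<xi>]] by (auto simp: f_def d_def c_def fser_cmult)
    define u where "u \<xi> t = of_real (exp (- (2 * \<epsilon>) * \<omega> (l1 \<xi>))) / (\<i> * \<nu> \<xi>) * w \<xi> t" for \<xi> t
    have uode: "ode (symb a b \<xi>) (f \<xi>) (u \<xi>)" if "fib.z \<xi> \<noteq> 1" for \<xi>
      unfolding ode_def
    proof (intro conjI allI)
      show "u \<xi> (t + 2 * pi) = u \<xi> t" for t by (simp add: u_def wp)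
      fix t
      let ?e = "complex_of_real (exp (- (2 * \<epsilon>) * \<omega> (l1 \<xi>)))"
      have "(u \<xi> has_vector_derivative ?e / (\<i> * \<nu> \<xi>) * (- \<i> * (symb a b \<xi> t - \<nu> \<xi>) * w \<xi> t)) (at t)"
        unfolding u_def [abs_def] by (rule has_vector_derivative_mult_right [OF wd])
      moreover have "?e / (\<i> * \<nu> \<xi>) * (- \<i> * (symb a b \<xi> t - \<nu> \<xi>) * w \<xi> t) = f \<xi> t - \<i> * symb a b \<xi> t * u \<xi> t"
        unfolding f1 [OF that] u_def using nz [OF that] by (simp add: field_simps)
      ultimately show "(u \<xi> has_vector_derivative f \<xi> t - \<i> * symb a b \<xi> t * u \<xi> t) (at t)" by simp
    qed
    have "\<exists>v. ode (symb a b \<xi>) (f \<xi>) v" for \<xi>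
    proof (cases "fib.z \<xi> = 1")
      case True
      then show ?thesis by (intro exI [of _ "\<lambda>_. 0"]) (simp add: f0 ode_def)
    qed (use uode in blast)
    then obtain U where U: "\<And>\<xi>. \<exists>v. ode (symb a b \<xi>) (f \<xi>) v \<and> (\<forall>t. norm (v t) \<le> U)"
      using solvable_imp_bounded_solutions [OF solv dd C(2)] unfolding f_def by blast
    \<comment> \<open>At resonant frequencies a nonzero divisor is an integer, of modulus at least
      1; the constant 1 covers them and keeps \<open>U'\<close> positive.\<close>
    define U' where "U' = max U 1"
    have key: "exp (- (2 * \<epsilon>) * \<omega> (l1 \<xi>)) \<le> U' * norm (of_int \<tau> + wm \<xi>)" if tz: "of_int \<tau> + wm \<xi> \<noteq> 0" for \<tau> \<xi>
    proof (cases "fib.z \<xi> = 1")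
      case True
      then have "\<beta>m \<xi> = 0" "\<alpha>m \<xi> \<in> \<int>" by (simp_all add: fib_z_eq_1_iff)
      then obtain n :: int where n: "wm \<xi> = of_int n" by (auto simp: wm_def elim!: Ints_cases)
      have "1 \<le> norm (complex_of_int (\<tau> + n))"
        using tz unfolding n of_int_add [symmetric] norm_of_int by (simp add: of_int_eq_0_iff del: of_int_add)
      then have "1 \<le> norm (of_int \<tau> + wm \<xi>)" by (simp add: n)
      then have "1 * 1 \<le> U' * norm (of_int \<tau> + wm \<xi>)" unfolding U'_def by (intro mult_mono) auto
      moreover have "exp (- (2 * \<epsilon>) * \<omega> (l1 \<xi>)) \<le> 1" using \<epsilon> w_nonneg [of "l1 \<xi>"] by simp
      ultimately show ?thesis by linarith
    next
      case False
      obtain v where v: "ode (symb a b \<xi>) (f \<xi>) v" "\<And>t. norm (v t) \<le> U" using U by blast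
      have "v (t0 \<xi>) = u \<xi> (t0 \<xi>)" by (rule fib.ode_unique [unfolded fib_c, OF False v(1) uode [OF False]])
      then have "norm (u \<xi> (t0 \<xi>)) \<le> U" using v(2) by metis
      then have "exp (- (2 * \<epsilon>) * \<omega> (l1 \<xi>)) / norm (\<nu> \<xi>) \<le> U" by (simp add: u_def w1 norm_divide norm_mult)
      then have "exp (- (2 * \<epsilon>) * \<omega> (l1 \<xi>)) \<le> U * norm (\<nu> \<xi>)" using nz [OF False] by (simp add: divide_le_eq)
      also have "\<dots> \<le> U' * norm (of_int \<tau> + wm \<xi>)"
      proof (intro mult_mono)
        \<comment> \<open>Rounding minimises the real part, and the imaginary part does not involve
          \<tau>.\<close>
        have "\<bar>\<alpha>m \<xi> - of_int (round (\<alpha>m \<xi>))\<bar> \<le> \<bar>\<alpha>m \<xi> - of_int (- \<tau>)\<bar>" by (rule round_diff_minimal)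
        then show "norm (\<nu> \<xi>) \<le> norm (of_int \<tau> + wm \<xi>)"
          unfolding cmod_def by (intro real_sqrt_le_mono add_mono) (auto simp: \<nu>_def wm_def abs_le_square_iff add.commute)
      qed (auto simp: U'_def)
      finally show ?thesis .
    qed
    have "1 / U' > 0" by (simp add: U'_def)
    moreover have "let z = of_int \<tau> + (\<Sum>j\<in>UNIV. of_int (\<xi> j) * (complex_of_real (mean (a j)) + \<i> * complex_of_real (mean (b j))))
      in z \<noteq> 0 \<longrightarrow> 1 / U' * exp (- e * \<omega> (sqrt (real_of_int \<tau>^2 + (\<Sum>j\<in>UNIV. real_of_int (\<xi> j)^2)))) \<le> cmod z"
      for \<tau> :: int and \<xi> :: "'n \<Rightarrow> int"
      unfolding Let_def wm_eq [symmetric]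
    proof
      assume tz: "of_int \<tau> + wm \<xi> \<noteq> 0"
      let ?E = "sqrt (real_of_int \<tau>^2 + (\<Sum>j\<in>UNIV. real_of_int (\<xi> j)^2))"
      have "\<omega> (l1 \<xi>) \<le> \<omega> (real CARD('n) * ?E)" by (rule w_mono [OF l1_nonneg l1_le_euclid])
      also have "\<dots> \<le> (real CARD('n) + 1) * \<omega> ?E" by (rule w_scale) (auto intro!: add_nonneg_nonneg sum_nonneg)
      finally have "2 * \<epsilon> * \<omega> (l1 \<xi>) \<le> 2 * \<epsilon> * ((real CARD('n) + 1) * \<omega> ?E)" using \<epsilon> by simp
      also have "\<dots> = e * \<omega> ?E" by (simp add: \<epsilon>_def field_simps)
      finally have "exp (- e * \<omega> ?E) \<le> exp (- (2 * \<epsilon>) * \<omega> (l1 \<xi>))" by simp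
      also have "\<dots> \<le> U' * norm (of_int \<tau> + wm \<xi>)" by (rule key [OF tz])
      finally show "1 / U' * exp (- e * \<omega> ?E) \<le> norm (of_int \<tau> + wm \<xi>)"
        using \<open>1 / U' > 0\<close> by (simp add: divide_le_eq mult.commute)
    qed
    ultimately show "\<exists>C>0. \<forall>(\<tau>::int) (\<xi>::'n \<Rightarrow> int). let z = of_int \<tau> + (\<Sum>j\<in>UNIV. of_int (\<xi> j) * (complex_of_real (mean (a j)) + \<i> * complex_of_real (mean (b j))))
      in z \<noteq> 0 \<longrightarrow> C * exp (- e * \<omega> (sqrt (real_of_int \<tau>^2 + (\<Sum>j\<in>UNIV. real_of_int (\<xi> j)^2)))) \<le> cmod z"
      by (intro exI [of _ "1 / U'"] conjI allI)
  qed
qed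

theorem solvable_iff:
  "globally_solvable \<omega> (L_op a b) \<longleftrightarrow>
    (\<forall>\<xi>. changes_sign (dot \<xi> b) \<longrightarrow> \<beta>m \<xi> = 0 \<and> \<alpha>m \<xi> \<in> \<int> \<and> (\<forall>r. connected (Omega_set b \<xi> r))) \<and>
    EDC2 \<omega> (\<lambda>j. mean (a j)) (\<lambda>j. mean (b j))"
  using solvable_of_conditions sign_change_imp_resonant resonant_imp_connected EDC2_of_solvable fib_z_eq_1_iff by blast

end

theorem theorem2p2:
  fixes \<omega> :: "real \<Rightarrow> real" and a b :: "'n::finite \<Rightarrow> real \<Rightarrow> real"
  assumes "weight_function \<omega>" and "subadditive_weight \<omega>" and "non_quasianalytic \<omega>"
    and "\<forall>j. E_omega \<omega> (\<lambda>v::real^1. complex_of_real (a j (v $ 1)))"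
    and "\<forall>j. E_omega \<omega> (\<lambda>v::real^1. complex_of_real (b j (v $ 1)))"
  shows "globally_solvable \<omega> (L_op a b) \<longleftrightarrow>
    ((\<forall>\<xi>::'n \<Rightarrow> int. changes_sign (\<lambda>t. \<Sum>j\<in>UNIV. of_int (\<xi> j) * b j t) \<longrightarrow>
        (\<Sum>j\<in>UNIV. of_int (\<xi> j) * mean (b j)) = 0 \<and>
        (\<Sum>j\<in>UNIV. of_int (\<xi> j) * mean (a j)) \<in> \<int> \<and>
        (\<forall>r. connected (Omega_set b \<xi> r))) \<and>
     EDC2 \<omega> (\<lambda>j. mean (a j)) (\<lambda>j. mean (b j)))"
proof -
  interpret vector_field \<omega> a b by unfold_locales (use assms in auto)
  show ?thesis using solvable_iff unfolding dot_def [abs_def] \<beta>m_def \<alpha>m_def .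
qed

end
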